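(* Let $\rho_0\in \mathrm{BV}([0,L],[\rho_0^{\min},\rho_0^{\max}])$, $\mathrm{In}\in \mathrm{BV}([0,T],[f_{\min},f_{\max}])$ and $f^*\in \mathrm{BV}([0,T],[f_{\min},f_{\max}])$, where $0<\rho_0^{\min}\le\rho_0^{\max}\le\rho_{\mathrm{cr}}$, $0<f_{\min}\le f_{\max}$, $\rho_0^{\min}\le f_{\min}/v_{\max}$ and $\rho_0^{\max}\ge f_{\max}/v_{\min}$, and let $K>0$. Then there exists a control policy $v\in \mathrm{BV}([0,T],[v_{\min},v_{\max}])$ with $\mathrm{TV}(v)\le K$ which minimizes, among all $v\in \mathrm{BV}([0,T],[v_{\min},v_{\max}])$ with $\mathrm{TV}(v)\le K$, the functional $$J(v)=\int_0^T\big(\mathrm{Out}(t)-f^*(t)\big)^2\,dt,$$ where $\mathrm{Out}$ is the outflow associated with the control policy $v$.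
   Context: Fix $L>0$, $T>0$, $0<v_{\min}\le v_{\max}$ and $0<\rho_{\mathrm{cr}}<\rho_{\max}$. The Newell–Daganzo flux $f:[0,\rho_{\max}]\times[v_{\min},v_{\max}]\to[0,\infty)$ is $$f(\rho,v)=\begin{cases}\rho v,&0\le\rho\le\rho_{\mathrm{cr}},\\ \dfrac{v\,\rho_{\mathrm{cr}}}{\rho_{\max}-\rho_{\mathrm{cr}}}(\rho_{\max}-\rho),&\rho_{\mathrm{cr}}<\rho\le\rho_{\max}.\end{cases}$$ $\mathrm{BV}(I,E)$ denotes the functions of bounded variation on the interval $I$ with values in $E$, and $\mathrm{TV}$ the total variation. For a control policy $v\in \mathrm{BV}([0,T],[v_{\min},v_{\max}])$, let $\rho$ be the unique (Kruzhkov) entropy solution on $[0,T]\times[0,L]$, with values in $[0,\rho_{\max}]$, of $$\rho_t+f(\rho,v(t))_x=0,\qquad \rho(0,x)=\rho_0(x),\qquad f_l(t)=\mathrm{In}(t),\qquad f_r(t)=\rho(t,L)\,v(t),$$ where the left flow condition is understood equivalently as the boundary condition $\rho(t,0)=\mathrm{In}(t)/v(t)$, and $f_r$ is the flow at the right end $x=L$ (Neumann/free outflow condition). This solution satisfies $\rho\le\rho_{\mathrm{cr}}$. The outflow is $\mathrm{Out}(t)=\rho(t,L)\,v(t)$ (trace at $x=L$ from inside). With $t_0$ defined by $\int_0^{t_0}v(s)\,ds=L$ and, for $t\ge t_0$, $\tau(t)$ defined by $\int_{\tau(t)}^tv(s)\,ds=L$, the outflow is $\mathrm{Out}(t)=\mathrm{In}(\tau(t))\,v(t)/v(\tau(t))$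 for (almost every) $t\in[t_0,T]$. *)

theory Defs
  imports "HOL-Analysis.Analysis"
begin

section \<open>Functions of bounded variation\<close>

text \<open>Pointwise (not essential) variation. A partition \<open>p 0 \<le> \<dots> \<le> p n\<close> of \<open>[a,b]\<close> is represented by
  the monotone sequence that extends it beyond index \<open>n\<close>.\<close>

definition total_variation :: "real \<Rightarrow> real \<Rightarrow> (real \<Rightarrow> real) \<Rightarrow> ereal" where
  "total_variation a b g =
     (SUP (n, p) \<in> {(n::nat, p::nat \<Rightarrow> real). mono p \<and> range p \<subseteq> {a..b}}.
        ereal (\<Sum>i<n. \<bar>g (p (Suc i)) - g (p i)\<bar>))"

definition BV :: "real \<Rightarrow> real \<Rightarrow> real set \<Rightarrow> (real \<Rightarrow> real) set" where
  "BV a b E = {g. g ` {a..b} \<subseteq> E \<and> total_variation a b g < \<infinity>}"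


section \<open>The initial-boundary value problem\<close>

definition newell_daganzo_flux :: "real \<Rightarrow> real \<Rightarrow> real \<Rightarrow> real \<Rightarrow> real" where
  "newell_daganzo_flux \<rho>cr \<rho>max r w =
     (if r \<le> \<rho>cr then r * w else w * \<rho>cr / (\<rho>max - \<rho>cr) * (\<rho>max - r))"

text \<open>\<open>L1_trace u s\<^sub>0 S I g\<close>: the strong trace \<open>ess lim u s = g\<close> in \<open>L\<^sup>1(I)\<close> as \<open>s\<close> tends to \<open>s\<^sub>0\<close> within
  \<open>S\<close>. The exceptional null set \<open>N\<close> makes the notion independent of the representative of \<open>u\<close>.
  Integrability of \<open>g\<close> is required since the Bochner integral of a non-integrable function is 0.\<close>

definition L1_trace ::
  "(real \<Rightarrow> real \<Rightarrow> real) \<Rightarrow> real \<Rightarrow> real set \<Rightarrow> real set \<Rightarrow> (real \<Rightarrow> real) \<Rightarrow> bool" where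
  "L1_trace u s\<^sub>0 S I g \<longleftrightarrow>
     set_integrable lborel I g \<and>
     (\<exists>N \<in> null_sets lborel. ((\<lambda>s. LINT y:I|lborel. \<bar>u s y - g y\<bar>) \<longlongrightarrow> 0) (at s\<^sub>0 within (S - N)))"

abbreviation initial_trace :: "real \<Rightarrow> real \<Rightarrow> (real \<Rightarrow> real \<Rightarrow> real) \<Rightarrow> (real \<Rightarrow> real) \<Rightarrow> bool" where
  "initial_trace L T \<rho> \<equiv> L1_trace \<rho> 0 {0<..<T} {0..L}"

abbreviation left_trace :: "real \<Rightarrow> real \<Rightarrow> (real \<Rightarrow> real \<Rightarrow> real) \<Rightarrow> (real \<Rightarrow> real) \<Rightarrow> bool" where
  "left_trace L T \<rho> \<equiv> L1_trace (\<lambda>x t. \<rho> t x) 0 {0<..<L} {0..T}"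

abbreviation right_trace :: "real \<Rightarrow> real \<Rightarrow> (real \<Rightarrow> real \<Rightarrow> real) \<Rightarrow> (real \<Rightarrow> real) \<Rightarrow> bool" where
  "right_trace L T \<rho> \<equiv> L1_trace (\<lambda>x t. \<rho> t x) L {0<..<L} {0..T}"

text \<open>Nonnegative \<open>C\<^sup>1\<close> functions with compact support in the open rectangle \<open>(0,T) \<times> (0,L)\<close>,
  together with their partial derivatives in \<open>t\<close> and \<open>x\<close>.\<close>

definition test_function ::
  "real \<Rightarrow> real \<Rightarrow> (real \<times> real \<Rightarrow> real) \<Rightarrow> (real \<times> real \<Rightarrow> real) \<Rightarrow> (real \<times> real \<Rightarrow> real) \<Rightarrow> bool" where
  "test_function L T \<phi> \<phi>t \<phi>x \<longleftrightarrow>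
     (\<forall>z. 0 \<le> \<phi> z) \<and>
     (\<forall>z. (\<phi> has_derivative (\<lambda>h. \<phi>t z * fst h + \<phi>x z * snd h)) (at z)) \<and>
     continuous_on UNIV \<phi>t \<and> continuous_on UNIV \<phi>x \<and>
     (\<exists>C. compact C \<and> C \<subseteq> {0<..<T} \<times> {0<..<L} \<and> (\<forall>z. z \<notin> C \<longrightarrow> \<phi> z = 0))"

text \<open>Kruzhkov entropy inequalities in the interior. They carry no source term because the flux
  depends on \<open>t\<close> but not explicitly on \<open>x\<close>.\<close>

definition kruzhkov_inequalities ::
  "real \<Rightarrow> real \<Rightarrow> real \<Rightarrow> real \<Rightarrow> (real \<Rightarrow> real) \<Rightarrow> (real \<Rightarrow> real \<Rightarrow> real) \<Rightarrow> bool" where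
  "kruzhkov_inequalities L T \<rho>cr \<rho>max v \<rho> \<longleftrightarrow>
     (\<forall>k \<in> {0..\<rho>max}. \<forall>\<phi> \<phi>t \<phi>x. test_function L T \<phi> \<phi>t \<phi>x \<longrightarrow>
        0 \<le> (LINT (t, x) : {0..T} \<times> {0..L} | lborel.
               \<bar>\<rho> t x - k\<bar> * \<phi>t (t, x)
               + sgn (\<rho> t x - k)
                 * (newell_daganzo_flux \<rho>cr \<rho>max (\<rho> t x) (v t) - newell_daganzo_flux \<rho>cr \<rho>max k (v t))
                 * \<phi>x (t, x)))"

text \<open>The condition at \<open>x = L\<close> is the outflow condition \<open>f_r(t) = \<rho>(t,L) v(t)\<close>: the flow \<open>f(r,v)\<close> through
  the right end, computed from the trace \<open>r\<close>, equals \<open>r v\<close>, so no congestion enters from the right.\<close>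

definition entropy_solution ::
  "real \<Rightarrow> real \<Rightarrow> real \<Rightarrow> real \<Rightarrow> (real \<Rightarrow> real) \<Rightarrow> (real \<Rightarrow> real) \<Rightarrow> (real \<Rightarrow> real) \<Rightarrow>
   (real \<Rightarrow> real \<Rightarrow> real) \<Rightarrow> bool" where
  "entropy_solution L T \<rho>cr \<rho>max \<rho>0 In v \<rho> \<longleftrightarrow>
     set_borel_measurable lborel ({0..T} \<times> {0..L}) (\<lambda>(t, x). \<rho> t x) \<and>
     (\<forall>t \<in> {0..T}. \<forall>x \<in> {0..L}. \<rho> t x \<in> {0..\<rho>max}) \<and>
     kruzhkov_inequalities L T \<rho>cr \<rho>max v \<rho> \<and>
     initial_trace L T \<rho> \<rho>0 \<and>
     left_trace L T \<rho> (\<lambda>t. In t / v t) \<and>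
     (\<exists>r. right_trace L T \<rho> r \<and>
        (AE t in lborel. t \<in> {0..T} \<longrightarrow> newell_daganzo_flux \<rho>cr \<rho>max (r t) (v t) = r t * v t))"


section \<open>Outflow and cost functional\<close>

text \<open>The entropy solution and its trace at \<open>x = L\<close> are unique up to null sets; \<open>SOME\<close> picks
  representatives, on which the cost does not depend.\<close>

definition outflow ::
  "real \<Rightarrow> real \<Rightarrow> real \<Rightarrow> real \<Rightarrow> (real \<Rightarrow> real) \<Rightarrow> (real \<Rightarrow> real) \<Rightarrow> (real \<Rightarrow> real) \<Rightarrow> real \<Rightarrow> real" where
  "outflow L T \<rho>cr \<rho>max \<rho>0 In v =
     (let \<rho> = (SOME \<rho>. entropy_solution L T \<rho>cr \<rho>max \<rho>0 In v \<rho>);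
          r = (SOME r. right_trace L T \<rho> r)
      in (\<lambda>t. r t * v t))"

definition cost ::
  "real \<Rightarrow> real \<Rightarrow> real \<Rightarrow> real \<Rightarrow> (real \<Rightarrow> real) \<Rightarrow> (real \<Rightarrow> real) \<Rightarrow> (real \<Rightarrow> real) \<Rightarrow> (real \<Rightarrow> real) \<Rightarrow> real" where
  "cost L T \<rho>cr \<rho>max \<rho>0 In fstar v =
     (LINT t:{0..T}|lborel. (outflow L T \<rho>cr \<rho>max \<rho>0 In v t - fstar t)\<^sup>2)"

end

theory Submission
  imports Defs "HOL-Complex_Analysis.Great_Picard"
begin

text \<open>Any entropy solution stays in free flow: the congestion \<open>(\<rho> - \<rho>cr)\<^sup>+\<close> moves to the left, so none can
  enter. Hence it solves a linear transport equation, and testing with functions of \<open>V t - x\<close>, where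
  \<open>V\<close> is the primitive of \<open>v\<close>, determines the cumulative outflow from the data. No uniqueness theorem for
  entropy solutions is needed; existence is given by the explicit solution along characteristics.

  The cumulative outflow depends on \<open>v\<close> only through \<open>V\<close>. Along a minimizing sequence Helly's theorem
  yields pointwise convergence of \<open>v\<close>, hence of \<open>V\<close> and of the cumulative outflows. So the outflows
  converge weakly, and convexity of the square makes the cost lower semicontinuous.\<close>

section \<open>Functions of bounded variation and Helly's selection theorem\<close>

text \<open>Three obstacles shape the proof. The outflow is picked by \<open>SOME\<close>, so every
  statement about it has to hold for an arbitrary entropy solution and an arbitrary trace. The
  entropy inequalities only admit test functions supported in the open rectangle, while the data
  appear as \<open>L\<^sup>1\<close> traces; boundary layers join the two, the derivatives of
  cutoffs acting as approximate Dirac masses on the sides t = 0, x = 0 and x = L. Finally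
  \<open>v\<close> may jump, so \<open>V\<close> is only Lipschitz and a function of
  \<open>V t - x\<close> is not an admissible test function; averages of \<open>V\<close> replace
  it, with an error that vanishes almost everywhere because \<open>v\<close> has only countably many
  discontinuities. The cumulative outflow is used instead of the explicit formula because the latter
  contains \<open>v\<close> at the delayed time and would require convergence of compositions; the
  former integrates fixed data over sets whose boundary moves continuously with \<open>V\<close>.
  All data are extended to the line by their end values. This leaves the cost unchanged, gives
  global bounds and makes \<open>V\<close> a bijection of the line.\<close>

lemma total_variation_ge_partition:
  assumes "mono p" "range p \<subseteq> {a..b}"
  shows "ereal (\<Sum>i<n. \<bar>g (p (Suc i)) - g (p i)\<bar>) \<le> total_variation a b g"
  unfolding total_variation_def using assms by (intro SUP_upper2[where i="(n, p)"]) auto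

lemma total_variation_le_iff:
  "total_variation a b g \<le> ereal K \<longleftrightarrow>
     (\<forall>n p. mono p \<longrightarrow> range p \<subseteq> {a..b} \<longrightarrow> (\<Sum>i<n. \<bar>g (p (Suc i)) - g (p i)\<bar>) \<le> K)"
  unfolding total_variation_def SUP_le_iff by auto

lemma total_variation_nonneg:
  assumes "a \<le> b" shows "0 \<le> total_variation a b g"
  using total_variation_ge_partition[of "\<lambda>_. a" a b g 0] assms by (auto simp: mono_def zero_ereal_def)

text \<open>This is what makes both the variation function and its difference with \<open>g\<close>
  monotone in the Jordan decomposition.\<close>

lemma total_variation_step:
  assumes "a \<le> x" "x \<le> y"
  shows "total_variation a x g + ereal \<bar>g y - g x\<bar> \<le> total_variation a y g"
proof -
  have "total_variation a x g \<le> total_variation a y g - ereal \<bar>g y - g x\<bar>"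
    unfolding total_variation_def[of a x]
  proof (rule SUP_least, clarsimp)
    fix n and p :: "nat \<Rightarrow> real"
    assume p: "mono p" "range p \<subseteq> {a..x}"
    \<comment> \<open>The partition of [a,x] is prolonged by x and then by y; the additional jump
      from \<open>p n\<close> to x can only increase the sum.\<close>
    define q where "q i = (if i \<le> n then p i else if i = Suc n then x else y)" for i
    have *: "a \<le> p i \<and> p i \<le> x \<and> p i \<le> y" for i
      using subsetD[OF p(2) rangeI, of i] assms by auto
    have "mono q"
      using p(1) * assms by (auto simp: mono_def q_def le_Suc_eq not_le intro: order_trans)
    moreover have "range q \<subseteq> {a..y}"
      using * assms by (auto simp: q_def intro: order_trans)
    ultimately have "ereal (\<Sum>i<Suc (Suc n). \<bar>g (q (Suc i)) - g (q i)\<bar>) \<le> total_variation a y g"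
      by (rule total_variation_ge_partition)
    moreover have "(\<Sum>i<n. \<bar>g (q (Suc i)) - g (q i)\<bar>) = (\<Sum>i<n. \<bar>g (p (Suc i)) - g (p i)\<bar>)"
      by (intro sum.cong) (auto simp: q_def)
    ultimately have "ereal ((\<Sum>i<n. \<bar>g (p (Suc i)) - g (p i)\<bar>) + \<bar>g x - g (p n)\<bar> + \<bar>g y - g x\<bar>)
        \<le> total_variation a y g"
      by (simp add: q_def)
    then have "ereal ((\<Sum>i<n. \<bar>g (p (Suc i)) - g (p i)\<bar>) + \<bar>g y - g x\<bar>) \<le> total_variation a y g"
      by (rule order_trans[rotated]) simp
    then show "ereal (\<Sum>i<n. \<bar>g (p (Suc i)) - g (p i)\<bar>) \<le> total_variation a y g - ereal \<bar>g y - g x\<bar>"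
      by (simp add: ereal_le_minus)
  qed
  then show ?thesis by (simp add: ereal_le_minus)
qed

text \<open>Membership in \<open>BV\<close> restricts a function on [a,b] only. Continuing it by its
  end values keeps bounds and variation and allows the use of facts about monotone functions on the
  whole line.\<close>

definition clamp_ext :: "real \<Rightarrow> real \<Rightarrow> (real \<Rightarrow> real) \<Rightarrow> real \<Rightarrow> real" where
  "clamp_ext a b g x = g (max a (min b x))"

lemma clamp_ext_eq [simp]: "x \<in> {a..b} \<Longrightarrow> clamp_ext a b g x = g x"
  by (auto simp: clamp_ext_def min_def max_def)

lemma clamp_ext_in: "a \<le> b \<Longrightarrow> g ` {a..b} \<subseteq> E \<Longrightarrow> clamp_ext a b g x \<in> E"
  by (auto simp: clamp_ext_def image_subset_iff)

text \<open>Jordan decomposition with the variation function as \<open>P\<close> and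
  \<open>P - g\<close> as \<open>Q\<close>. The bound on \<open>P\<close> depends on the variation
  only, which Helly's theorem needs.\<close>

lemma clamp_ext_mono_decomp:
  assumes "a \<le> b" and fin: "total_variation a b g \<le> ereal K"
  obtains P Q where "mono P" "mono Q" "\<And>x. clamp_ext a b g x = P x - Q x"
    "\<And>x. 0 \<le> P x" "\<And>x. P x \<le> K"
proof -
  define c where "c x = max a (min b x)" for x
  have c: "a \<le> c x" "c x \<le> b" for x using assms by (auto simp: c_def)
  have cm: "x \<le> y \<Longrightarrow> c x \<le> c y" for x y by (auto simp: c_def max_def min_def)
  define P where "P x = real_of_ereal (total_variation a (c x) g)" for x
  have le: "total_variation a (c x) g \<le> ereal K" for x
  proof -
    have "total_variation a (c x) g \<le> total_variation a (c x) g + ereal \<bar>g b - g (c x)\<bar>"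
      by (simp add: ereal_le_add_self)
    then show ?thesis using total_variation_step[OF c, of x g] fin by (meson order_trans)
  qed
  have ge: "0 \<le> total_variation a (c x) g" for x
    using c by (intro total_variation_nonneg) auto
  have eq: "total_variation a (c x) g = ereal (P x)" for x
    unfolding P_def using le[of x] ge[of x] by (cases "total_variation a (c x) g") auto
  have step: "P x + \<bar>g (c y) - g (c x)\<bar> \<le> P y" if "x \<le> y" for x y
    using total_variation_step[OF c(1) cm[OF that], of g] by (simp add: eq)
  show thesis
  proof
    show "mono P" by (rule monoI) (use step in \<open>smt (verit)\<close>)
    show "mono (\<lambda>x. P x - g (c x))" by (rule monoI) (use step in \<open>smt (verit)\<close>)
    show "clamp_ext a b g x = P x - (P x - g (c x))" for x by (simp add: clamp_ext_def c_def)
    show "0 \<le> P x" "P x \<le> K" for x using le[of x] ge[of x] by (simp_all add: eq)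
  qed
qed

lemma clamp_ext_BV:
  assumes "a \<le> b" "g \<in> BV a b E"
  shows "clamp_ext a b g \<in> borel_measurable borel"
    and "countable {x. \<not> isCont (clamp_ext a b g) x}"
proof -
  obtain K where "total_variation a b g \<le> ereal K"
    using assms by (cases "total_variation a b g") (auto simp: BV_def)
  from clamp_ext_mono_decomp[OF assms(1) this]
  obtain P Q where PQ: "mono P" "mono Q" "\<And>x. clamp_ext a b g x = P x - Q x" by metis
  have eq: "clamp_ext a b g = (\<lambda>x. P x - Q x)" using PQ(3) by auto
  show "clamp_ext a b g \<in> borel_measurable borel"
    unfolding eq using PQ by (intro borel_measurable_diff borel_measurable_mono)
  have "{x. \<not> isCont (clamp_ext a b g) x} \<subseteq> {x. \<not> isCont P x} \<union> {x. \<not> isCont Q x}"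
    unfolding eq by (auto intro: continuous_diff)
  then show "countable {x. \<not> isCont (clamp_ext a b g) x}"
    using mono_ctble_discont[OF PQ(1)] mono_ctble_discont[OF PQ(2)]
    by (meson countable_Un countable_subset)
qed

text \<open>For a fixed partition the sum of jumps is continuous under pointwise convergence, and a
  supremum of such sums is lower semicontinuous.\<close>

lemma total_variation_limit_le:
  assumes lim: "\<And>x. x \<in> {a..b} \<Longrightarrow> (\<lambda>n. f n x) \<longlonglongrightarrow> g x"
    and le: "\<And>n. total_variation a b (f n) \<le> ereal K"
  shows "total_variation a b g \<le> ereal K"
  unfolding total_variation_le_iff
proof (intro allI impI)
  fix n and p :: "nat \<Rightarrow> real"
  assume p: "mono p" "range p \<subseteq> {a..b}"
  have "(\<lambda>m. \<Sum>i<n. \<bar>f m (p (Suc i)) - f m (p i)\<bar>) \<longlonglongrightarrow> (\<Sum>i<n. \<bar>g (p (Suc i)) - g (p i)\<bar>)"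
    by (intro tendsto_sum tendsto_rabs tendsto_diff lim subsetD[OF p(2)] rangeI)
  moreover have "(\<Sum>i<n. \<bar>f m (p (Suc i)) - f m (p i)\<bar>) \<le> K" for m
    using le[of m] p unfolding total_variation_le_iff by blast
  ultimately show "(\<Sum>i<n. \<bar>g (p (Suc i)) - g (p i)\<bar>) \<le> K"
    by (intro LIMSEQ_le_const2) auto
qed

text \<open>A diagonal subsequence converges at all rationals. Monotonicity squeezes the values at a
  continuity point of the limit between those at nearby rationals; the countably many remaining
  points are handled by a second diagonal extraction.\<close>

lemma Helly_selection_mono:
  fixes f :: "nat \<Rightarrow> real \<Rightarrow> real"
  assumes mono: "\<And>n. mono (f n)" and bd: "\<And>n x. \<bar>f n x\<bar> \<le> B"
  obtains k where "strict_mono (k :: nat \<Rightarrow> nat)" "\<And>x. convergent (\<lambda>n. f (k n) x)"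
proof -
  obtain k1 where k1: "strict_mono (k1 :: nat \<Rightarrow> nat)"
      "\<And>x. x \<in> \<rat> \<Longrightarrow> \<exists>l. (\<lambda>n. f (k1 n) x) \<longlonglongrightarrow> l"
    using function_convergent_subsequence[of "\<rat> :: real set" f B] bd countable_rat by auto
  define l where "l x = lim (\<lambda>n. f (k1 n) x)" for x
  have l: "(\<lambda>n. f (k1 n) q) \<longlonglongrightarrow> l q" if "q \<in> \<rat>" for q
    using k1(2)[OF that] by (auto simp: l_def limI)
  have lb: "\<bar>l q\<bar> \<le> B" if "q \<in> \<rat>" for q
    using LIMSEQ_le_const2[OF tendsto_rabs[OF l[OF that]]] bd by auto
  \<comment> \<open>A monotone candidate for the limit. At its discontinuities it need not be the
    limit, but there are only countably many of them.\<close>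
  define h where "h x = (INF q\<in>\<rat> \<inter> {x<..}. l q)" for x
  have ne: "\<rat> \<inter> {x<..} \<noteq> {}" for x :: real
    using Rats_dense_in_real[of x "x + 1"] by auto
  have bb: "bdd_below (l ` (\<rat> \<inter> {x<..}))" for x
    using lb by (intro bdd_belowI2[where m="-B"]) (auto simp: abs_le_iff minus_le_iff)
  have "mono h"
    unfolding h_def by (intro monoI cINF_superset_mono ne bb) auto
  have cont: "convergent (\<lambda>n. f (k1 n) x)" if "isCont h x" for x
  proof -
    have "(\<lambda>n. f (k1 n) x) \<longlonglongrightarrow> h x"
    proof (rule LIMSEQ_I)
      fix e :: real assume "0 < e"
      from that[unfolded continuous_at_eps_delta, rule_format, OF this]
      obtain d where d: "0 < d" "\<And>y. \<bar>y - x\<bar> < d \<Longrightarrow> \<bar>h y - h x\<bar> < e"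
        by (auto simp: dist_real_def)
      obtain q where q: "q \<in> \<rat>" "x - d/2 < q" "q < x"
        using Rats_dense_in_real[of "x - d/2" x] d by auto
      \<comment> \<open>The rational q lies to the right of x - d/2, hence \<open>l q\<close> is one
        of the values in the infimum that defines \<open>h (x - d/2)\<close>.\<close>
      have "h (x - d/2) \<le> l q" unfolding h_def by (rule cINF_lower[OF bb]) (use q in auto)
      with d(2)[of "x - d/2"] d(1) have 1: "h x - e < l q" by auto
      have "\<exists>q'\<in>\<rat> \<inter> {x<..}. l q' < h x + e"
        using cINF_less_iff[OF ne bb, of x "h x + e"] \<open>0 < e\<close> unfolding h_def[symmetric] by auto
      then obtain q' where q': "q' \<in> \<rat>" "x < q'" "l q' < h x + e" by auto
      have "\<forall>\<^sub>F n in sequentially. h x - e < f (k1 n) q"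
        using order_tendstoD(1)[OF l[OF q(1)] 1] .
      moreover have "\<forall>\<^sub>F n in sequentially. f (k1 n) q' < h x + e"
        using order_tendstoD(2)[OF l[OF q'(1)] q'(3)] .
      ultimately have "\<forall>\<^sub>F n in sequentially. norm (f (k1 n) x - h x) < e"
      proof eventually_elim
        case (elim n)
        have "f (k1 n) q \<le> f (k1 n) x" "f (k1 n) x \<le> f (k1 n) q'"
          using q q' by (auto intro!: monoD[OF mono])
        with elim show ?case by (auto simp: abs_less_iff)
      qed
      then show "\<exists>no. \<forall>n\<ge>no. norm (f (k1 n) x - h x) < e"
        by (simp add: eventually_sequentially)
    qed
    then show ?thesis by (auto simp: convergent_def)
  qed
  obtain k2 where k2: "strict_mono (k2 :: nat \<Rightarrow> nat)"
      "\<And>x. x \<in> {x. \<not> isCont h x} \<Longrightarrow> \<exists>l. (\<lambda>n. f (k1 (k2 n)) x) \<longlonglongrightarrow> l"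
    using function_convergent_subsequence[of "{x. \<not> isCont h x}" "\<lambda>n. f (k1 n)" B]
      mono_ctble_discont[OF \<open>mono h\<close>] bd by auto
  show thesis
  proof
    show "strict_mono (k1 \<circ> k2)" using k1 k2 by (simp add: strict_mono_o)
    show "convergent (\<lambda>n. f ((k1 \<circ> k2) n) x)" for x
    proof (cases "isCont h x")
      case True
      from convergent_subseq_convergent[OF cont[OF this] k2(1)] show ?thesis by (simp add: o_def)
    next
      case False
      with k2(2)[of x] show ?thesis by (auto simp: convergent_def)
    qed
  qed
qed

text \<open>Both parts of the Jordan decomposition are bounded uniformly in n, so the monotone case
  applies to \<open>P\<close> and then, along the subsequence found, to \<open>Q\<close>.\<close>

lemma Helly_selection_BV:
  fixes f :: "nat \<Rightarrow> real \<Rightarrow> real"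
  assumes ab: "a \<le> b" and rng: "\<And>n. f n ` {a..b} \<subseteq> {c..d}"
    and le: "\<And>n. total_variation a b (f n) \<le> ereal K"
  obtains k g where "strict_mono (k :: nat \<Rightarrow> nat)" "\<And>x. x \<in> {a..b} \<Longrightarrow> (\<lambda>n. f (k n) x) \<longlonglongrightarrow> g x"
    "g ` {a..b} \<subseteq> {c..d}" "total_variation a b g \<le> ereal K"
proof -
  have "\<forall>n. \<exists>P Q. mono P \<and> mono Q \<and> (\<forall>x. clamp_ext a b (f n) x = P x - Q x) \<and>
      (\<forall>x. 0 \<le> P x) \<and> (\<forall>x. P x \<le> K)"
    using clamp_ext_mono_decomp[OF ab le] by metis
  then obtain P Q where PQ: "\<And>n. mono (P n)" "\<And>n. mono (Q n)"
      "\<And>n x. clamp_ext a b (f n) x = P n x - Q n x" "\<And>n x. 0 \<le> P n x" "\<And>n x. P n x \<le> K"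
    by metis
  have f: "c \<le> clamp_ext a b (f n) x \<and> clamp_ext a b (f n) x \<le> d" for n x
    using clamp_ext_in[OF ab rng, of n x] by auto
  have Pb: "\<bar>P n x\<bar> \<le> K" for n x using PQ(4,5) by (smt (verit))
  have Qb: "\<bar>Q n x\<bar> \<le> K + \<bar>c\<bar> + \<bar>d\<bar>" for n x using PQ(3,4,5) f by (smt (verit))
  obtain k1 where k1: "strict_mono (k1 :: nat \<Rightarrow> nat)" "\<And>x. convergent (\<lambda>n. P (k1 n) x)"
    using Helly_selection_mono[of P, OF PQ(1) Pb] by metis
  obtain k2 where k2: "strict_mono (k2 :: nat \<Rightarrow> nat)" "\<And>x. convergent (\<lambda>n. Q (k1 (k2 n)) x)"
    using Helly_selection_mono[of "\<lambda>n. Q (k1 n)", OF PQ(2) Qb] by metis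
  have "convergent (\<lambda>n. clamp_ext a b (f (k1 (k2 n))) x)" for x
    unfolding PQ(3)
    using convergent_subseq_convergent[OF k1(2) k2(1), of x] k2(2)[of x]
    by (intro convergent_diff) (simp_all add: o_def)
  then obtain g where g: "\<And>x. (\<lambda>n. clamp_ext a b (f (k1 (k2 n))) x) \<longlonglongrightarrow> g x"
    unfolding convergent_def by metis
  show thesis
  proof (rule that)
    show "strict_mono (k1 \<circ> k2)" using k1 k2 by (simp add: strict_mono_o)
    show lim: "(\<lambda>n. f ((k1 \<circ> k2) n) x) \<longlonglongrightarrow> g x" if "x \<in> {a..b}" for x
      using g[of x] that by simp
    have "c \<le> g x" "g x \<le> d" for x
      using f by (auto intro!: LIMSEQ_le_const[OF g] LIMSEQ_le_const2[OF g])
    then show "g ` {a..b} \<subseteq> {c..d}" by auto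
    show "total_variation a b g \<le> ereal K"
      by (rule total_variation_limit_le[OF lim]) (use le in auto)
  qed
qed

section \<open>Integrals over bounded sets\<close>

lemma set_integrable_bounded:
  fixes f :: "'a::euclidean_space \<Rightarrow> real"
  assumes "A \<in> sets borel" "emeasure lborel A < \<infinity>" "f \<in> borel_measurable borel"
    and "\<And>x. x \<in> A \<Longrightarrow> \<bar>f x\<bar> \<le> B"
  shows "set_integrable lborel A f"
  unfolding set_integrable_def
  by (rule integrableI_bounded_set_indicator[where B=B]) (use assms in auto)

lemma set_integrable_Icc_bounded:
  fixes g :: "real \<Rightarrow> real"
  assumes "g \<in> borel_measurable borel" and "\<And>y. \<bar>g y\<bar> \<le> C"
  shows "set_integrable lborel {a..b} g"
  by (rule set_integrable_bounded[OF _ _ assms]) (auto intro: emeasure_lborel_Icc_eq[THEN ord_eq_less_trans])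

lemma set_integral_dominated_bounded:
  fixes f :: "'a::euclidean_space \<Rightarrow> real"
  assumes A: "A \<in> sets borel" "emeasure lborel A < \<infinity>"
    and [measurable]: "f \<in> borel_measurable borel" "\<And>n. s n \<in> borel_measurable borel"
    and bd: "\<And>n x. x \<in> A \<Longrightarrow> \<bar>s n x\<bar> \<le> B"
    and lim: "AE x in lborel. x \<in> A \<longrightarrow> (\<lambda>n. s n x) \<longlonglongrightarrow> f x"
  shows "(\<lambda>n. LINT x:A|lborel. s n x) \<longlonglongrightarrow> (LINT x:A|lborel. f x)"
  unfolding set_lebesgue_integral_def
proof (rule integral_dominated_convergence[where w="\<lambda>x. indicator A x * B"])
  have [measurable]: "A \<in> sets borel" by fact
  show "integrable lborel (\<lambda>x. indicator A x * B)"
    using A by (intro integrable_mult_left) (simp add: integrable_indicator_iff)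
  show "AE x in lborel. (\<lambda>n. indicator A x *\<^sub>R s n x) \<longlonglongrightarrow> indicator A x *\<^sub>R f x"
    using lim by eventually_elim (auto simp: indicator_def)
  show "AE x in lborel. norm (indicator A x *\<^sub>R s n x) \<le> indicator A x * B" for n
    using bd by (auto simp: indicator_def)
  show "(\<lambda>x. indicator A x *\<^sub>R f x) \<in> borel_measurable lborel"
       "(\<lambda>x. indicator A x *\<^sub>R s n x) \<in> borel_measurable lborel" for n
    by measurable
qed

lemma emeasure_lborel_rect:
  fixes a b c d :: real
  shows "emeasure lborel ({a..b} \<times> {c..d}) < \<infinity>" "{a..b} \<times> {c..d} \<in> sets borel"
proof -
  have eq: "{a..b} \<times> {c..d} = cbox (a, c) (b, d)" by (auto simp: cbox_Pair_eq)
  show "emeasure lborel ({a..b} \<times> {c..d}) < \<infinity>" "{a..b} \<times> {c..d} \<in> sets borel"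
    unfolding eq using emeasure_lborel_cbox_finite by auto
qed

lemma measurable_projections_borel [measurable]:
  "(fst :: real \<times> real \<Rightarrow> real) \<in> borel_measurable borel"
  "(snd :: real \<times> real \<Rightarrow> real) \<in> borel_measurable borel"
  by (intro borel_measurable_continuous_onI continuous_intros)+

text \<open>A null set of the line times the line is a null set of the plane.\<close>

lemma AE_lborel_projections:
  assumes "AE t in lborel. P t"
  shows "AE z in lborel. P (fst (z :: real \<times> real))" "AE z in lborel. P (snd (z :: real \<times> real))"
proof -
  obtain N where N: "{t. \<not> P t} \<subseteq> N" "N \<in> null_sets lborel"
    using assms unfolding eventually_ae_filter by auto
  have "N \<times> (UNIV :: real set) \<in> null_sets (lborel \<Otimes>\<^sub>M lborel)"
    "(UNIV :: real set) \<times> N \<in> null_sets (lborel \<Otimes>\<^sub>M lborel)"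
    using N(2) by (intro null_setsI pair_measureI; simp add: lborel.emeasure_pair_measure_Times null_sets_def)+
  then have N': "N \<times> (UNIV :: real set) \<in> null_sets lborel" "(UNIV :: real set) \<times> N \<in> null_sets lborel"
    by (simp_all only: lborel_prod)
  show "AE z in lborel. P (fst (z :: real \<times> real))" by (rule AE_I'[OF N'(1)]) (use N(1) in auto)
  show "AE z in lborel. P (snd (z :: real \<times> real))" by (rule AE_I'[OF N'(2)]) (use N(1) in auto)
qed

lemma measurable_slices:
  fixes f :: "real \<times> real \<Rightarrow> real"
  assumes "f \<in> borel_measurable borel"
  shows "(\<lambda>x. f (t, x)) \<in> borel_measurable borel" "(\<lambda>t. f (t, x)) \<in> borel_measurable borel"
  by (rule measurable_compose[OF _ assms], intro borel_measurable_continuous_onI continuous_intros)+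

lemma set_Fubini:
  fixes f :: "real \<times> real \<Rightarrow> real"
  assumes f [measurable]: "f \<in> borel_measurable borel"
    and bd: "\<And>z. z \<in> {a..b} \<times> {c..d} \<Longrightarrow> \<bar>f z\<bar> \<le> B"
  shows "(LINT z:{a..b} \<times> {c..d}|lborel. f z) = (LINT t:{a..b}|lborel. LINT x:{c..d}|lborel. f (t, x))"
    and "(LINT z:{a..b} \<times> {c..d}|lborel. f z) = (LINT x:{c..d}|lborel. LINT t:{a..b}|lborel. f (t, x))"
    and "set_integrable lborel {a..b} (\<lambda>t. LINT x:{c..d}|lborel. f (t, x))"
    and "set_integrable lborel {c..d} (\<lambda>x. LINT t:{a..b}|lborel. f (t, x))"
proof -
  define g where "g = (\<lambda>z. indicator ({a..b} \<times> {c..d}) z *\<^sub>R f z)"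
  have int: "integrable lborel g"
    using set_integrable_bounded[OF emeasure_lborel_rect(2,1) f bd] by (simp add: set_integrable_def g_def)
  then have int': "integrable (lborel \<Otimes>\<^sub>M lborel) (case_prod (\<lambda>t x. g (t, x)))"
    by (simp add: lborel_prod)
  have g: "g (t, x) = indicator {a..b} t * (indicator {c..d} x * f (t, x))"
          "g (t, x) = indicator {c..d} x * (indicator {a..b} t * f (t, x))" for t x
    by (auto simp: g_def indicator_def)
  have t: "(\<integral>x. g (t, x) \<partial>lborel) = indicator {a..b} t *\<^sub>R (LINT x:{c..d}|lborel. f (t, x))" for t
    by (simp add: g(1) set_lebesgue_integral_def)
  have x: "(\<integral>t. g (t, x) \<partial>lborel) = indicator {c..d} x *\<^sub>R (LINT t:{a..b}|lborel. f (t, x))" for x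
    by (simp add: g(2) set_lebesgue_integral_def)
  have "(LINT z:{a..b} \<times> {c..d}|lborel. f z) = integral\<^sup>L lborel g"
    by (simp add: set_lebesgue_integral_def g_def)
  also have "\<dots> = integral\<^sup>L (lborel \<Otimes>\<^sub>M lborel) (case_prod (\<lambda>t x. g (t, x)))"
    by (simp add: lborel_prod)
  finally have eq: "(LINT z:{a..b} \<times> {c..d}|lborel. f z) = \<dots>" .
  show "(LINT z:{a..b} \<times> {c..d}|lborel. f z) = (LINT t:{a..b}|lborel. LINT x:{c..d}|lborel. f (t, x))"
    unfolding eq lborel_pair.integral_fst[OF int', symmetric] t by (simp add: set_lebesgue_integral_def)
  show "(LINT z:{a..b} \<times> {c..d}|lborel. f z) = (LINT x:{c..d}|lborel. LINT t:{a..b}|lborel. f (t, x))"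
    unfolding eq lborel_pair.integral_snd[OF int', symmetric] x by (simp add: set_lebesgue_integral_def)
  show "set_integrable lborel {a..b} (\<lambda>t. LINT x:{c..d}|lborel. f (t, x))"
    using lborel_pair.integrable_fst[OF int'] by (simp add: t set_integrable_def)
  show "set_integrable lborel {c..d} (\<lambda>x. LINT t:{a..b}|lborel. f (t, x))"
    using lborel_pair.integrable_snd[OF int'] by (simp add: x set_integrable_def)
qed

section \<open>Integrals with an integrable weight\<close>

lemma set_integrable_mult_bounded:
  fixes g k :: "real \<Rightarrow> real"
  assumes g: "set_integrable lborel I g" and k: "k \<in> borel_measurable borel"
    and bd: "\<And>y. y \<in> I \<Longrightarrow> \<bar>k y\<bar> \<le> C"
  shows "set_integrable lborel I (\<lambda>y. g y * k y)"
proof -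
  have "integrable lborel (\<lambda>y. C * (indicator I y *\<^sub>R g y))"
    using g by (simp add: set_integrable_def)
  moreover have "(\<lambda>y. (indicator I y *\<^sub>R g y) * k y) \<in> borel_measurable lborel"
    using g k by (intro borel_measurable_times) (auto simp: set_integrable_def)
  ultimately have "integrable lborel (\<lambda>y. (indicator I y *\<^sub>R g y) * k y)"
  proof (rule Bochner_Integration.integrable_bound, intro AE_I2)
    fix y
    show "norm ((indicator I y *\<^sub>R g y) * k y) \<le> norm (C * (indicator I y *\<^sub>R g y))"
    proof (cases "y \<in> I")
      case True
      with bd[OF this] show ?thesis
        by (simp add: abs_mult mult.commute[of "\<bar>g y\<bar>"] mult_right_mono)
    qed simp
  qed
  then show ?thesis by (simp add: set_integrable_def mult.assoc)
qed

text \<open>Dominated convergence with the majorant C |g|. It is stated for a merely integrable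
  weight \<open>g\<close> because the trace of a solution is only known to be integrable.\<close>

lemma set_integral_weighted_limit:
  fixes g :: "real \<Rightarrow> real"
  assumes g: "set_integrable lborel I g"
    and k: "k \<in> borel_measurable borel" "\<And>n. s n \<in> borel_measurable borel"
    and bd: "\<And>n y. y \<in> I \<Longrightarrow> \<bar>s n y\<bar> \<le> C"
    and lim: "AE y in lborel. y \<in> I \<longrightarrow> (\<lambda>n. s n y) \<longlonglongrightarrow> k y"
  shows "(\<lambda>n. LINT y:I|lborel. g y * s n y) \<longlonglongrightarrow> (LINT y:I|lborel. g y * k y)"
  unfolding set_lebesgue_integral_def
proof (rule integral_dominated_convergence[where w="\<lambda>y. C * norm (indicator I y *\<^sub>R g y)"])
  show "integrable lborel (\<lambda>y. C * norm (indicator I y *\<^sub>R g y))"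
    using g by (simp add: set_integrable_def)
  have m: "(\<lambda>y. indicator I y *\<^sub>R (g y * h y)) \<in> borel_measurable lborel"
    if "h \<in> borel_measurable borel" for h
  proof -
    have "(\<lambda>y. (indicator I y *\<^sub>R g y) * h y) \<in> borel_measurable lborel"
      using g that by (intro borel_measurable_times) (auto simp: set_integrable_def)
    then show ?thesis by (simp add: mult.assoc)
  qed
  show "(\<lambda>y. indicator I y *\<^sub>R (g y * k y)) \<in> borel_measurable lborel" by (rule m[OF k(1)])
  show "(\<lambda>y. indicator I y *\<^sub>R (g y * s n y)) \<in> borel_measurable lborel" for n by (rule m[OF k(2)])
  show "AE y in lborel. norm (indicator I y *\<^sub>R (g y * s n y)) \<le> C * norm (indicator I y *\<^sub>R g y)" for n
  proof (intro AE_I2)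
    fix y
    show "norm (indicator I y *\<^sub>R (g y * s n y)) \<le> C * norm (indicator I y *\<^sub>R g y)"
    proof (cases "y \<in> I")
      case True
      with bd[OF this, of n] show ?thesis
        by (simp add: abs_mult mult.commute[of "\<bar>g y\<bar>"] mult_right_mono)
    qed simp
  qed
  show "AE y in lborel. (\<lambda>n. indicator I y *\<^sub>R (g y * s n y)) \<longlonglongrightarrow> indicator I y *\<^sub>R (g y * k y)"
    using lim
  proof eventually_elim
    case (elim y)
    then show ?case by (cases "y \<in> I") (auto intro: tendsto_intros)
  qed
qed

lemma AE_zero_if_set_integral_le_zero:
  fixes f :: "'a::euclidean_space \<Rightarrow> real"
  assumes int: "set_integrable lborel A f" and le: "(LINT x:A|lborel. f x) \<le> 0" and nn: "\<And>x. 0 \<le> f x"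
  shows "AE x in lborel. x \<in> A \<longrightarrow> f x = 0"
proof -
  have "(LINT x|lborel. indicator A x *\<^sub>R f x) = 0"
    using le by (intro antisym Bochner_Integration.integral_nonneg) (simp_all add: set_lebesgue_integral_def nn)
  then have "AE x in lborel. indicator A x *\<^sub>R f x = 0"
    using int nn by (subst integral_nonneg_eq_0_iff_AE[symmetric]) (simp_all add: set_integrable_def)
  then show ?thesis by eventually_elim (auto simp: indicator_def)
qed

lemma set_integral_FTC:
  fixes F f :: "real \<Rightarrow> real"
  assumes "a \<le> b" "\<And>x. (F has_real_derivative f x) (at x)" "continuous_on UNIV f"
  shows "(LINT x:{a..b}|lborel. f x) = F b - F a"
  unfolding set_lebesgue_integral_def using assms
  by (intro integral_FTC_Icc)
    (auto intro: DERIV_subset continuous_on_subset simp flip: has_real_derivative_iff_has_vector_derivative)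

section \<open>Cutoff functions\<close>

text \<open>The square of the positive part is \<open>C\<^sup>1\<close>, which is all the smoothness
  that test functions have to possess.\<close>

definition pos_sq :: "real \<Rightarrow> real" where "pos_sq y = (max 0 y)\<^sup>2"

lemma pos_sq_deriv: "(pos_sq has_real_derivative 2 * max 0 y) (at y)"
proof -
  consider "y < 0" | "y > 0" | "y = 0" by linarith
  then show ?thesis
  proof cases
    case 1
    have "((\<lambda>_. 0) has_real_derivative 0) (at y)" by simp
    then have "(pos_sq has_real_derivative 0) (at y)"
      by (rule has_field_derivative_transform_within_open[where S="{..<0}"])
        (use 1 in \<open>auto simp: pos_sq_def\<close>)
    then show ?thesis using 1 by (simp add: max_def)
  next
    case 2
    have "((\<lambda>x. x\<^sup>2) has_real_derivative 2 * y) (at y)" by (auto intro!: derivative_eq_intros)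
    then have "(pos_sq has_real_derivative 2 * y) (at y)"
      by (rule has_field_derivative_transform_within_open[where S="{0<..}"])
        (use 2 in \<open>auto simp: pos_sq_def\<close>)
    then show ?thesis using 2 by (simp add: max_def)
  next
    case 3
    have "((\<lambda>h. (pos_sq (0 + h) - pos_sq 0) / h) \<longlongrightarrow> 0) (at 0)"
    proof (rule Lim_null_comparison)
      show "\<forall>\<^sub>F h in at 0. norm ((pos_sq (0 + h) - pos_sq 0) / h) \<le> \<bar>h\<bar>"
        by (auto simp: eventually_at_filter pos_sq_def max_def power2_eq_square)
      show "(abs \<longlongrightarrow> 0) (at (0::real))" by (rule tendsto_eq_intros refl | simp)+
    qed
    then show ?thesis using 3 by (simp add: DERIV_def)
  qed
qed

lemma pos_sq_sum_pos: "0 < pos_sq y + pos_sq (1 - y)"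
proof -
  have "0 < pos_sq y \<or> 0 < pos_sq (1 - y)" by (auto simp: pos_sq_def max_def)
  moreover have "0 \<le> pos_sq z" for z by (simp add: pos_sq_def)
  ultimately show ?thesis by (smt (verit))
qed

text \<open>A \<open>C\<^sup>1\<close> transition from 0 at y = 0 to 1 at y = 1. The denominator is
  positive since y or 1 - y is.\<close>

definition smooth_step :: "real \<Rightarrow> real" where
  "smooth_step y = pos_sq y / (pos_sq y + pos_sq (1 - y))"

text \<open>The quotient rule after cancellation; in this form the sign and the support in [0,1] can
  be read off.\<close>

definition smooth_step' :: "real \<Rightarrow> real" where
  "smooth_step' y = (2 * max 0 y * pos_sq (1 - y) + pos_sq y * (2 * max 0 (1 - y))) /
     (pos_sq y + pos_sq (1 - y))\<^sup>2"

lemma smooth_step_deriv: "(smooth_step has_real_derivative smooth_step' y) (at y)"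
  unfolding smooth_step_def[abs_def] smooth_step'_def using pos_sq_sum_pos[of y]
  by (auto intro!: derivative_eq_intros DERIV_chain'[OF _ pos_sq_deriv] pos_sq_deriv
      simp: power2_eq_square algebra_simps)

lemma continuous_pos_sq: "continuous_on UNIV pos_sq"
  using pos_sq_deriv by (intro DERIV_continuous_on) (auto intro: has_field_derivative_at_within)

lemma continuous_smooth_step': "continuous_on UNIV smooth_step'"
  unfolding smooth_step'_def[abs_def] using pos_sq_sum_pos
  by (intro continuous_intros continuous_on_compose2[OF continuous_pos_sq]) (auto simp: less_imp_neq[THEN not_sym])

lemma smooth_step_bounds: "0 \<le> smooth_step y" "smooth_step y \<le> 1"
  using pos_sq_sum_pos[of y] by (auto simp: smooth_step_def pos_sq_def)

lemma smooth_step_eq: "y \<le> 0 \<Longrightarrow> smooth_step y = 0" "1 \<le> y \<Longrightarrow> smooth_step y = 1"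
  by (auto simp: smooth_step_def pos_sq_def)

lemma smooth_step'_nonneg: "0 \<le> smooth_step' y"
  by (auto simp: smooth_step'_def pos_sq_def)

lemma smooth_step'_zero: "y \<notin> {0..1} \<Longrightarrow> smooth_step' y = 0"
  by (auto simp: smooth_step'_def pos_sq_def not_le)

lemma smooth_step'_bounded: obtains M where "\<And>y. \<bar>smooth_step' y\<bar> \<le> M" "0 \<le> M"
proof -
  have "bounded (smooth_step' ` {0..1})"
    by (intro compact_imp_bounded compact_continuous_image continuous_on_subset[OF continuous_smooth_step']) auto
  then obtain M where M: "\<And>y. y \<in> {0..1} \<Longrightarrow> \<bar>smooth_step' y\<bar> \<le> M"
    unfolding bounded_iff by fastforce
  have "\<bar>smooth_step' y\<bar> \<le> max 0 M" for y
    using M[of y] smooth_step'_zero[of y] by (cases "y \<in> {0..1}") auto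
  then show thesis by (rule that) simp
qed

text \<open>The rise from 0 to 1 takes place between 1/(n+1) and 2/(n+1). Multiplication by the
  cutoff thus moves a support strictly inside the domain, and the derivative is an approximate Dirac
  mass at 0 from the right.\<close>

definition cutoff :: "nat \<Rightarrow> real \<Rightarrow> real" where
  "cutoff n t = smooth_step (real (Suc n) * t - 1)"

definition cutoff' :: "nat \<Rightarrow> real \<Rightarrow> real" where
  "cutoff' n t = real (Suc n) * smooth_step' (real (Suc n) * t - 1)"

lemma cutoff_deriv: "(cutoff n has_real_derivative cutoff' n t) (at t)"
proof -
  have "((\<lambda>t. real (Suc n) * t - 1) has_real_derivative real (Suc n)) (at t)"
    by (auto intro!: derivative_eq_intros)
  from DERIV_chain'[OF this smooth_step_deriv] show ?thesis
    unfolding cutoff_def[abs_def] cutoff'_def by (simp add: mult.commute)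
qed

lemma continuous_cutoff': "continuous_on UNIV (cutoff' n)"
  unfolding cutoff'_def[abs_def]
  by (intro continuous_intros continuous_on_compose2[OF continuous_smooth_step']) auto

lemma continuous_cutoff: "continuous_on UNIV (cutoff n)"
  using cutoff_deriv by (intro DERIV_continuous_on) (auto intro: has_field_derivative_at_within)

lemma measurable_cutoff [measurable]:
  "cutoff n \<in> borel_measurable borel" "cutoff' n \<in> borel_measurable borel"
  using continuous_cutoff continuous_cutoff' by (auto intro: borel_measurable_continuous_onI)

lemma cutoff_bounds: "0 \<le> cutoff n t" "cutoff n t \<le> 1"
  by (simp_all add: cutoff_def smooth_step_bounds)

lemma cutoff_zero: "t \<le> 1 / real (Suc n) \<Longrightarrow> cutoff n t = 0"
  unfolding cutoff_def by (rule smooth_step_eq) (simp add: field_simps)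

lemma cutoff_one: "2 / real (Suc n) \<le> t \<Longrightarrow> cutoff n t = 1"
  unfolding cutoff_def by (rule smooth_step_eq) (simp add: field_simps)

lemma cutoff'_nonneg: "0 \<le> cutoff' n t"
  by (simp add: cutoff'_def smooth_step'_nonneg)

lemma cutoff'_nonzero:
  assumes "cutoff' n t \<noteq> 0" shows "1 / real (Suc n) \<le> t" "t \<le> 2 / real (Suc n)"
proof -
  have "real (Suc n) * t - 1 \<in> {0..1}"
    using assms smooth_step'_zero by (force simp: cutoff'_def)
  then show "1 / real (Suc n) \<le> t" "t \<le> 2 / real (Suc n)" by (auto simp: field_simps)
qed

lemma cutoff'_bounded: obtains M where "\<And>t. \<bar>cutoff' n t\<bar> \<le> M"
proof -
  obtain M where "\<And>y. \<bar>smooth_step' y\<bar> \<le> M" using smooth_step'_bounded by metis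
  then have "\<bar>cutoff' n t\<bar> \<le> real (Suc n) * M" for t
    unfolding cutoff'_def abs_mult by (intro mult_mono) auto
  then show thesis by (rule that)
qed

lemma tendsto_Suc_over: "(\<lambda>n. c / real (Suc n)) \<longlonglongrightarrow> 0"
  using tendsto_mult[OF tendsto_const[of c] LIMSEQ_inverse_real_of_nat] by (simp add: divide_inverse)

lemma cutoff_tendsto: "0 < t \<Longrightarrow> (\<lambda>n. cutoff n t) \<longlonglongrightarrow> 1"
  using order_tendstoD(2)[OF tendsto_Suc_over[of 2], of t]
  by (intro tendsto_eventually) (auto elim!: eventually_mono intro!: cutoff_one)

lemma cutoff'_integral:
  assumes "2 / real (Suc n) \<le> T"
  shows "(LINT t:{0..T}|lborel. cutoff' n t) = 1"
proof -
  have "0 < 2 / real (Suc n)" by simp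
  with assms have T: "0 \<le> T" by linarith
  have "(LINT t:{0..T}|lborel. cutoff' n t) = cutoff n T - cutoff n 0"
    by (rule set_integral_FTC[OF T cutoff_deriv continuous_cutoff'])
  then show ?thesis using cutoff_one[OF assms] cutoff_zero[of 0 n] by simp
qed

section \<open>Boundary layers\<close>

text \<open>Kernels of mass one that concentrate at \<open>s0\<close> average \<open>F\<close> to
  its limit there. The limit may be taken off the null set \<open>N\<close>, which integrals do not
  see, and within \<open>S\<close>, where the kernels live.\<close>

lemma layer_limit:
  fixes F :: "real \<Rightarrow> real"
  assumes ker: "\<forall>\<^sub>F n in sequentially. set_integrable lborel J (k n) \<and> (LINT s:J|lborel. k n s) = 1"
    and pos: "\<And>n s. 0 \<le> k n s"
    and supp: "\<forall>\<^sub>F n in sequentially. \<forall>s\<in>J. k n s \<noteq> 0 \<longrightarrow> s \<in> S \<and> \<bar>s - s0\<bar> \<le> d n"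
    and d: "d \<longlonglongrightarrow> 0" and s0: "s0 \<notin> S"
    and int: "\<And>n. set_integrable lborel J (\<lambda>s. k n s * F s)"
    and N: "N \<in> null_sets lborel" and lim: "(F \<longlongrightarrow> F0) (at s0 within (S - N))"
  shows "(\<lambda>n. LINT s:J|lborel. k n s * F s) \<longlonglongrightarrow> F0"
proof (rule LIMSEQ_I)
  fix e :: real assume e: "0 < e"
  with lim obtain r where r: "0 < r" "\<And>s. s \<in> S - N \<Longrightarrow> s \<noteq> s0 \<Longrightarrow> \<bar>s - s0\<bar> < r \<Longrightarrow> \<bar>F s - F0\<bar> < e / 2"
    unfolding tendsto_iff eventually_at dist_real_def by (metis half_gt_zero)
  have "\<forall>\<^sub>F n in sequentially. d n < r" using order_tendstoD(2)[OF d r(1)] .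
  with ker supp have "\<forall>\<^sub>F n in sequentially. norm ((LINT s:J|lborel. k n s * F s) - F0) < e"
  proof eventually_elim
    case (elim n)
    have AE: "AE s in lborel. s \<notin> N" using N by (rule AE_not_in)
    have "(LINT s:J|lborel. k n s * F s) - F0 = (LINT s:J|lborel. k n s * F s) - (LINT s:J|lborel. k n s * F0)"
      using elim by simp
    also have "\<dots> = (LINT s:J|lborel. k n s * F s - k n s * F0)"
      using elim int by (intro set_integral_diff(2)[symmetric]) auto
    finally have 1: "(LINT s:J|lborel. k n s * F s) - F0 = \<dots>" .
    have "norm (LINT s:J|lborel. k n s * F s - k n s * F0) \<le> (LINT s:J|lborel. norm (k n s * F s - k n s * F0))"
      using elim int by (intro set_integral_norm_bound set_integral_diff) auto
    also have "\<dots> \<le> (LINT s:J|lborel. k n s * (e / 2))"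
    proof (rule set_integral_mono_AE)
      show "set_integrable lborel J (\<lambda>s. norm (k n s * F s - k n s * F0))"
        using elim int by (intro set_integrable_norm set_integral_diff) auto
      show "set_integrable lborel J (\<lambda>s. k n s * (e / 2))" using elim by simp
      show "AE s \<in> J in lborel. norm (k n s * F s - k n s * F0) \<le> k n s * (e / 2)"
        using AE
      proof eventually_elim
        case (elim s)
        show ?case
        proof
          assume "s \<in> J"
          show "norm (k n s * F s - k n s * F0) \<le> k n s * (e / 2)"
          proof (cases "k n s = 0")
            case False
            then have "s \<in> S" "\<bar>s - s0\<bar> < r" using \<open>\<forall>s\<in>J. _\<close> \<open>s \<in> J\<close> \<open>d n < r\<close> by auto
            then have "\<bar>F s - F0\<bar> \<le> e / 2" using r(2)[of s] elim s0 by force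
            then have "k n s * \<bar>F s - F0\<bar> \<le> k n s * (e / 2)" by (rule mult_left_mono) (rule pos)
            moreover have "norm (k n s * F s - k n s * F0) = k n s * \<bar>F s - F0\<bar>"
              using pos[of n s] by (simp add: abs_mult flip: right_diff_distrib)
            ultimately show ?thesis by simp
          qed simp
        qed
      qed
    qed
    also have "\<dots> = e / 2" using elim by simp
    finally show ?case unfolding 1 using e by simp
  qed
  then show "\<exists>no. \<forall>n\<ge>no. norm ((LINT s:J|lborel. k n s * F s) - F0) < e"
    by (simp add: eventually_sequentially)
qed

text \<open>The difference of the pairings of \<open>w s\<close> and \<open>g\<close> with
  \<open>\<Psi> s\<close> is at most C times their \<open>L\<^sup>1\<close> distance, which the
  trace controls; replacing \<open>\<Psi> s\<close> by \<open>\<Psi> s0\<close> against the fixed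
  \<open>g\<close> is dominated convergence.\<close>

lemma trace_integral_tendsto:
  assumes tr: "L1_trace w s0 S I g"
    and I: "I \<in> sets borel" "emeasure lborel I < \<infinity>"
    and w: "\<And>s. w s \<in> borel_measurable borel" and wb: "\<And>s y. s \<in> S \<Longrightarrow> y \<in> I \<Longrightarrow> \<bar>w s y\<bar> \<le> B"
    and \<Psi>: "\<And>s. \<Psi> s \<in> borel_measurable borel"
    and \<Psi>b: "\<And>s y. s \<in> insert s0 S \<Longrightarrow> y \<in> I \<Longrightarrow> \<bar>\<Psi> s y\<bar> \<le> C"
    and \<Psi>l: "\<And>y. y \<in> I \<Longrightarrow> ((\<lambda>s. \<Psi> s y) \<longlongrightarrow> \<Psi> s0 y) (at s0 within S)"
  obtains N where "N \<in> null_sets lborel"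
    "((\<lambda>s. LINT y:I|lborel. w s y * \<Psi> s y) \<longlongrightarrow> (LINT y:I|lborel. g y * \<Psi> s0 y)) (at s0 within (S - N))"
proof -
  have [measurable]: "I \<in> sets borel" by fact
  note [measurable] = w \<Psi>
  obtain N where gi: "set_integrable lborel I g" and N: "N \<in> null_sets lborel"
    and lim: "((\<lambda>s. LINT y:I|lborel. \<bar>w s y - g y\<bar>) \<longlongrightarrow> 0) (at s0 within (S - N))"
    using tr unfolding L1_trace_def by blast
  have wi: "set_integrable lborel I (w s)" if "s \<in> S" for s
    by (rule set_integrable_bounded[where B=B]) (use I w wb that in auto)
  have bmul: "set_integrable lborel I (\<lambda>y. f y * \<Psi> s y)"
    if "s \<in> insert s0 S" "set_integrable lborel I f" for s f
    using that \<Psi> \<Psi>b by (intro set_integrable_mult_bounded) auto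
  have "((\<lambda>s. LINT y:I|lborel. g y * \<Psi> s y) \<longlongrightarrow> (LINT y:I|lborel. g y * \<Psi> s0 y)) (at s0 within S)"
    unfolding tendsto_at_iff_sequentially comp_def
  proof (intro allI impI)
    fix X :: "nat \<Rightarrow> real" assume X: "\<forall>i. X i \<in> S - {s0}" "X \<longlonglongrightarrow> s0"
    show "(\<lambda>n. LINT y:I|lborel. g y * \<Psi> (X n) y) \<longlonglongrightarrow> (LINT y:I|lborel. g y * \<Psi> s0 y)"
    proof (rule set_integral_weighted_limit[OF gi \<Psi> \<Psi>])
      show "\<bar>\<Psi> (X n) y\<bar> \<le> C" if "y \<in> I" for n y using \<Psi>b[of "X n" y] X(1) that by blast
      show "AE y in lborel. y \<in> I \<longrightarrow> (\<lambda>n. \<Psi> (X n) y) \<longlonglongrightarrow> \<Psi> s0 y"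
        using \<Psi>l X unfolding tendsto_at_iff_sequentially comp_def by blast
    qed
  qed
  then have sub: "((\<lambda>s. LINT y:I|lborel. g y * \<Psi> s y) \<longlongrightarrow> (LINT y:I|lborel. g y * \<Psi> s0 y)) (at s0 within (S - N))"
    by (rule tendsto_within_subset) auto
  have "((\<lambda>s. (LINT y:I|lborel. w s y * \<Psi> s y) - (LINT y:I|lborel. g y * \<Psi> s y)) \<longlongrightarrow> 0) (at s0 within (S - N))"
  proof (rule Lim_null_comparison)
    show "((\<lambda>s. C * (LINT y:I|lborel. \<bar>w s y - g y\<bar>)) \<longlongrightarrow> 0) (at s0 within (S - N))"
      using tendsto_mult_left[OF lim, of C] by simp
    show "\<forall>\<^sub>F s in at s0 within (S - N). norm ((LINT y:I|lborel. w s y * \<Psi> s y) - (LINT y:I|lborel. g y * \<Psi> s y))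
        \<le> C * (LINT y:I|lborel. \<bar>w s y - g y\<bar>)" (is "eventually ?le _")
      unfolding eventually_at_filter
    proof (intro always_eventually allI impI)
      fix s assume "s \<in> S - N"
      then have s: "s \<in> insert s0 S" "s \<in> S" by auto
      have wg: "set_integrable lborel I (\<lambda>y. w s y - g y)" using wi[OF s(2)] gi by (rule set_integral_diff)
      have "(LINT y:I|lborel. w s y * \<Psi> s y) - (LINT y:I|lborel. g y * \<Psi> s y) = (LINT y:I|lborel. (w s y - g y) * \<Psi> s y)"
        using bmul[OF s(1) wi[OF s(2)]] bmul[OF s(1) gi] by (simp add: set_integral_diff(2) left_diff_distrib)
      also have "norm \<dots> \<le> (LINT y:I|lborel. norm ((w s y - g y) * \<Psi> s y))"
        by (rule set_integral_norm_bound[OF bmul[OF s(1) wg]])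
      also have "\<dots> \<le> (LINT y:I|lborel. C * \<bar>w s y - g y\<bar>)"
      proof (rule set_integral_mono)
        show "set_integrable lborel I (\<lambda>y. norm ((w s y - g y) * \<Psi> s y))"
          by (rule set_integrable_norm[OF bmul[OF s(1) wg]])
        show "set_integrable lborel I (\<lambda>y. C * \<bar>w s y - g y\<bar>)" using set_integrable_abs[OF wg] by simp
        show "norm ((w s y - g y) * \<Psi> s y) \<le> C * \<bar>w s y - g y\<bar>" if "y \<in> I" for y
          using \<Psi>b[OF s(1) that] by (simp add: abs_mult mult.commute mult_right_mono)
      qed
      finally show "?le s" by simp
    qed
  qed
  from tendsto_add[OF this sub] N that show thesis by simp
qed

section \<open>A Green inequality with boundary terms\<close>

text \<open>This is \<open>test_function\<close> without sign and support. Carrying the partial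
  derivatives as parameters lets the product and chain rules produce them as explicit terms.\<close>

definition C1_fun ::
  "(real \<times> real \<Rightarrow> real) \<Rightarrow> (real \<times> real \<Rightarrow> real) \<Rightarrow> (real \<times> real \<Rightarrow> real) \<Rightarrow> bool" where
  "C1_fun \<phi> \<phi>t \<phi>x \<longleftrightarrow>
     (\<forall>z. (\<phi> has_derivative (\<lambda>h. \<phi>t z * fst h + \<phi>x z * snd h)) (at z)) \<and>
     continuous_on UNIV \<phi>t \<and> continuous_on UNIV \<phi>x"

lemma C1_funD: "C1_fun \<phi> \<phi>t \<phi>x \<Longrightarrow> (\<phi> has_derivative (\<lambda>h. \<phi>t z * fst h + \<phi>x z * snd h)) (at z)"
  unfolding C1_fun_def by blast

lemma C1_fun_continuous: "C1_fun \<phi> \<phi>t \<phi>x \<Longrightarrow> continuous_on UNIV \<phi>"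
  unfolding C1_fun_def by (metis continuous_at_imp_continuous_on has_derivative_continuous)

lemma C1_fun_measurable:
  assumes "C1_fun \<phi> \<phi>t \<phi>x"
  shows "\<phi> \<in> borel_measurable borel" "\<phi>t \<in> borel_measurable borel" "\<phi>x \<in> borel_measurable borel"
  using assms C1_fun_continuous[OF assms] by (auto simp: C1_fun_def intro: borel_measurable_continuous_onI)

lemma C1_fun_compose:
  assumes f: "C1_fun f ft fx"
    and g: "\<And>y. (g has_real_derivative g' y) (at y)" "continuous_on UNIV g'"
  shows "C1_fun (\<lambda>z. g (f z)) (\<lambda>z. g' (f z) * ft z) (\<lambda>z. g' (f z) * fx z)"
  unfolding C1_fun_def
proof (intro conjI allI)
  fix z
  have "(f has_derivative (\<lambda>h. ft z * fst h + fx z * snd h)) (at z)" by (rule C1_funD[OF f])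
  from has_derivative_compose[OF this g(1)[unfolded has_field_derivative_def]]
  show "((\<lambda>z. g (f z)) has_derivative (\<lambda>h. g' (f z) * ft z * fst h + g' (f z) * fx z * snd h)) (at z)"
    by (rule has_derivative_eq_rhs) (simp add: fun_eq_iff algebra_simps)
next
  have "continuous_on UNIV (\<lambda>z. g' (f z))"
    by (rule continuous_on_compose2[OF g(2) C1_fun_continuous[OF f]]) simp
  then show "continuous_on UNIV (\<lambda>z. g' (f z) * ft z)" "continuous_on UNIV (\<lambda>z. g' (f z) * fx z)"
    using f by (auto simp: C1_fun_def intro: continuous_on_mult)
qed

lemma C1_fun_mult:
  assumes f: "C1_fun f ft fx" and g: "C1_fun g gt gx"
  shows "C1_fun (\<lambda>z. f z * g z) (\<lambda>z. ft z * g z + f z * gt z) (\<lambda>z. fx z * g z + f z * gx z)"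
  unfolding C1_fun_def
proof (intro conjI allI)
  fix z
  have "(f has_derivative (\<lambda>h. ft z * fst h + fx z * snd h)) (at z)"
       "(g has_derivative (\<lambda>h. gt z * fst h + gx z * snd h)) (at z)"
    by (rule C1_funD[OF f], rule C1_funD[OF g])
  from has_derivative_mult[OF this]
  show "((\<lambda>z. f z * g z) has_derivative
      (\<lambda>h. (ft z * g z + f z * gt z) * fst h + (fx z * g z + f z * gx z) * snd h)) (at z)"
    by (rule has_derivative_eq_rhs) (simp add: fun_eq_iff algebra_simps)
next
  show "continuous_on UNIV (\<lambda>z. ft z * g z + f z * gt z)" "continuous_on UNIV (\<lambda>z. fx z * g z + f z * gx z)"
    using f g C1_fun_continuous[OF f] C1_fun_continuous[OF g]
    by (auto simp: C1_fun_def intro!: continuous_on_mult continuous_on_add)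
qed

lemma C1_fun_coords:
  "C1_fun fst (\<lambda>_. 1) (\<lambda>_. 0)" "C1_fun snd (\<lambda>_. 0) (\<lambda>_. 1)"
  by (auto simp: C1_fun_def intro!: derivative_eq_intros continuous_intros)

lemma C1_fun_diff:
  assumes f: "C1_fun f ft fx" and g: "C1_fun g gt gx"
  shows "C1_fun (\<lambda>z. f z - g z) (\<lambda>z. ft z - gt z) (\<lambda>z. fx z - gx z)"
  unfolding C1_fun_def
proof (intro conjI allI)
  fix z
  have "(f has_derivative (\<lambda>h. ft z * fst h + fx z * snd h)) (at z)"
       "(g has_derivative (\<lambda>h. gt z * fst h + gx z * snd h)) (at z)"
    by (rule C1_funD[OF f], rule C1_funD[OF g])
  from has_derivative_diff[OF this]
  show "((\<lambda>z. f z - g z) has_derivative (\<lambda>h. (ft z - gt z) * fst h + (fx z - gx z) * snd h)) (at z)"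
    by (rule has_derivative_eq_rhs) (simp add: fun_eq_iff algebra_simps)
qed (use f g in \<open>auto simp: C1_fun_def intro!: continuous_on_diff\<close>)

lemma C1_fun_bounded_rect:
  assumes "C1_fun \<phi> \<phi>t \<phi>x"
  obtains M where "\<And>z. z \<in> {a..b} \<times> {c..d} \<Longrightarrow> \<bar>\<phi> z\<bar> \<le> M \<and> \<bar>\<phi>t z\<bar> \<le> M \<and> \<bar>\<phi>x z\<bar> \<le> M" "0 \<le> M"
proof -
  have "\<exists>M. \<forall>z\<in>{a..b} \<times> {c..d}. \<bar>f z\<bar> \<le> M" if "continuous_on UNIV f" for f :: "real \<times> real \<Rightarrow> real"
  proof -
    have "bounded (f ` ({a..b} \<times> {c..d}))"
      by (intro compact_imp_bounded compact_continuous_image continuous_on_subset[OF that] compact_Times) auto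
    then show ?thesis unfolding bounded_iff by fastforce
  qed
  then obtain M1 M2 M3 where M: "\<forall>z\<in>{a..b} \<times> {c..d}. \<bar>\<phi> z\<bar> \<le> M1" "\<forall>z\<in>{a..b} \<times> {c..d}. \<bar>\<phi>t z\<bar> \<le> M2"
      "\<forall>z\<in>{a..b} \<times> {c..d}. \<bar>\<phi>x z\<bar> \<le> M3"
    using assms C1_fun_continuous[OF assms] unfolding C1_fun_def by meson
  show thesis
    by (rule that[of "max 0 (max M1 (max M2 M3))"]) (use M in \<open>auto simp: le_max_iff_disj\<close>)
qed

lemma test_function_iff:
  "test_function L T \<phi> \<phi>t \<phi>x \<longleftrightarrow> (\<forall>z. 0 \<le> \<phi> z) \<and> C1_fun \<phi> \<phi>t \<phi>x \<and>
     (\<exists>C. compact C \<and> C \<subseteq> {0<..<T} \<times> {0<..<L} \<and> (\<forall>z. z \<notin> C \<longrightarrow> \<phi> z = 0))"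
  by (auto simp: test_function_def C1_fun_def)

lemma cutoff_layer_limit:
  fixes F :: "real \<Rightarrow> real"
  assumes T: "0 < T" and int: "\<And>n. set_integrable lborel {0..T} (\<lambda>s. cutoff' n s * F s)"
    and N: "N \<in> null_sets lborel" "(F \<longlongrightarrow> F0) (at 0 within ({0<..<T} - N))"
  shows "(\<lambda>n. LINT s:{0..T}|lborel. cutoff' n s * F s) \<longlonglongrightarrow> F0"
proof (rule layer_limit[OF _ _ _ tendsto_Suc_over[of 2] _ int N])
  have ev: "\<forall>\<^sub>F n in sequentially. 2 / real (Suc n) < T"
    using order_tendstoD(2)[OF tendsto_Suc_over T] .
  then show "\<forall>\<^sub>F n in sequentially. set_integrable lborel {0..T} (cutoff' n) \<and> (LINT s:{0..T}|lborel. cutoff' n s) = 1"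
    by eventually_elim
      (auto intro!: cutoff'_integral borel_integrable_atLeastAtMost' continuous_on_subset[OF continuous_cutoff'])
  show "\<forall>\<^sub>F n in sequentially. \<forall>s\<in>{0..T}. cutoff' n s \<noteq> 0 \<longrightarrow> s \<in> {0<..<T} \<and> \<bar>s - 0\<bar> \<le> 2 / real (Suc n)"
    using ev
  proof eventually_elim
    case (elim n)
    have "0 < 1 / real (Suc n)" by simp
    with elim cutoff'_nonzero[of n] show ?case by fastforce
  qed
qed (auto simp: cutoff'_nonneg)

text \<open>The interior inequality is tested with \<open>\<Phi>\<close> times a cutoff in time and
  one at each end in space. The product rule gives the wanted integrand and terms with
  \<open>cutoff'\<close>, which concentrate at t = 0, x = 0 and x = L and become the boundary
  integrals. \<open>\<Phi>\<close> vanishes from \<open>T'\<close> on, so the side t = T contributes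
  nothing. The limits are successive: for a fixed spatial cutoff its derivative is bounded, so
  dominated convergence applies in the time layer. The density \<open>u\<close> and the flux
  \<open>q\<close> are independent of each other, so that the same inequality serves for congestion
  and, used with both signs, for the mass balance.\<close>

lemma green_inequality:
  fixes u q \<Phi> \<Phi>t \<Phi>x :: "real \<times> real \<Rightarrow> real"
  assumes L: "0 < L" and T: "0 < T"
    and um [measurable]: "u \<in> borel_measurable borel" and qm [measurable]: "q \<in> borel_measurable borel"
    and ub: "\<And>z. z \<in> {0..T} \<times> {0..L} \<Longrightarrow> \<bar>u z\<bar> \<le> B" and qb: "\<And>z. z \<in> {0..T} \<times> {0..L} \<Longrightarrow> \<bar>q z\<bar> \<le> B"
    and u0: "initial_trace L T (\<lambda>t x. u (t, x)) u0"
    and q0: "left_trace L T (\<lambda>t x. q (t, x)) q0"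
    and qL: "right_trace L T (\<lambda>t x. q (t, x)) qL"
    and weak: "\<And>\<phi> \<phi>t \<phi>x. test_function L T \<phi> \<phi>t \<phi>x \<Longrightarrow>
        0 \<le> (LINT z:{0..T} \<times> {0..L}|lborel. u z * \<phi>t z + q z * \<phi>x z)"
    and \<Phi>: "C1_fun \<Phi> \<Phi>t \<Phi>x" and pos: "\<And>z. 0 \<le> \<Phi> z"
    and T': "T' < T" and van: "\<And>t x. T' \<le> t \<Longrightarrow> x \<in> {0..L} \<Longrightarrow> \<Phi> (t, x) = 0"
  shows "0 \<le> (LINT z:{0..T} \<times> {0..L}|lborel. u z * \<Phi>t z + q z * \<Phi>x z)
      + (LINT x:{0..L}|lborel. u0 x * \<Phi> (0, x)) + (LINT t:{0..T}|lborel. q0 t * \<Phi> (t, 0))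
      - (LINT t:{0..T}|lborel. qL t * \<Phi> (t, L))"
proof -
  let ?R = "{0..T} \<times> {0..L}"
  note Rfin = emeasure_lborel_rect(2,1)[of 0 T 0 L]
  note [measurable] = C1_fun_measurable[OF \<Phi>]
  obtain M where M: "\<And>z. z \<in> ?R \<Longrightarrow> \<bar>\<Phi> z\<bar> \<le> M \<and> \<bar>\<Phi>t z\<bar> \<le> M \<and> \<bar>\<Phi>x z\<bar> \<le> M" "0 \<le> M"
    using C1_fun_bounded_rect[OF \<Phi>] by metis
  have mult_bd: "\<bar>f * g\<bar> \<le> F * G" if "\<bar>f\<bar> \<le> F" "\<bar>g\<bar> \<le> G" for f g F G :: real
    unfolding abs_mult using that by (intro mult_mono) auto
  define b where "b n x = cutoff n x * cutoff n (L - x)" for n x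
  define b' where "b' n x = cutoff' n x * cutoff n (L - x) - cutoff n x * cutoff' n (L - x)" for n x
  have [measurable]: "b n \<in> borel_measurable borel" "b' n \<in> borel_measurable borel" for n
    unfolding b_def b'_def by measurable
  have bb: "0 \<le> b n x" "b n x \<le> 1" "\<bar>b n x\<bar> \<le> 1" for n x
    using cutoff_bounds[of n] by (auto simp: b_def abs_mult intro!: mult_le_one)
  have bder: "(b n has_real_derivative b' n x) (at x)" for n x
  proof -
    have "((\<lambda>x. L - x) has_real_derivative - 1) (at x)" by (auto intro!: derivative_eq_intros)
    from DERIV_mult[OF cutoff_deriv[of n x] DERIV_chain'[OF this cutoff_deriv[of n]]]
    show ?thesis unfolding b_def[abs_def] b'_def by (simp add: algebra_simps)
  qed
  have cont: "continuous_on UNIV (b' n)" "continuous_on UNIV (b n)" for n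
    unfolding b'_def[abs_def] b_def[abs_def]
    by (auto intro!: continuous_intros continuous_on_compose2[OF continuous_cutoff'] continuous_on_compose2[OF continuous_cutoff])
  have b'bd: "\<exists>K. \<forall>x. \<bar>b' n x\<bar> \<le> K" for n
  proof -
    obtain K where K: "\<And>t. \<bar>cutoff' n t\<bar> \<le> K" using cutoff'_bounded by metis
    have "\<bar>b' n x\<bar> \<le> K * 1 + 1 * K" for x
      unfolding b'_def using cutoff_bounds[of n]
      by (intro order_trans[OF abs_triangle_ineq4] add_mono mult_bd K) (auto simp: abs_le_iff intro: order_trans[of _ 0])
    then show ?thesis by blast
  qed
  define G where "G n z = u z * (\<Phi>t z * b n (snd z)) + q z * (\<Phi>x z * b n (snd z) + \<Phi> z * b' n (snd z))" for n z
  have [measurable]: "G n \<in> borel_measurable borel" for n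
    unfolding G_def by measurable
  \<comment> \<open>first the layer at \<open>t = 0\<close>, with the layers at both ends kept fixed\<close>
  have stage1: "0 \<le> (LINT z:?R|lborel. G n z) + (LINT x:{0..L}|lborel. u0 x * (\<Phi> (0, x) * b n x))" for n
  proof -
    obtain K where K: "\<And>x. \<bar>b' n x\<bar> \<le> K" using b'bd by blast
    have Gb: "\<bar>G n z\<bar> \<le> B * (M * 1) + B * (M * 1 + M * K)" if "z \<in> ?R" for z
      unfolding G_def using M(1)[OF that] ub[OF that] qb[OF that]
      by (intro order_trans[OF abs_triangle_ineq] add_mono mult_bd bb K) auto
    have lim1: "(\<lambda>m. LINT z:?R|lborel. cutoff m (fst z) * G n z) \<longlonglongrightarrow> (LINT z:?R|lborel. G n z)"
    proof (rule set_integral_dominated_bounded[OF Rfin])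
      show "(\<lambda>z. cutoff m (fst z) * G n z) \<in> borel_measurable borel" for m
        by measurable
      show "\<bar>cutoff m (fst z) * G n z\<bar> \<le> 1 * (B * (M * 1) + B * (M * 1 + M * K))" if "z \<in> ?R" for m z
        using cutoff_bounds[of m "fst z"] by (intro mult_bd Gb that) (auto simp: abs_le_iff intro: order_trans[of _ 0])
      have "AE z in lborel. fst (z :: real \<times> real) \<noteq> 0" by (intro AE_lborel_projections(1) AE_lborel_singleton)
      then show "AE z in lborel. z \<in> ?R \<longrightarrow> (\<lambda>m. cutoff m (fst z) * G n z) \<longlonglongrightarrow> G n z"
      proof eventually_elim
        case (elim z)
        show ?case
        proof
          assume "z \<in> ?R"
          with elim have "0 < fst z" by auto
          from tendsto_mult[OF cutoff_tendsto[OF this] tendsto_const[of "G n z"]]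
          show "(\<lambda>m. cutoff m (fst z) * G n z) \<longlonglongrightarrow> G n z" by simp
        qed
      qed
    qed measurable
    define F where "F t = (LINT x:{0..L}|lborel. u (t, x) * (\<Phi> (t, x) * b n x))" for t
    have um2 [measurable]: "(\<lambda>z. cutoff' m (fst z) * (u z * (\<Phi> z * b n (snd z)))) \<in> borel_measurable borel" for m
      by measurable
    have uPb: "\<bar>cutoff' m (fst z) * (u z * (\<Phi> z * b n (snd z)))\<bar> \<le> Q * (B * (M * 1))"
      if "\<And>t. \<bar>cutoff' m t\<bar> \<le> Q" "z \<in> ?R" for m Q z
      using M(1)[OF that(2)] ub[OF that(2)] that(1) by (intro mult_bd bb) auto
    have Fub: "(LINT z:?R|lborel. cutoff' m (fst z) * (u z * (\<Phi> z * b n (snd z)))) =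
          (LINT t:{0..T}|lborel. cutoff' m t * F t)"
        "set_integrable lborel {0..T} (\<lambda>t. cutoff' m t * F t)" for m
    proof -
      obtain Q where Q: "\<And>t. \<bar>cutoff' m t\<bar> \<le> Q" using cutoff'_bounded by metis
      from set_Fubini(1,3)[OF um2 uPb[OF Q], of 0 T 0 L]
      show "(LINT z:?R|lborel. cutoff' m (fst z) * (u z * (\<Phi> z * b n (snd z)))) =
          (LINT t:{0..T}|lborel. cutoff' m t * F t)"
        "set_integrable lborel {0..T} (\<lambda>t. cutoff' m t * F t)"
        by (auto simp: F_def)
    qed
    obtain N where N: "N \<in> null_sets lborel"
      and Fl: "(F \<longlongrightarrow> (LINT x:{0..L}|lborel. u0 x * (\<Phi> (0, x) * b n x))) (at 0 within ({0<..<T} - N))"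
    proof (rule trace_integral_tendsto[OF u0, where \<Psi>="\<lambda>t x. \<Phi> (t, x) * b n x" and B=B and C="M * 1"])
      show "\<bar>\<Phi> (t, x) * b n x\<bar> \<le> M * 1" if "t \<in> insert 0 {0<..<T}" "x \<in> {0..L}" for t x
        using M(1)[of "(t, x)"] that L T by (intro mult_bd bb) auto
      show "((\<lambda>t. \<Phi> (t, x) * b n x) \<longlongrightarrow> \<Phi> (0, x) * b n x) (at 0 within {0<..<T})" for x
      proof -
        have "continuous_on UNIV (\<lambda>t. \<Phi> (t, x))"
          by (intro continuous_on_compose2[OF C1_fun_continuous[OF \<Phi>]] continuous_intros) auto
        then have "((\<lambda>t. \<Phi> (t, x)) \<longlongrightarrow> \<Phi> (0, x)) (at 0)" by (simp add: continuous_on_def)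
        then show ?thesis by (intro tendsto_intros) (rule tendsto_within_subset, auto)
      qed
      show "(\<lambda>x. \<Phi> (t, x) * b n x) \<in> borel_measurable borel" for t
        by (intro borel_measurable_times measurable_slices C1_fun_measurable[OF \<Phi>]) auto
      show "(\<lambda>x. u (t, x)) \<in> borel_measurable borel" for t by (intro measurable_slices um)
      show "\<bar>u (s, y)\<bar> \<le> B" if "s \<in> {0<..<T}" "y \<in> {0..L}" for s y using ub[of "(s, y)"] that by auto
      show "emeasure lborel {0..L} < \<infinity>" using L by simp
    qed (auto simp: F_def[abs_def])
    have lim2: "(\<lambda>m. LINT t:{0..T}|lborel. cutoff' m t * F t) \<longlonglongrightarrow> (LINT x:{0..L}|lborel. u0 x * (\<Phi> (0, x) * b n x))"
      by (rule cutoff_layer_limit[OF T Fub(2) N Fl])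
    have "0 \<le> (LINT z:?R|lborel. cutoff m (fst z) * G n z) + (LINT t:{0..T}|lborel. cutoff' m t * F t)" for m
    proof -
      define \<phi> where "\<phi> z = \<Phi> z * cutoff m (fst z) * b n (snd z)" for z
      have C1: "C1_fun \<phi> (\<lambda>z. (\<Phi>t z * cutoff m (fst z) + \<Phi> z * (cutoff' m (fst z) * 1)) * b n (snd z)
            + \<Phi> z * cutoff m (fst z) * (b' n (snd z) * 0))
          (\<lambda>z. (\<Phi>x z * cutoff m (fst z) + \<Phi> z * (cutoff' m (fst z) * 0)) * b n (snd z)
            + \<Phi> z * cutoff m (fst z) * (b' n (snd z) * 1))" (is "C1_fun _ ?\<phi>t ?\<phi>x")
        unfolding \<phi>_def
        by (intro C1_fun_mult \<Phi> C1_fun_compose[OF C1_fun_coords(1) cutoff_deriv continuous_cutoff']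
            C1_fun_compose[OF C1_fun_coords(2) bder cont(1)])
      have "test_function L T \<phi> ?\<phi>t ?\<phi>x"
        unfolding test_function_iff
      \<comment> \<open>The cutoffs vanish up to distance 1/(m+1) from t = 0 and 1/(n+1) from both
        ends. The upper bound \<open>T'\<close> comes from \<open>\<Phi>\<close>, whose vanishing is
        only assumed for x in [0,L]; outside, the spatial cutoff is zero.\<close>
      proof (intro conjI C1 allI exI[of _ "{1 / real (Suc m)..T'} \<times> {1 / real (Suc n)..L - 1 / real (Suc n)}"])
        show "0 \<le> \<phi> z" for z unfolding \<phi>_def using pos bb cutoff_bounds by simp
        show "compact ({1 / real (Suc m)..T'} \<times> {1 / real (Suc n)..L - 1 / real (Suc n)})"
          by (intro compact_Times) auto
        have "\<And>a. 1 / real (Suc m) \<le> a \<Longrightarrow> 0 < a" "\<And>x. 1 / real (Suc n) \<le> x \<Longrightarrow> 0 < x"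
          "\<And>x. x \<le> L - 1 / real (Suc n) \<Longrightarrow> x < L"
          by (smt (verit) divide_pos_pos of_nat_0_less_iff zero_less_Suc)+
        then show "{1 / real (Suc m)..T'} \<times> {1 / real (Suc n)..L - 1 / real (Suc n)} \<subseteq> {0<..<T} \<times> {0<..<L}"
          using T' by (auto simp del: of_nat_Suc)
        show "z \<notin> {1 / real (Suc m)..T'} \<times> {1 / real (Suc n)..L - 1 / real (Suc n)} \<longrightarrow> \<phi> z = 0" for z
        proof -
          have "0 \<le> 1 / real (Suc n)" by simp
          then have "\<Phi> z = 0" if "T' < fst z" "1 / real (Suc n) \<le> snd z" "snd z \<le> L - 1 / real (Suc n)"
          proof -
            have "0 \<le> snd z" "snd z \<le> L" using that \<open>0 \<le> 1 / real (Suc n)\<close> by linarith+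
            then show ?thesis using van[of "fst z" "snd z"] that by simp
          qed
          then have \<Phi>0: "T' < fst z \<Longrightarrow> 1 / real (Suc n) \<le> snd z \<Longrightarrow> snd z \<le> L - 1 / real (Suc n) \<Longrightarrow> \<phi> z = 0"
            by (simp add: \<phi>_def)
          have c0: "fst z \<le> 1 / real (Suc m) \<or> snd z \<le> 1 / real (Suc n) \<or> L - snd z \<le> 1 / real (Suc n) \<Longrightarrow> \<phi> z = 0"
            by (auto simp: \<phi>_def b_def cutoff_zero simp del: of_nat_Suc)
          show ?thesis
          proof
            assume "z \<notin> {1 / real (Suc m)..T'} \<times> {1 / real (Suc n)..L - 1 / real (Suc n)}"
            then have "\<not> (1 / real (Suc m) \<le> fst z \<and> fst z \<le> T' \<and> 1 / real (Suc n) \<le> snd z \<and> snd z \<le> L - 1 / real (Suc n))"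
              by (cases z) (auto simp del: of_nat_Suc)
            then show "\<phi> z = 0" using \<Phi>0 c0 by linarith
          qed
        qed
      qed
      from weak[OF this]
      have "0 \<le> (LINT z:?R|lborel. cutoff m (fst z) * G n z + cutoff' m (fst z) * (u z * (\<Phi> z * b n (snd z))))"
        by (simp add: G_def algebra_simps)
      also have "\<dots> = (LINT z:?R|lborel. cutoff m (fst z) * G n z)
          + (LINT z:?R|lborel. cutoff' m (fst z) * (u z * (\<Phi> z * b n (snd z))))"
      proof (rule set_integral_add)
        show "set_integrable lborel ?R (\<lambda>z. cutoff m (fst z) * G n z)"
          using cutoff_bounds[of m]
          by (intro set_integrable_bounded[OF Rfin, where B="1 * (B * (M * 1) + B * (M * 1 + M * K))"] mult_bd Gb)
            (auto simp: abs_le_iff intro: order_trans[of _ 0])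
        obtain Q where Q: "\<And>t. \<bar>cutoff' m t\<bar> \<le> Q" using cutoff'_bounded by metis
        show "set_integrable lborel ?R (\<lambda>z. cutoff' m (fst z) * (u z * (\<Phi> z * b n (snd z))))"
          by (rule set_integrable_bounded[OF Rfin um2 uPb[OF Q]])
      qed
      finally show ?thesis by (simp add: Fub)
    qed
    then show ?thesis by (intro LIMSEQ_le_const[OF tendsto_add[OF lim1 lim2]]) auto
  qed
  define H where "H z = u z * \<Phi>t z + q z * \<Phi>x z" for z
  have [measurable]: "H \<in> borel_measurable borel" unfolding H_def by measurable
  have Hb: "\<bar>H z\<bar> \<le> B * M + B * M" if "z \<in> ?R" for z
    unfolding H_def using M(1)[OF that] ub[OF that] qb[OF that]
    by (intro order_trans[OF abs_triangle_ineq] add_mono mult_bd) auto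
  define F where "F x = (LINT t:{0..T}|lborel. q (t, x) * \<Phi> (t, x))" for x
  have qP: "(\<lambda>z. k (snd z) * (q z * \<Phi> z)) \<in> borel_measurable borel" if [measurable]: "k \<in> borel_measurable borel" for k :: "real \<Rightarrow> real"
    by measurable
  have qPb: "\<bar>k (snd z) * (q z * \<Phi> z)\<bar> \<le> Q * (B * M)" if "\<And>x. \<bar>k x\<bar> \<le> Q" "z \<in> ?R" for k Q z
    using M(1)[OF that(2)] qb[OF that(2)] that(1) by (intro mult_bd) auto
  have Fub: "(LINT z:?R|lborel. k (snd z) * (q z * \<Phi> z)) = (LINT x:{0..L}|lborel. k x * F x)"
     "set_integrable lborel {0..L} (\<lambda>x. k x * F x)"
     if "k \<in> borel_measurable borel" "\<And>x. \<bar>k x\<bar> \<le> Q" for k Q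
    using set_Fubini(2,4)[OF qP[OF that(1)] qPb[where k=k, OF that(2)], of 0 T 0 L]
    by (auto simp: F_def)
  have intc: "set_integrable lborel {0..L} k" if "continuous_on UNIV k" for k :: "real \<Rightarrow> real"
    by (rule borel_integrable_atLeastAtMost') (rule continuous_on_subset[OF that], auto)
  have contr: "continuous_on UNIV (\<lambda>x. cutoff' n (L - x))" for n
    by (intro continuous_on_compose2[OF continuous_cutoff'] continuous_intros) auto
  have evL: "\<forall>\<^sub>F n in sequentially. 4 / real (Suc n) < L"
    using order_tendstoD(2)[OF tendsto_Suc_over L] .
  have \<Phi>lim: "((\<lambda>x. \<Phi> (t, x)) \<longlongrightarrow> \<Phi> (t, x0)) (at x0 within {0<..<L})" for t x0
  proof -
    have "continuous_on UNIV (\<lambda>x. \<Phi> (t, x))"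
      by (intro continuous_on_compose2[OF C1_fun_continuous[OF \<Phi>]] continuous_intros) auto
    then have "((\<lambda>x. \<Phi> (t, x)) \<longlongrightarrow> \<Phi> (t, x0)) (at x0)" by (simp add: continuous_on_def)
    then show ?thesis by (rule tendsto_within_subset) auto
  qed
  have trace: "\<exists>N\<in>null_sets lborel. (F \<longlongrightarrow> (LINT t:{0..T}|lborel. g t * \<Phi> (t, x0))) (at x0 within ({0<..<L} - N))"
    if tr: "L1_trace (\<lambda>x t. q (t, x)) x0 {0<..<L} {0..T} g" and x0: "x0 \<in> {0..L}" for g x0
  proof (rule trace_integral_tendsto[OF tr, where \<Psi>="\<lambda>x t. \<Phi> (t, x)" and B=B and C=M])
    show "\<bar>\<Phi> (t, x)\<bar> \<le> M" if "x \<in> insert x0 {0<..<L}" "t \<in> {0..T}" for t x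
      using M(1)[of "(t, x)"] that x0 by auto
    show "(\<lambda>t. \<Phi> (t, x)) \<in> borel_measurable borel" "(\<lambda>t. q (t, x)) \<in> borel_measurable borel" for x
      by (intro measurable_slices C1_fun_measurable[OF \<Phi>] qm)+
    show "\<bar>q (y, s)\<bar> \<le> B" if "s \<in> {0<..<L}" "y \<in> {0..T}" for s y using qb[of "(y, s)"] that by auto
    show "((\<lambda>s. \<Phi> (y, s)) \<longlongrightarrow> \<Phi> (y, x0)) (at x0 within {0<..<L})" for y by (rule \<Phi>lim)
    show "emeasure lborel {0..T} < \<infinity>" using T by simp
  qed (auto simp: F_def[abs_def])
  have lim3: "(\<lambda>n. LINT x:{0..L}|lborel. cutoff' n x * F x) \<longlonglongrightarrow> (LINT t:{0..T}|lborel. q0 t * \<Phi> (t, 0))"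
  proof -
    have "set_integrable lborel {0..L} (\<lambda>s. cutoff' n s * F s)" for n
      using cutoff'_bounded[of n] Fub(2)[of "cutoff' n"] by (metis measurable_cutoff(2))
    then show ?thesis using trace[OF q0] L by (auto intro: cutoff_layer_limit)
  qed
  have lim4: "(\<lambda>n. LINT x:{0..L}|lborel. cutoff' n (L - x) * F x) \<longlonglongrightarrow> (LINT t:{0..T}|lborel. qL t * \<Phi> (t, L))"
  proof -
    obtain N where N: "N \<in> null_sets lborel"
      "(F \<longlongrightarrow> (LINT t:{0..T}|lborel. qL t * \<Phi> (t, L))) (at L within ({0<..<L} - N))"
      using trace[OF qL] L by auto
    show ?thesis
    proof (rule layer_limit[OF _ _ _ tendsto_Suc_over[of 2] _ _ N])
      show "\<forall>\<^sub>F n in sequentially. set_integrable lborel {0..L} (\<lambda>x. cutoff' n (L - x)) \<and> (LINT s:{0..L}|lborel. cutoff' n (L - s)) = 1"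
        using evL
      proof eventually_elim
        case (elim n)
        have "(LINT s:{0..L}|lborel. cutoff' n (L - s)) = - cutoff n (L - L) - (- cutoff n (L - 0))"
        proof (rule set_integral_FTC[OF _ _ contr])
          show "((\<lambda>x. - cutoff n (L - x)) has_real_derivative cutoff' n (L - x)) (at x)" for x
          proof -
            have "((\<lambda>x. L - x) has_real_derivative - 1) (at x)" by (auto intro!: derivative_eq_intros)
            from DERIV_minus[OF DERIV_chain'[OF this cutoff_deriv[of n]]] show ?thesis by simp
          qed
        qed (use L in simp)
        moreover have "2 / real (Suc n) \<le> L" using elim by (simp add: field_simps)
        ultimately show ?case using cutoff_zero[of 0 n] cutoff_one[of n L] by (simp add: intc[OF contr])
      qed
      show "\<forall>\<^sub>F n in sequentially. \<forall>s\<in>{0..L}. cutoff' n (L - s) \<noteq> 0 \<longrightarrow> s \<in> {0<..<L} \<and> \<bar>s - L\<bar> \<le> 2 / real (Suc n)"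
        using evL
      proof eventually_elim
        case (elim n)
        have "0 < 1 / real (Suc n)" "2 / real (Suc n) < 4 / real (Suc n)" by (simp_all add: field_simps)
        with elim cutoff'_nonzero[of n] show ?case by fastforce
      qed
      show "set_integrable lborel {0..L} (\<lambda>s. cutoff' n (L - s) * F s)" for n
      proof -
        obtain Q where "\<And>t. \<bar>cutoff' n t\<bar> \<le> Q" using cutoff'_bounded by metis
        then show ?thesis by (intro Fub(2)) auto
      qed
    qed (auto simp: cutoff'_nonneg)
  qed
  have AEx: "AE z in lborel. snd (z :: real \<times> real) \<noteq> 0 \<and> snd z \<noteq> L"
    by (intro AE_lborel_projections(2) AE_conjI AE_lborel_singleton)
  have blim: "(\<lambda>n. b n x) \<longlonglongrightarrow> 1" if "0 < x" "x < L" for x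
    using tendsto_mult[OF cutoff_tendsto[of x] cutoff_tendsto[of "L - x"]] that by (simp add: b_def)
  have lim5: "(\<lambda>n. LINT z:?R|lborel. b n (snd z) * H z) \<longlonglongrightarrow> (LINT z:?R|lborel. H z)"
  proof (rule set_integral_dominated_bounded[OF Rfin])
    show "(\<lambda>z. b n (snd z) * H z) \<in> borel_measurable borel" for n
      by measurable
    show "\<bar>b n (snd z) * H z\<bar> \<le> 1 * (B * M + B * M)" if "z \<in> ?R" for n z
      by (intro mult_bd Hb that bb)
    show "AE z in lborel. z \<in> ?R \<longrightarrow> (\<lambda>n. b n (snd z) * H z) \<longlonglongrightarrow> H z"
      using AEx
    proof eventually_elim
      case (elim z)
      show ?case
      proof
        assume "z \<in> ?R"
        with elim have "0 < snd z" "snd z < L" by auto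
        from tendsto_mult[OF blim[OF this] tendsto_const[of "H z"]]
        show "(\<lambda>n. b n (snd z) * H z) \<longlonglongrightarrow> H z" by simp
      qed
    qed
  qed measurable
  have lim6: "(\<lambda>n. LINT x:{0..L}|lborel. u0 x * (\<Phi> (0, x) * b n x)) \<longlonglongrightarrow> (LINT x:{0..L}|lborel. u0 x * \<Phi> (0, x))"
  proof (rule set_integral_weighted_limit)
    show "set_integrable lborel {0..L} u0" using u0 by (simp add: L1_trace_def)
    have [measurable]: "(\<lambda>x. \<Phi> (0, x)) \<in> borel_measurable borel"
      by (intro measurable_slices C1_fun_measurable[OF \<Phi>])
    show "(\<lambda>x. \<Phi> (0, x)) \<in> borel_measurable borel" "(\<lambda>x. \<Phi> (0, x) * b n x) \<in> borel_measurable borel" for n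
      by measurable
    show "\<bar>\<Phi> (0, x) * b n x\<bar> \<le> M * 1" if "x \<in> {0..L}" for n x
      using M(1)[of "(0, x)"] that T by (intro mult_bd bb) auto
    show "AE x in lborel. x \<in> {0..L} \<longrightarrow> (\<lambda>n. \<Phi> (0, x) * b n x) \<longlonglongrightarrow> \<Phi> (0, x)"
      using AE_lborel_singleton[of 0] AE_lborel_singleton[of L]
    proof eventually_elim
      case (elim x)
      then show ?case using tendsto_mult[OF tendsto_const[of "\<Phi> (0, x)"] blim[of x]] by auto
    qed
  qed
  have "\<forall>\<^sub>F n in sequentially. 0 \<le> ((LINT z:?R|lborel. b n (snd z) * H z) + (LINT x:{0..L}|lborel. u0 x * (\<Phi> (0, x) * b n x)))
      + ((LINT x:{0..L}|lborel. cutoff' n x * F x) - (LINT x:{0..L}|lborel. cutoff' n (L - x) * F x))"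
    using evL
  proof eventually_elim
    case (elim n)
    \<comment> \<open>Since 4/(n+1) < L, the transition zones at the two ends are disjoint: where
      the derivative of one cutoff is nonzero, the other cutoff is already 1.\<close>
    have b'eq: "b' n x = cutoff' n x - cutoff' n (L - x)" for x
    proof -
      have 24: "2 / real (Suc n) + 2 / real (Suc n) = 4 / real (Suc n)"
        by (simp flip: add_divide_distrib)
      have "cutoff n (L - x) = 1" if "cutoff' n x \<noteq> 0"
        using cutoff'_nonzero[OF that] elim 24 by (intro cutoff_one) linarith
      moreover have "cutoff n x = 1" if "cutoff' n (L - x) \<noteq> 0"
        using cutoff'_nonzero[OF that] elim 24 by (intro cutoff_one) linarith
      ultimately show ?thesis unfolding b'_def by (metis mult.right_neutral mult_zero_left mult_zero_right mult_1)
    qed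
    obtain Q where Q: "\<And>t. \<bar>cutoff' n t\<bar> \<le> Q" using cutoff'_bounded by metis
    note i1 = Fub[OF measurable_cutoff(2) Q] and i2 = Fub[of "\<lambda>x. cutoff' n (L - x)", OF _ Q, simplified]
    have j1: "set_integrable lborel ?R (\<lambda>z. k (snd z) * (q z * \<Phi> z))"
      if "k \<in> borel_measurable borel" "\<And>x. \<bar>k x\<bar> \<le> Q" for k
      by (rule set_integrable_bounded[OF Rfin qP[OF that(1)] qPb[where k=k, OF that(2)]])
    have j2: "set_integrable lborel ?R (\<lambda>z. b n (snd z) * H z)"
      by (rule set_integrable_bounded[OF Rfin _ mult_bd[OF bb(3) Hb]]) measurable
    have "(LINT z:?R|lborel. G n z) = (LINT z:?R|lborel. b n (snd z) * H z +
        (cutoff' n (snd z) * (q z * \<Phi> z) - cutoff' n (L - snd z) * (q z * \<Phi> z)))"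
      by (intro set_lebesgue_integral_cong) (auto simp: G_def H_def b'eq algebra_simps lborel_prod[symmetric])
    also have "\<dots> = (LINT z:?R|lborel. b n (snd z) * H z) +
        ((LINT z:?R|lborel. cutoff' n (snd z) * (q z * \<Phi> z)) - (LINT z:?R|lborel. cutoff' n (L - snd z) * (q z * \<Phi> z)))"
      using j1[of "cutoff' n"] j1[of "\<lambda>x. cutoff' n (L - x)"] j2 Q
      by (simp add: set_integral_add set_integral_diff)
    finally show ?case using stage1[of n] by (simp add: i1 i2)
  qed
  then have "0 \<le> ((LINT z:?R|lborel. H z) + (LINT x:{0..L}|lborel. u0 x * \<Phi> (0, x))) +
      ((LINT t:{0..T}|lborel. q0 t * \<Phi> (t, 0)) - (LINT t:{0..T}|lborel. qL t * \<Phi> (t, L)))"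
    by (intro tendsto_lowerbound[OF tendsto_add[OF tendsto_add[OF lim5 lim6] tendsto_diff[OF lim3 lim4]]]) auto
  then show ?thesis by (simp add: H_def)
qed

section \<open>Characteristics\<close>

text \<open>The assumptions hold on the whole line, as they do for the clamped extension of a
  control. The two-sided bound makes \<open>V\<close> bi-Lipschitz, and the countability condition
  makes it differentiable almost everywhere.\<close>

locale velocity =
  fixes v :: "real \<Rightarrow> real" and vmin vmax :: real
  assumes v_measurable [measurable]: "v \<in> borel_measurable borel"
    and vmin_pos: "0 < vmin"
    and v_bounds: "vmin \<le> v t" "v t \<le> vmax"
    and v_discont: "countable {t. \<not> isCont v t}"
begin

lemma vmax_pos: "0 < vmax" using vmin_pos v_bounds[of 0] by linarith

lemma v_pos: "0 < v t" using vmin_pos v_bounds(1)[of t] by linarith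

lemma abs_v_le: "\<bar>v t\<bar> \<le> vmax" using v_pos[of t] v_bounds(2)[of t] by simp

lemma AE_isCont_v: "AE t in lborel. isCont v t"
proof (rule AE_I')
  show "{t. \<not> isCont v t} \<in> null_sets lborel" using v_discont by (rule countable_imp_null_set_lborel)
qed auto

text \<open>The oriented integral defines \<open>V\<close> for negative times as well, so that it
  becomes a bijection of the line.\<close>

definition V :: "real \<Rightarrow> real" where "V t = (LBINT s=0..t. v s)"

lemma V_0 [simp]: "V 0 = 0"
  unfolding V_def by (metis interval_integral_endpoints_same zero_ereal_def)

lemma v_set_integrable: "set_integrable lborel {a..b} v"
  by (rule set_integrable_Icc_bounded[OF v_measurable abs_v_le])

lemma V_diff:
  assumes "s \<le> t" shows "V t - V s = (LINT x:{s..t}|lborel. v x)"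
proof -
  have "interval_lebesgue_integrable lborel (ereal a) (ereal b) v" for a b
    unfolding interval_lebesgue_integrable_def
    by (auto intro: set_integrable_subset[OF v_set_integrable[of a b]] set_integrable_subset[OF v_set_integrable[of b a]])
  then have "(LBINT x=0..ereal s. v x) + (LBINT x=ereal s..ereal t. v x) = (LBINT x=0..ereal t. v x)"
    by (intro interval_integral_sum) (simp add: min_def max_def zero_ereal_def)
  then show ?thesis using assms by (simp add: V_def interval_integral_Icc)
qed

lemma V_diff_bounds:
  assumes "s \<le> t" "\<And>x. x \<in> {s..t} \<Longrightarrow> m \<le> v x \<and> v x \<le> M"
  shows "m * (t - s) \<le> V t - V s" "V t - V s \<le> M * (t - s)"
proof -
  have c: "(LINT x:{s..t}|lborel. c) = c * (t - s)" "set_integrable lborel {s..t} (\<lambda>_. c)" for c :: real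
    using assms(1) by (auto simp: set_lebesgue_integral_def set_integrable_def mult.commute)
  show "m * (t - s) \<le> V t - V s" unfolding V_diff[OF assms(1)] c(1)[symmetric]
    using assms(2) by (intro set_integral_mono c v_set_integrable) auto
  show "V t - V s \<le> M * (t - s)" unfolding V_diff[OF assms(1)] c(1)[symmetric]
    using assms(2) by (intro set_integral_mono c v_set_integrable) auto
qed

lemma V_bounds:
  assumes "s \<le> t" shows "vmin * (t - s) \<le> V t - V s" "V t - V s \<le> vmax * (t - s)"
  using V_diff_bounds[OF assms, of vmin vmax] v_bounds by auto

lemma V_mono: "s \<le> t \<Longrightarrow> V s \<le> V t"
  using V_bounds(1)[of s t] vmin_pos by (smt (verit) mult_nonneg_nonneg)

lemma V_less_iff: "V s < V t \<longleftrightarrow> s < t"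
proof (cases "s < t")
  case True
  then have "0 < vmin * (t - s)" using vmin_pos by simp
  with V_bounds(1)[of s t] True show ?thesis by linarith
next
  case False
  then show ?thesis using V_mono[of t s] by simp
qed

lemma V_le_iff: "V s \<le> V t \<longleftrightarrow> s \<le> t"
  using V_less_iff[of t s] by linarith

lemma V_eq_iff: "V s = V t \<longleftrightarrow> s = t"
  using V_less_iff[of t s] V_less_iff[of s t] by linarith

lemma V_lipschitz: "\<bar>V t - V s\<bar> \<le> vmax * \<bar>t - s\<bar>"
  using V_bounds(2)[of s t] V_bounds(2)[of t s] V_mono[of s t] V_mono[of t s] by (cases "s \<le> t") auto

lemma V_expansive: "vmin * \<bar>t - s\<bar> \<le> \<bar>V t - V s\<bar>"
  using V_bounds(1)[of s t] V_bounds(1)[of t s] by (cases "s \<le> t") auto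

lemma isCont_lipschitz:
  fixes f :: "real \<Rightarrow> real"
  assumes "\<And>s t. \<bar>f t - f s\<bar> \<le> c * \<bar>t - s\<bar>"
  shows "isCont f x"
proof -
  have "((\<lambda>t. f t - f x) \<longlongrightarrow> 0) (at x)"
  proof (rule Lim_null_comparison)
    show "\<forall>\<^sub>F t in at x. norm (f t - f x) \<le> c * \<bar>t - x\<bar>" using assms by simp
    show "((\<lambda>t. c * \<bar>t - x\<bar>) \<longlongrightarrow> 0) (at x)"
      by (rule tendsto_eq_intros refl | simp)+
  qed
  then show ?thesis by (simp add: isCont_def LIM_zero_iff)
qed

lemma isCont_V: "isCont V x" using V_lipschitz by (rule isCont_lipschitz)

lemma continuous_on_V: "continuous_on S V"
  by (simp add: continuous_at_imp_continuous_on isCont_V)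

lemma V_measurable [measurable]: "V \<in> borel_measurable borel"
  by (rule borel_measurable_continuous_onI[OF continuous_on_V])

text \<open>The difference quotient is a mean of \<open>v\<close> over a short interval, hence close
  to \<open>v t\<close> at a point of continuity.\<close>

lemma V_deriv:
  assumes "isCont v t" shows "(V has_real_derivative v t) (at t)"
  unfolding DERIV_def
proof (rule LIM_I)
  fix e :: real assume e: "0 < e"
  then obtain d where d: "0 < d" "\<And>x. \<bar>x - t\<bar> < d \<Longrightarrow> \<bar>v x - v t\<bar> < e / 2"
    using assms[unfolded continuous_at_eps_delta, rule_format, of "e / 2"] by (auto simp: dist_real_def)
  have "\<bar>(V (t + h) - V t) / h - v t\<bar> < e" if h: "h \<noteq> 0" "\<bar>h\<bar> < d" for h
  proof -
    have b: "v t - e / 2 \<le> v x \<and> v x \<le> v t + e / 2" if "\<bar>x - t\<bar> < d" for x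
      using d(2)[OF that] unfolding abs_less_iff by linarith
    have "(v t - e / 2) \<le> (V (t + h) - V t) / h \<and> (V (t + h) - V t) / h \<le> v t + e / 2"
    proof (cases "0 < h")
      case True
      then have "(v t - e / 2) * (t + h - t) \<le> V (t + h) - V t" "V (t + h) - V t \<le> (v t + e / 2) * (t + h - t)"
        using True h by (intro V_diff_bounds[of t "t + h" "v t - e / 2" "v t + e / 2"] b; simp)+
      then show ?thesis using True by (simp add: field_simps)
    next
      case False
      then have "(v t - e / 2) * (t - (t + h)) \<le> V t - V (t + h)" "V t - V (t + h) \<le> (v t + e / 2) * (t - (t + h))"
        using False h by (intro V_diff_bounds[of "t + h" t "v t - e / 2" "v t + e / 2"] b; simp)+
      then show ?thesis using False h by (simp add: field_simps)
    qed
    then show ?thesis using e by (auto simp: abs_less_iff)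
  qed
  then show "\<exists>s>0. \<forall>x. x \<noteq> 0 \<and> norm (x - 0) < s \<longrightarrow> norm ((V (t + x) - V t) / x - v t) < e"
    using d(1) by auto
qed

section \<open>The inverse of \<open>V\<close> and smooth approximations of \<open>V\<close>\<close>

definition V_inv :: "real \<Rightarrow> real" where "V_inv = inv V"

lemma bij_V: "bij V"
proof (rule bijI)
  show "inj V" by (auto simp: inj_def V_eq_iff)
  show "surj V"
    unfolding surj_def
  proof
    fix y
    \<comment> \<open>\<open>V\<close> grows at least at speed \<open>vmin\<close> and vanishes at
      0, so it passes the value y between -a and a.\<close>
    define a where "a = \<bar>y\<bar> / vmin"
    have a: "0 \<le> a" "vmin * a = \<bar>y\<bar>" using vmin_pos by (auto simp: a_def)
    have "V (- a) \<le> y" "y \<le> V a"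
      using V_bounds(1)[of 0 a] V_bounds(1)[of "-a" 0] a by auto
    then show "\<exists>x. y = V x"
      using IVT[of V "- a" y a] a isCont_V by force
  qed
qed

lemma V_V_inv [simp]: "V (V_inv y) = y" unfolding V_inv_def by (rule surj_f_inv_f[OF bij_is_surj[OF bij_V]])
lemma V_inv_V [simp]: "V_inv (V t) = t" unfolding V_inv_def by (rule inv_f_f[OF bij_is_inj[OF bij_V]])

lemma isCont_V_inv: "isCont V_inv y"
proof (rule isCont_lipschitz)
  fix s t
  show "\<bar>V_inv t - V_inv s\<bar> \<le> (1 / vmin) * \<bar>t - s\<bar>"
    using V_expansive[of "V_inv t" "V_inv s"] vmin_pos by (simp add: field_simps)
qed

lemma V_inv_measurable [measurable]: "V_inv \<in> borel_measurable borel"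
  by (rule borel_measurable_continuous_onI) (simp add: continuous_at_imp_continuous_on isCont_V_inv)

text \<open>Averaging \<open>V\<close> forwards in time gives \<open>C\<^sup>1\<close> approximations that lie above \<open>V\<close>.\<close>

definition PV :: "real \<Rightarrow> real" where "PV = (SOME F. \<forall>t. (F has_real_derivative V t) (at t))"

lemma PV_deriv: "(PV has_real_derivative V t) (at t)"
proof -
  \<comment> \<open>With infinite end points the antiderivative theorem for open intervals yields a
    single primitive on the whole line.\<close>
  have "\<exists>F. \<forall>x::real. -\<infinity> < ereal x \<longrightarrow> ereal x < \<infinity> \<longrightarrow> (F has_vector_derivative V x) (at x)"
    by (rule einterval_antiderivative) (auto simp: isCont_V)
  then have "\<exists>F. \<forall>t. (F has_real_derivative V t) (at t)"
    by (simp add: has_real_derivative_iff_has_vector_derivative)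
  then show ?thesis unfolding PV_def by (rule someI2_ex) simp
qed

definition V_avg :: "nat \<Rightarrow> real \<Rightarrow> real" where
  "V_avg n t = real (Suc n) * (PV (t + 1 / real (Suc n)) - PV t)"

definition V_avg' :: "nat \<Rightarrow> real \<Rightarrow> real" where
  "V_avg' n t = real (Suc n) * (V (t + 1 / real (Suc n)) - V t)"

lemma V_avg_deriv: "(V_avg n has_real_derivative V_avg' n t) (at t)"
proof -
  have "((\<lambda>t. t + 1 / real (Suc n)) has_real_derivative 1) (at t)"
    by (auto intro!: derivative_eq_intros)
  from DERIV_cmult[OF DERIV_diff[OF DERIV_chain'[OF this PV_deriv] PV_deriv]]
  show ?thesis unfolding V_avg_def[abs_def] V_avg'_def by simp
qed

lemma continuous_V_avg': "continuous_on S (V_avg' n)"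
  unfolding V_avg'_def[abs_def]
  by (intro continuous_intros continuous_on_compose2[OF continuous_on_V[of UNIV]]) auto

lemma continuous_V_avg: "continuous_on S (V_avg n)"
  using V_avg_deriv by (intro DERIV_continuous_on) (auto intro: has_field_derivative_at_within)

lemma V_avg_measurable [measurable]: "V_avg n \<in> borel_measurable borel" "V_avg' n \<in> borel_measurable borel"
  using continuous_V_avg continuous_V_avg' by (auto intro: borel_measurable_continuous_onI)

lemma V_avg_bounds: "V t \<le> V_avg n t" "V_avg n t \<le> V t + vmax / real (Suc n)"
proof -
  have "t < t + 1 / real (Suc n)" by simp
  from MVT2[OF this, of PV V] PV_deriv obtain z where
    z: "t < z" "z < t + 1 / real (Suc n)" "PV (t + 1 / real (Suc n)) - PV t = (t + 1 / real (Suc n) - t) * V z"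
    by blast
  then have V_avg: "V_avg n t = V z" by (simp add: V_avg_def)
  show "V t \<le> V_avg n t" unfolding V_avg using z by (simp add: V_le_iff)
  have "V z \<le> V t + vmax * (z - t)" using V_bounds(2)[of t z] z by simp
  also have "\<dots> \<le> V t + vmax * (1 / real (Suc n))"
    using z vmax_pos by (intro add_left_mono mult_left_mono) auto
  finally show "V_avg n t \<le> V t + vmax / real (Suc n)" unfolding V_avg by simp
qed

lemma V_avg'_bounds: "0 \<le> V_avg' n t" "V_avg' n t \<le> vmax"
proof -
  have t: "t \<le> t + 1 / real (Suc n)" by simp
  show "0 \<le> V_avg' n t" unfolding V_avg'_def using V_mono[OF t] by simp
  have "V_avg' n t \<le> real (Suc n) * (vmax * (1 / real (Suc n)))"
    unfolding V_avg'_def using V_bounds(2)[OF t] by (intro mult_left_mono) auto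
  then show "V_avg' n t \<le> vmax" by simp
qed

lemma V_avg'_tendsto:
  assumes "isCont v t" shows "(\<lambda>n. V_avg' n t) \<longlonglongrightarrow> v t"
proof -
  have "((\<lambda>h. (V (t + h) - V t) / h) \<longlongrightarrow> v t) (at 0)" using V_deriv[OF assms] by (simp add: DERIV_def)
  moreover have "filterlim (\<lambda>n. 1 / real (Suc n)) (at 0) sequentially"
    unfolding filterlim_at using tendsto_Suc_over[of 1] by simp
  ultimately have "(\<lambda>n. (V (t + 1 / real (Suc n)) - V t) / (1 / real (Suc n))) \<longlonglongrightarrow> v t"
    by (rule filterlim_compose)
  then show ?thesis by (simp add: V_avg'_def mult.commute)
qed

lemma V_avg_tendsto: "(\<lambda>n. V_avg n t) \<longlonglongrightarrow> V t"
proof (rule tendsto_sandwich[OF _ _ tendsto_const])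
  show "(\<lambda>n. V t + vmax / real (Suc n)) \<longlonglongrightarrow> V t"
    using tendsto_add[OF tendsto_const[of "V t"] tendsto_Suc_over[of vmax]] by simp
qed (use V_avg_bounds in auto)

lemma C1_fun_V_avg: "C1_fun (\<lambda>z. V_avg n (fst z)) (\<lambda>z. V_avg' n (fst z)) (\<lambda>z. 0)"
  using C1_fun_compose[OF C1_fun_coords(1) V_avg_deriv continuous_V_avg', of n] by simp

text \<open>The integrand is the derivative of \<open>\<phi>\<close> along the curve x = V t - s,
  but only almost everywhere, as \<open>V\<close> is merely Lipschitz. The fundamental theorem is
  therefore applied to the \<open>C\<^sup>1\<close> curves given by \<open>V_avg n\<close>, and n
  tends to infinity.\<close>

lemma integral_along_characteristic:
  assumes \<phi>: "C1_fun \<phi> \<phi>t \<phi>x" and T: "0 \<le> T"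
  shows "(LINT t:{0..T}|lborel. \<phi>t (t, V t - s) + v t * \<phi>x (t, V t - s)) = \<phi> (T, V T - s) - \<phi> (0, - s)"
proof -
  note cont = C1_fun_continuous[OF \<phi>]
  have ct: "continuous_on UNIV \<phi>t" "continuous_on UNIV \<phi>x" using \<phi> by (auto simp: C1_fun_def)
  define D where "D n t = \<phi>t (t, V_avg n t - s) + V_avg' n t * \<phi>x (t, V_avg n t - s)" for n t
  have cD: "continuous_on UNIV (D n)" for n
    unfolding D_def by (intro continuous_intros continuous_V_avg continuous_V_avg'
        continuous_on_compose2[OF ct(1)] continuous_on_compose2[OF ct(2)]) auto
  have FTC: "(LINT t:{0..T}|lborel. D n t) = \<phi> (T, V_avg n T - s) - \<phi> (0, V_avg n 0 - s)" for n
  proof (rule set_integral_FTC[OF T _ cD])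
    fix t
    have "((\<lambda>t. V_avg n t - s) has_real_derivative V_avg' n t) (at t)"
      using DERIV_diff[OF V_avg_deriv DERIV_const[of s]] by simp
    then have "((\<lambda>t. (t, V_avg n t - s)) has_derivative (\<lambda>h. (h, V_avg' n t * h))) (at t)"
      unfolding has_field_derivative_def by (intro has_derivative_Pair has_derivative_ident)
    from has_derivative_compose[OF this C1_funD[OF \<phi>]]
    have "((\<lambda>t. \<phi> (t, V_avg n t - s)) has_derivative (\<lambda>h. \<phi>t (t, V_avg n t - s) * h + \<phi>x (t, V_avg n t - s) * (V_avg' n t * h))) (at t)"
      by simp
    then show "((\<lambda>t. \<phi> (t, V_avg n t - s)) has_real_derivative D n t) (at t)"
      unfolding has_field_derivative_def by (rule has_derivative_eq_rhs) (simp add: fun_eq_iff D_def algebra_simps)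
  qed
  \<comment> \<open>One box contains all the averaged curves, because \<open>V_avg n t\<close> lies
    between \<open>V t\<close> and \<open>V t + vmax\<close> and \<open>V\<close> increases from 0
    to \<open>V T\<close>.\<close>
  obtain M where M: "\<And>z. z \<in> {0..T} \<times> {- s..V T + vmax - s} \<Longrightarrow> \<bar>\<phi> z\<bar> \<le> M \<and> \<bar>\<phi>t z\<bar> \<le> M \<and> \<bar>\<phi>x z\<bar> \<le> M" "0 \<le> M"
    using C1_fun_bounded_rect[OF \<phi>] by metis
  have rect: "(t, V_avg n t - s) \<in> {0..T} \<times> {- s..V T + vmax - s}" if "t \<in> {0..T}" for n t
  proof -
    have "vmax / real (Suc n) \<le> vmax" using vmax_pos by (simp add: field_simps)
    moreover have "V 0 \<le> V t" "V t \<le> V T" using that by (intro V_mono; simp)+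
    ultimately show ?thesis using that V_avg_bounds[where n=n and t=t] by auto
  qed
  have "(\<lambda>n. LINT t:{0..T}|lborel. D n t) \<longlonglongrightarrow> (LINT t:{0..T}|lborel. \<phi>t (t, V t - s) + v t * \<phi>x (t, V t - s))"
  proof (rule set_integral_dominated_bounded)
    show "D n \<in> borel_measurable borel" for n by (rule borel_measurable_continuous_onI[OF cD])
    have "(\<lambda>t. \<phi>t (t, V t - s)) \<in> borel_measurable borel" "(\<lambda>t. \<phi>x (t, V t - s)) \<in> borel_measurable borel"
      by (intro borel_measurable_continuous_onI continuous_intros continuous_on_V
        continuous_on_compose2[OF ct(1)] continuous_on_compose2[OF ct(2)]; simp)+
    then show "(\<lambda>t. \<phi>t (t, V t - s) + v t * \<phi>x (t, V t - s)) \<in> borel_measurable borel" by measurable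
    show "\<bar>D n t\<bar> \<le> M + vmax * M" if "t \<in> {0..T}" for n t
    proof -
      have "\<bar>D n t\<bar> \<le> \<bar>\<phi>t (t, V_avg n t - s)\<bar> + V_avg' n t * \<bar>\<phi>x (t, V_avg n t - s)\<bar>"
        unfolding D_def using V_avg'_bounds(1)[where n=n and t=t] by (intro order_trans[OF abs_triangle_ineq]) (simp add: abs_mult)
      also have "\<dots> \<le> M + vmax * M"
        using M(1)[OF rect[OF that], of n] V_avg'_bounds[where n=n and t=t] vmax_pos by (intro add_mono mult_mono) auto
      finally show ?thesis .
    qed
    show "AE t in lborel. t \<in> {0..T} \<longrightarrow> (\<lambda>n. D n t) \<longlonglongrightarrow> \<phi>t (t, V t - s) + v t * \<phi>x (t, V t - s)"
      using AE_isCont_v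
    proof eventually_elim
      case (elim t)
      have "(\<lambda>n. (t, V_avg n t - s)) \<longlonglongrightarrow> (t, V t - s)" by (intro tendsto_intros V_avg_tendsto)
      then have "(\<lambda>n. \<phi>t (t, V_avg n t - s)) \<longlonglongrightarrow> \<phi>t (t, V t - s)" "(\<lambda>n. \<phi>x (t, V_avg n t - s)) \<longlonglongrightarrow> \<phi>x (t, V t - s)"
        using ct by (auto intro!: isCont_tendsto_compose[of _ \<phi>t] isCont_tendsto_compose[of _ \<phi>x] simp: continuous_on_eq_continuous_at)
      then show ?case unfolding D_def by (intro impI tendsto_intros V_avg'_tendsto elim)
    qed
  qed (use T in auto)
  moreover have "(\<lambda>n. \<phi> (T, V_avg n T - s) - \<phi> (0, V_avg n 0 - s)) \<longlonglongrightarrow> \<phi> (T, V T - s) - \<phi> (0, V 0 - s)"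
    using cont by (intro tendsto_diff isCont_tendsto_compose[of _ \<phi>] tendsto_intros V_avg_tendsto) (auto simp: continuous_on_eq_continuous_at)
  ultimately show ?thesis unfolding FTC by (simp add: LIMSEQ_unique)
qed

end

section \<open>The outflow of an arbitrary entropy solution\<close>

text \<open>A quantity that depends on the solution in a Lipschitz way inherits a trace. This
  supplies the traces of the congestion, of the flux and of the absolute value.\<close>

lemma L1_trace_dominated:
  assumes tr: "L1_trace w s0 S I g"
    and w: "\<And>s. s \<in> S \<Longrightarrow> set_integrable lborel I (w s)"
    and w': "\<And>s. s \<in> S \<Longrightarrow> set_integrable lborel I (w' s)" and g': "set_integrable lborel I g'"
    and le: "\<And>s. s \<in> S \<Longrightarrow> AE y in lborel. y \<in> I \<longrightarrow> \<bar>w' s y - g' y\<bar> \<le> C * \<bar>w s y - g y\<bar>"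
  shows "L1_trace w' s0 S I g'"
proof -
  obtain N where g: "set_integrable lborel I g" and N: "N \<in> null_sets lborel"
    and lim: "((\<lambda>s. LINT y:I|lborel. \<bar>w s y - g y\<bar>) \<longlongrightarrow> 0) (at s0 within (S - N))"
    using tr unfolding L1_trace_def by blast
  have "((\<lambda>s. LINT y:I|lborel. \<bar>w' s y - g' y\<bar>) \<longlongrightarrow> 0) (at s0 within (S - N))"
  proof (rule Lim_null_comparison)
    show "((\<lambda>s. C * (LINT y:I|lborel. \<bar>w s y - g y\<bar>)) \<longlongrightarrow> 0) (at s0 within (S - N))"
      using tendsto_mult[OF tendsto_const[of C] lim] by simp
    show "\<forall>\<^sub>F s in at s0 within (S - N). norm (LINT y:I|lborel. \<bar>w' s y - g' y\<bar>) \<le> C * (LINT y:I|lborel. \<bar>w s y - g y\<bar>)"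
      unfolding eventually_at_filter
    proof (intro always_eventually allI impI)
      fix s assume "s \<in> S - N"
      then have s: "s \<in> S" by simp
      have i': "set_integrable lborel I (\<lambda>y. \<bar>w' s y - g' y\<bar>)"
        by (intro set_integrable_abs set_integral_diff w' g' s)
      have i: "set_integrable lborel I (\<lambda>y. C * \<bar>w s y - g y\<bar>)"
        using set_integrable_abs[OF set_integral_diff(1)[OF w[OF s] g]] by simp
      have "0 \<le> (LINT y:I|lborel. \<bar>w' s y - g' y\<bar>)"
        unfolding set_lebesgue_integral_def by (rule Bochner_Integration.integral_nonneg) simp
      moreover have "(LINT y:I|lborel. \<bar>w' s y - g' y\<bar>) \<le> (LINT y:I|lborel. C * \<bar>w s y - g y\<bar>)"
        using le[OF s] by (intro set_integral_mono_AE[OF i' i])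
      ultimately show "norm (LINT y:I|lborel. \<bar>w' s y - g' y\<bar>) \<le> C * (LINT y:I|lborel. \<bar>w s y - g y\<bar>)"
        by simp
    qed
  qed
  with g' N show ?thesis unfolding L1_trace_def by blast
qed

lemma L1_trace_cong:
  assumes "\<And>s y. s \<in> S \<Longrightarrow> y \<in> I \<Longrightarrow> w s y = w' s y"
  shows "L1_trace w s0 S I g \<longleftrightarrow> L1_trace w' s0 S I g"
proof -
  have "((\<lambda>s. LINT y:I|lborel. \<bar>w s y - g y\<bar>) \<longlongrightarrow> 0) (at s0 within (S - N)) \<longleftrightarrow>
        ((\<lambda>s. LINT y:I|lborel. \<bar>w' s y - g y\<bar>) \<longlongrightarrow> 0) (at s0 within (S - N))" for N
  proof (rule tendsto_cong)
    show "\<forall>\<^sub>F s in at s0 within (S - N). (LINT y:I|lborel. \<bar>w s y - g y\<bar>) = (LINT y:I|lborel. \<bar>w' s y - g y\<bar>)"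
      unfolding eventually_at_filter set_lebesgue_integral_def
      using assms by (intro always_eventually allI impI Bochner_Integration.integral_cong) (auto simp: indicator_def)
  qed
  then show ?thesis unfolding L1_trace_def by simp
qed

lemma slices_integrable:
  fixes g :: "real \<times> real \<Rightarrow> real"
  assumes "g \<in> borel_measurable borel" and "\<And>z. \<bar>g z\<bar> \<le> C"
  shows "set_integrable lborel {a..b} (\<lambda>x. g (t, x))" "set_integrable lborel {a..b} (\<lambda>t. g (t, x))"
  using assms by (auto intro: set_integrable_Icc_bounded measurable_slices)

text \<open>The complement of the compact support is open and \<open>\<phi>\<close> is zero on it,
  so the derivatives vanish there too.\<close>

lemma test_function_outside:
  assumes "test_function L T \<phi> \<phi>t \<phi>x" "z \<notin> {0<..<T} \<times> {0<..<L}"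
  shows "\<phi> z = 0" "\<phi>t z = 0" "\<phi>x z = 0"
proof -
  obtain C where C: "compact C" "C \<subseteq> {0<..<T} \<times> {0<..<L}" "\<And>z. z \<notin> C \<Longrightarrow> \<phi> z = 0"
    and d: "C1_fun \<phi> \<phi>t \<phi>x"
    using assms(1) by (auto simp: test_function_iff)
  have z: "z \<notin> C" using assms(2) C(2) by blast
  show "\<phi> z = 0" by (rule C(3)[OF z])
  have "((\<lambda>_. 0) has_derivative (\<lambda>_. 0)) (at z)" by simp
  then have "(\<phi> has_derivative (\<lambda>_. 0)) (at z)"
    by (rule has_derivative_transform_within_open[of _ _ _ _ "- C"]) (use C z in \<open>auto intro: compact_imp_closed\<close>)
  from has_derivative_unique[OF C1_funD[OF d] this]
  have "\<phi>t z * fst h + \<phi>x z * snd h = 0" for h by meson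
  from this[of "(1, 0)"] this[of "(0, 1)"] show "\<phi>t z = 0" "\<phi>x z = 0" by simp_all
qed

text \<open>Each derivative is integrated first in its own variable; the coefficient
  \<open>a\<close> depends on time only and is constant in the x-integral. These identities remove
  the constant states from the entropy inequalities.\<close>

lemma test_function_integrals:
  assumes tf: "test_function L T \<phi> \<phi>t \<phi>x" and "0 < T" "0 < L"
    and a [measurable]: "a \<in> borel_measurable borel" and ab: "\<And>t. \<bar>a t\<bar> \<le> B"
  shows "(LINT z:{0..T} \<times> {0..L}|lborel. \<phi>t z) = 0"
    and "(LINT z:{0..T} \<times> {0..L}|lborel. a (fst z) * \<phi>x z) = 0"
proof -
  have C1: "C1_fun \<phi> \<phi>t \<phi>x" using tf by (simp add: test_function_iff)
  note [measurable] = C1_fun_measurable[OF C1]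
  have ct: "continuous_on UNIV \<phi>t" "continuous_on UNIV \<phi>x" using C1 by (auto simp: C1_fun_def)
  obtain M where M: "\<And>z. z \<in> {0..T} \<times> {0..L} \<Longrightarrow> \<bar>\<phi> z\<bar> \<le> M \<and> \<bar>\<phi>t z\<bar> \<le> M \<and> \<bar>\<phi>x z\<bar> \<le> M" "0 \<le> M"
    using C1_fun_bounded_rect[OF C1] by metis
  have t: "(LINT t:{0..T}|lborel. \<phi>t (t, x)) = 0" for x
  proof -
    have "((\<lambda>t. \<phi> (t, x)) has_real_derivative \<phi>t (t, x)) (at t)" for t
    proof -
      have "((\<lambda>t. (t, x)) has_derivative (\<lambda>h. (h, 0))) (at t)" by (intro derivative_intros)
      from has_derivative_compose[OF this C1_funD[OF C1]] show ?thesis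
        unfolding has_field_derivative_def by simp
    qed
    from set_integral_FTC[OF _ this continuous_on_compose2[OF ct(1)], of 0 T] show ?thesis
      using test_function_outside(1)[OF tf] \<open>0 < T\<close> by (simp add: continuous_intros)
  qed
  have x: "(LINT x:{0..L}|lborel. \<phi>x (t, x)) = 0" for t
  proof -
    have "((\<lambda>x. \<phi> (t, x)) has_real_derivative \<phi>x (t, x)) (at x)" for x
    proof -
      have "((\<lambda>x. (t, x)) has_derivative (\<lambda>h. (0, h))) (at x)" by (intro derivative_intros)
      from has_derivative_compose[OF this C1_funD[OF C1]] show ?thesis
        unfolding has_field_derivative_def by simp
    qed
    from set_integral_FTC[OF _ this continuous_on_compose2[OF ct(2)], of 0 L] show ?thesis
      using test_function_outside(1)[OF tf] \<open>0 < L\<close> by (simp add: continuous_intros)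
  qed
  show "(LINT z:{0..T} \<times> {0..L}|lborel. \<phi>t z) = 0"
    using M by (subst set_Fubini(2)[where B=M]) (auto simp: t)
  have "(LINT z:{0..T} \<times> {0..L}|lborel. a (fst z) * \<phi>x z) = (LINT t:{0..T}|lborel. LINT x:{0..L}|lborel. a t * \<phi>x (t, x))"
  proof (subst set_Fubini(1)[where B="B * M"])
    show "\<bar>a (fst z) * \<phi>x z\<bar> \<le> B * M" if "z \<in> {0..T} \<times> {0..L}" for z
      unfolding abs_mult using M(1)[OF that] ab[of "fst z"] by (intro mult_mono) auto
  qed auto
  then show "(LINT z:{0..T} \<times> {0..L}|lborel. a (fst z) * \<phi>x z) = 0" by (simp add: x)
qed

text \<open>The data are again globally defined. The bounds by \<open>\<rho>cr\<close> on the
  initial density and on the inflow density say that only free flow is prescribed.\<close>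

locale traffic = velocity +
  fixes L T \<rho>cr \<rho>max :: real and \<rho>0 In :: "real \<Rightarrow> real"
  assumes L_pos: "0 < L" and T_pos: "0 < T" and rcr_pos: "0 < \<rho>cr" and rcr_less: "\<rho>cr < \<rho>max"
    and rho0_measurable [measurable]: "\<rho>0 \<in> borel_measurable borel"
    and In_measurable [measurable]: "In \<in> borel_measurable borel"
    and rho0_bounds: "0 \<le> \<rho>0 x" "\<rho>0 x \<le> \<rho>cr"
    and In_bounds: "0 \<le> In t" "In t / v s \<le> \<rho>cr"
    and rho0_discont: "countable {x. \<not> isCont \<rho>0 x}"
    and In_discont: "countable {t. \<not> isCont In t}"
begin

abbreviation "R \<equiv> {0..T} \<times> {0..L}"

abbreviation "f \<equiv> newell_daganzo_flux \<rho>cr \<rho>max"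

lemma R_finite: "R \<in> sets borel" "emeasure lborel R < \<infinity>"
  using emeasure_lborel_rect by auto

lemma rmax_pos: "0 < \<rho>max" using rcr_pos rcr_less by simp

lemma abs_rho0_le: "\<bar>\<rho>0 x\<bar> \<le> \<rho>cr"
  using rho0_bounds by simp

lemma abs_In_le: "\<bar>In t\<bar> \<le> \<rho>cr * vmax"
proof -
  have "In t \<le> \<rho>cr * v t" using In_bounds(2)[of t t] v_pos[of t] by (simp add: divide_le_eq)
  also have "\<dots> \<le> \<rho>cr * vmax" using v_bounds(2)[of t] rcr_pos by (intro mult_left_mono) auto
  finally show ?thesis using In_bounds(1)[of t] by simp
qed

lemma rho0_integrable: "set_integrable lborel {a..b} \<rho>0"
  by (rule set_integrable_Icc_bounded[OF rho0_measurable abs_rho0_le])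

lemma In_integrable: "set_integrable lborel {a..b} In"
  by (rule set_integrable_Icc_bounded[OF In_measurable abs_In_le])

text \<open>The falling branch of the flux meets the line r v only at \<open>\<rho>cr\<close> and
  stays off it afterwards. The condition at x = L thus says that the trace is not congested.\<close>

lemma flux_eq_linear_iff: "f r (v t) = r * v t \<longleftrightarrow> r \<le> \<rho>cr"
proof (cases "r \<le> \<rho>cr")
  case False
  have "f r (v t) \<noteq> r * v t"
  proof
    assume "f r (v t) = r * v t"
    then have "v t * (\<rho>cr * (\<rho>max - r)) = v t * (r * (\<rho>max - \<rho>cr))"
      using False rcr_less by (simp add: newell_daganzo_flux_def field_simps)
    then have "\<rho>cr * (\<rho>max - r) = r * (\<rho>max - \<rho>cr)" using v_pos[of t] by simp
    then have "\<rho>max * (r - \<rho>cr) = 0" by (auto simp: algebra_simps)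
    then show False using False rmax_pos by auto
  qed
  with False show ?thesis by simp
qed (simp add: newell_daganzo_flux_def)

text \<open>The cumulative outflow is determined by conservation of mass: up to time \<open>t\<close> the initial mass
  to the right of \<open>L - V t\<close> and the mass that entered before time \<open>\<tau>(t)\<close> have left.\<close>

definition departed :: "real \<Rightarrow> real" where
  "departed t = (LINT x:{0..L}|lborel. \<rho>0 x * indicator {0<..} (V t - L + x)) +
     (LINT s:{0..T}|lborel. In s * indicator {0<..} (V t - L - V s))"

lemma integrable_test:
  assumes "test_function L T \<phi> \<phi>t \<phi>x" and [measurable]: "g \<in> borel_measurable borel"
    and "\<And>z. z \<in> R \<Longrightarrow> \<bar>g z\<bar> \<le> C"
  shows "set_integrable lborel R (\<lambda>z. g z * \<phi>t z)" "set_integrable lborel R (\<lambda>z. g z * \<phi>x z)"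
proof -
  have C1: "C1_fun \<phi> \<phi>t \<phi>x" using assms(1) by (simp add: test_function_iff)
  note [measurable] = C1_fun_measurable[OF C1]
  obtain M where M: "\<And>z. z \<in> R \<Longrightarrow> \<bar>\<phi> z\<bar> \<le> M \<and> \<bar>\<phi>t z\<bar> \<le> M \<and> \<bar>\<phi>x z\<bar> \<le> M" "0 \<le> M"
    using C1_fun_bounded_rect[OF C1] by metis
  have "\<bar>g z * \<phi>t z\<bar> \<le> C * M" "\<bar>g z * \<phi>x z\<bar> \<le> C * M" if "z \<in> R" for z
    unfolding abs_mult using M(1)[OF that] assms(3)[OF that] by (intro mult_mono; auto)+
  then show "set_integrable lborel R (\<lambda>z. g z * \<phi>t z)" "set_integrable lborel R (\<lambda>z. g z * \<phi>x z)"
    by (intro set_integrable_bounded[OF R_finite, where B="C * M"]; simp)+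
qed

section \<open>An arbitrary entropy solution and its right trace\<close>

context
  fixes \<rho> :: "real \<Rightarrow> real \<Rightarrow> real" and r :: "real \<Rightarrow> real"
  assumes sol: "entropy_solution L T \<rho>cr \<rho>max \<rho>0 In v \<rho>"
    and r_trace: "right_trace L T \<rho> r"
    and r_flux: "AE t in lborel. t \<in> {0..T} \<longrightarrow> f (r t) (v t) = r t * v t"
begin

text \<open>Measurability and bounds of \<open>\<rho>\<close> are given on the rectangle only; the
  extension by zero has them everywhere.\<close>

definition u :: "real \<times> real \<Rightarrow> real" where "u z = indicator R z * \<rho> (fst z) (snd z)"

lemma u_eq: "z \<in> R \<Longrightarrow> u z = \<rho> (fst z) (snd z)"
  by (simp add: u_def)

lemma u_measurable [measurable]: "u \<in> borel_measurable borel"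
  using sol unfolding entropy_solution_def set_borel_measurable_def u_def[abs_def]
  by (simp add: case_prod_beta')

lemma u_bounds: "0 \<le> u z" "u z \<le> \<rho>max"
  using sol rmax_pos by (auto simp: u_def indicator_def entropy_solution_def)

lemma abs_u_le: "\<bar>u z\<bar> \<le> \<rho>max"
  using u_bounds[of z] by simp

lemma u_traces:
  "initial_trace L T (\<lambda>t x. u (t, x)) \<rho>0"
  "left_trace L T (\<lambda>t x. u (t, x)) (\<lambda>t. In t / v t)"
  "right_trace L T (\<lambda>t x. u (t, x)) r"
proof -
  have "initial_trace L T \<rho> \<rho>0 \<longleftrightarrow> initial_trace L T (\<lambda>t x. u (t, x)) \<rho>0"
    by (rule L1_trace_cong) (auto simp: u_def)
  then show "initial_trace L T (\<lambda>t x. u (t, x)) \<rho>0" using sol by (simp add: entropy_solution_def)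
  have *: "L1_trace (\<lambda>x t. \<rho> t x) s {0<..<L} {0..T} g \<longleftrightarrow> L1_trace (\<lambda>x t. u (t, x)) s {0<..<L} {0..T} g" for s g
    by (rule L1_trace_cong) (auto simp: u_def)
  show "left_trace L T (\<lambda>t x. u (t, x)) (\<lambda>t. In t / v t)" using sol *[of 0] by (simp add: entropy_solution_def)
  show "right_trace L T (\<lambda>t x. u (t, x)) r" using r_trace *[of L] by simp
qed

lemma flux_measurable [measurable]: "(\<lambda>z. f (u z) (v (fst z))) \<in> borel_measurable borel"
  unfolding newell_daganzo_flux_def by measurable

lemma flux_bounds: "\<bar>f (u z) (v t)\<bar> \<le> vmax * \<rho>max"
proof (cases "u z \<le> \<rho>cr")
  case True
  have "u z * v t \<le> \<rho>max * vmax" using u_bounds[of z] v_bounds[of t] v_pos[of t] rmax_pos by (intro mult_mono) auto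
  then show ?thesis using True u_bounds[of z] v_pos[of t] by (simp add: newell_daganzo_flux_def abs_mult mult.commute)
next
  case False
  then have "\<rho>cr * (\<rho>max - u z) \<le> \<rho>max * (\<rho>max - \<rho>cr)"
    using u_bounds[of z] rcr_pos rcr_less by (intro mult_mono) auto
  then have "v t * (\<rho>cr * (\<rho>max - u z) / (\<rho>max - \<rho>cr)) \<le> vmax * \<rho>max"
    using u_bounds[of z] rcr_pos rcr_less rmax_pos v_pos[of t] v_bounds[of t] vmax_pos
    by (intro mult_mono) (auto simp: divide_le_eq)
  moreover have "0 \<le> v t * (\<rho>cr * (\<rho>max - u z) / (\<rho>max - \<rho>cr))"
    using u_bounds[of z] rcr_pos rcr_less v_pos[of t] by simp
  moreover have "f (u z) (v t) = v t * (\<rho>cr * (\<rho>max - u z) / (\<rho>max - \<rho>cr))"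
    using False by (simp add: newell_daganzo_flux_def)
  ultimately show ?thesis by (metis abs_of_nonneg)
qed

definition entropy_integrand ::
  "real \<Rightarrow> (real \<times> real \<Rightarrow> real) \<Rightarrow> (real \<times> real \<Rightarrow> real) \<Rightarrow> real \<times> real \<Rightarrow> real" where
  "entropy_integrand k \<phi>t \<phi>x z =
     \<bar>u z - k\<bar> * \<phi>t z + sgn (u z - k) * (f (u z) (v (fst z)) - f k (v (fst z))) * \<phi>x z"

lemma kruzhkov_u:
  assumes "k \<in> {0..\<rho>max}" "test_function L T \<phi> \<phi>t \<phi>x"
  shows "0 \<le> (LINT z:R|lborel. entropy_integrand k \<phi>t \<phi>x z)"
proof -
  have "0 \<le> (LINT (t, x) : R | lborel. \<bar>\<rho> t x - k\<bar> * \<phi>t (t, x)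
               + sgn (\<rho> t x - k) * (f (\<rho> t x) (v t) - f k (v t)) * \<phi>x (t, x))"
    using sol assms unfolding entropy_solution_def kruzhkov_inequalities_def by blast
  also have "\<dots> = (LINT z:R|lborel. entropy_integrand k \<phi>t \<phi>x z)"
    by (rule set_lebesgue_integral_cong) (auto simp: entropy_integrand_def u_eq R_finite)
  finally show ?thesis .
qed

text \<open>The constants \<open>k = 0\<close> and \<open>k = \<rho>max\<close> bound the solution from below and above, so that the two
  entropy inequalities combine to the weak equation.\<close>

lemma weak_equation:
  assumes tf: "test_function L T \<phi> \<phi>t \<phi>x"
  shows "(LINT z:R|lborel. u z * \<phi>t z + f (u z) (v (fst z)) * \<phi>x z) = 0"
proof -
  note iu = integrable_test(1)[OF tf u_measurable abs_u_le] and iF = integrable_test(2)[OF tf flux_measurable flux_bounds]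
  \<comment> \<open>The flux vanishes at both constants. Hence the sign may be taken as 1 (for k =
    0) or -1 (for k = \<open>\<rho>max\<close>) even at points where it is 0.\<close>
  have f0: "f 0 w = 0" "f \<rho>max w = 0" for w using rcr_pos rcr_less by (auto simp: newell_daganzo_flux_def)
  have "0 \<le> (LINT z:R|lborel. entropy_integrand 0 \<phi>t \<phi>x z)"
    using rmax_pos by (intro kruzhkov_u[OF _ tf]) auto
  also have "\<dots> = (LINT z:R|lborel. u z * \<phi>t z + f (u z) (v (fst z)) * \<phi>x z)"
  proof (rule set_lebesgue_integral_cong)
    show "\<forall>z. z \<in> R \<longrightarrow> entropy_integrand 0 \<phi>t \<phi>x z
        = u z * \<phi>t z + f (u z) (v (fst z)) * \<phi>x z"
      using u_bounds(1) by (auto simp: entropy_integrand_def sgn_if f0 less_le)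
  qed (simp add: R_finite)
  finally have 1: "0 \<le> (LINT z:R|lborel. u z * \<phi>t z + f (u z) (v (fst z)) * \<phi>x z)" .
  have "0 \<le> (LINT z:R|lborel. entropy_integrand \<rho>max \<phi>t \<phi>x z)"
    using rmax_pos by (intro kruzhkov_u[OF _ tf]) auto
  also have "\<dots> = (LINT z:R|lborel. \<rho>max * \<phi>t z - (u z * \<phi>t z + f (u z) (v (fst z)) * \<phi>x z))"
  proof (rule set_lebesgue_integral_cong)
    show "\<forall>z. z \<in> R \<longrightarrow> entropy_integrand \<rho>max \<phi>t \<phi>x z
        = \<rho>max * \<phi>t z - (u z * \<phi>t z + f (u z) (v (fst z)) * \<phi>x z)" (is "\<forall>z. z \<in> R \<longrightarrow> ?P z")
    proof (intro allI impI)
      fix z show "?P z"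
        using u_bounds(2)[of z] by (cases "u z = \<rho>max") (auto simp: entropy_integrand_def f0 abs_if algebra_simps)
    qed
  qed (simp add: R_finite)
  also have "\<dots> = (LINT z:R|lborel. \<rho>max * \<phi>t z) - (LINT z:R|lborel. u z * \<phi>t z + f (u z) (v (fst z)) * \<phi>x z)"
    using integrable_test(1)[OF tf, of "\<lambda>_. \<rho>max" "\<rho>max"] rmax_pos iu iF
    by (intro set_integral_diff set_integral_add) auto
  also have "(LINT z:R|lborel. \<rho>max * \<phi>t z) = 0"
    using test_function_integrals(1)[OF tf T_pos L_pos v_measurable abs_v_le] by simp
  finally show ?thesis using 1 by linarith
qed

text \<open>Congestion \<open>(u - \<rho>cr)\<^sup>+\<close> travels to the left with speed \<open>c v\<close>; none is present initially and
  none enters at \<open>x = L\<close>.\<close>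

lemma free_flow: "AE z in lborel. z \<in> R \<longrightarrow> u z \<le> \<rho>cr"
proof -
  define c where "c = \<rho>cr / (\<rho>max - \<rho>cr)"
  have c: "0 < c" using rcr_pos rcr_less by (simp add: c_def)
  define e where "e z = max 0 (u z - \<rho>cr)" for z
  define q where "q z = - (c * v (fst z) * e z)" for z
  have em [measurable]: "e \<in> borel_measurable borel" unfolding e_def by measurable
  have qm [measurable]: "q \<in> borel_measurable borel" unfolding q_def by measurable
  have z: "set_integrable lborel I (\<lambda>_. 0 :: real)" for I by (simp add: set_integrable_def)
  have eb: "0 \<le> e z" "e z \<le> \<rho>max" "\<bar>e z\<bar> \<le> \<rho>max" for z
    using u_bounds[of z] rcr_pos rmax_pos by (auto simp: e_def)
  have qb: "\<bar>q z\<bar> \<le> c * vmax * \<rho>max" for z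
    unfolding q_def abs_minus_cancel abs_mult using c abs_v_le[of "fst z"] eb(3)[of z] vmax_pos
    by (intro mult_mono) auto
  define B where "B = max \<rho>max (c * vmax * \<rho>max)"
  have weak: "0 \<le> (LINT z:R|lborel. e z * \<phi>t z + q z * \<phi>x z)" if tf: "test_function L T \<phi> \<phi>t \<phi>x" for \<phi> \<phi>t \<phi>x
  proof -
    have "0 \<le> (LINT z:R|lborel. entropy_integrand \<rho>cr \<phi>t \<phi>x z)"
      using rcr_pos rcr_less by (intro kruzhkov_u[OF _ tf]) auto
    \<comment> \<open>On both branches |u - \<open>\<rho>cr\<close>| = 2 e - (u -
      \<open>\<rho>cr\<close>), and the entropy flux is 2 q - f(u) + \<open>\<rho>cr\<close> v. The
      weak equation and the integrals of the constant terms are zero, which leaves the inequality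
      for e and q.\<close>
    also have "\<dots> = (LINT z:R|lborel. 2 * (e z * \<phi>t z + q z * \<phi>x z) -
        (u z * \<phi>t z + f (u z) (v (fst z)) * \<phi>x z) + (\<rho>cr * \<phi>t z + \<rho>cr * (v (fst z) * \<phi>x z)))"
    proof (rule set_lebesgue_integral_cong)
      show "\<forall>z. z \<in> R \<longrightarrow> entropy_integrand \<rho>cr \<phi>t \<phi>x z
        = 2 * (e z * \<phi>t z + q z * \<phi>x z) - (u z * \<phi>t z + f (u z) (v (fst z)) * \<phi>x z) + (\<rho>cr * \<phi>t z + \<rho>cr * (v (fst z) * \<phi>x z))" (is "\<forall>z. z \<in> R \<longrightarrow> ?P z")
      proof (intro allI impI)
        fix z
        have fl: "f (u z) (v (fst z)) = \<rho>cr * v (fst z) - c * v (fst z) * (u z - \<rho>cr)" if "u z > \<rho>cr"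
        proof -
          have "c * (\<rho>max - \<rho>cr) = \<rho>cr" using rcr_less by (simp add: c_def)
          moreover have "f (u z) (v (fst z)) = c * v (fst z) * (\<rho>max - u z)"
            using that by (simp add: newell_daganzo_flux_def c_def)
          moreover have "c * w * (\<rho>max - y) = (c * (\<rho>max - \<rho>cr)) * w - c * w * (y - \<rho>cr)" for w y
            by (simp add: algebra_simps)
          ultimately show ?thesis by simp
        qed
        have fc: "f \<rho>cr (v (fst z)) = \<rho>cr * v (fst z)" by (simp add: newell_daganzo_flux_def)
        consider "u z < \<rho>cr" | "u z = \<rho>cr" | "u z > \<rho>cr" by linarith
        then show "?P z"
        proof cases
          case 3 then show ?thesis by (simp add: entropy_integrand_def fl fc e_def q_def algebra_simps)
        qed (simp_all add: entropy_integrand_def fc e_def q_def algebra_simps)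
      qed
    qed (simp add: R_finite)
    also have "\<dots> = 2 * (LINT z:R|lborel. e z * \<phi>t z + q z * \<phi>x z)
       - (LINT z:R|lborel. u z * \<phi>t z + f (u z) (v (fst z)) * \<phi>x z)
       + (\<rho>cr * (LINT z:R|lborel. \<phi>t z) + \<rho>cr * (LINT z:R|lborel. v (fst z) * \<phi>x z))"
    proof -
      have i: "set_integrable lborel R (\<lambda>z. e z * \<phi>t z)" "set_integrable lborel R (\<lambda>z. q z * \<phi>x z)"
        "set_integrable lborel R (\<lambda>z. u z * \<phi>t z)" "set_integrable lborel R (\<lambda>z. f (u z) (v (fst z)) * \<phi>x z)"
        "set_integrable lborel R (\<lambda>z. v (fst z) * \<phi>x z)" "set_integrable lborel R (\<lambda>z. \<phi>t z)"
        using integrable_test(1)[OF tf, of "\<lambda>_. 1" 1]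
        by (auto intro!: integrable_test[OF tf] eb qb abs_u_le flux_bounds abs_v_le)
      show ?thesis using i by (simp add: set_integral_add set_integral_diff)
    qed
    also have "\<dots> = 2 * (LINT z:R|lborel. e z * \<phi>t z + q z * \<phi>x z)"
      using test_function_integrals[OF tf T_pos L_pos v_measurable abs_v_le] weak_equation[OF tf] by simp
    finally show ?thesis by simp
  qed
  \<comment> \<open>Where a trace value is at most \<open>\<rho>cr\<close>, the congestion is
    bounded by the distance of u from that value. It therefore has trace zero at t = 0, x = 0 and x
    = L, the last by the outflow condition.\<close>
  have tr_u0: "initial_trace L T (\<lambda>t x. e (t, x)) (\<lambda>_. 0)"
  proof (rule L1_trace_dominated[OF u_traces(1), where C=1])
    show "AE x in lborel. x \<in> {0..L} \<longrightarrow> \<bar>e (s, x) - 0\<bar> \<le> 1 * \<bar>u (s, x) - \<rho>0 x\<bar>" for s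
    proof (intro AE_I2 impI)
      fix x
      show "\<bar>e (s, x) - 0\<bar> \<le> 1 * \<bar>u (s, x) - \<rho>0 x\<bar>" using rho0_bounds(2)[of x] by (auto simp: e_def)
    qed
  qed (rule slices_integrable[OF u_measurable abs_u_le] slices_integrable[OF em eb(3)] z)+
  have tr_q0: "left_trace L T (\<lambda>t x. q (t, x)) (\<lambda>_. 0)"
  proof (rule L1_trace_dominated[OF u_traces(2), where C="c * vmax"])
    show "AE t in lborel. t \<in> {0..T} \<longrightarrow> \<bar>q (t, s) - 0\<bar> \<le> c * vmax * \<bar>u (t, s) - In t / v t\<bar>" for s
    proof (intro AE_I2 impI)
      fix t
      have "e (t, s) \<le> \<bar>u (t, s) - In t / v t\<bar>" using In_bounds(2)[of t t] by (auto simp: e_def)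
      then have "c * v t * e (t, s) \<le> c * vmax * \<bar>u (t, s) - In t / v t\<bar>"
        using c v_bounds(2)[of t] v_pos[of t] eb(1) vmax_pos by (intro mult_mono) auto
      then show "\<bar>q (t, s) - 0\<bar> \<le> c * vmax * \<bar>u (t, s) - In t / v t\<bar>"
        using c v_pos[of t] eb(1)[of "(t, s)"] by (simp add: q_def abs_mult)
    qed
  qed (rule slices_integrable[OF u_measurable abs_u_le] slices_integrable[OF qm qb] z)+
  have tr_qL: "right_trace L T (\<lambda>t x. q (t, x)) (\<lambda>_. 0)"
  proof (rule L1_trace_dominated[OF u_traces(3), where C="c * vmax"])
    show "AE t in lborel. t \<in> {0..T} \<longrightarrow> \<bar>q (t, s) - 0\<bar> \<le> c * vmax * \<bar>u (t, s) - r t\<bar>" for s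
      using r_flux
    proof eventually_elim
      case (elim t)
      show ?case
      proof
        assume "t \<in> {0..T}"
        with elim have "r t \<le> \<rho>cr" by (simp add: flux_eq_linear_iff)
        then have "e (t, s) \<le> \<bar>u (t, s) - r t\<bar>" by (auto simp: e_def)
        then have "c * v t * e (t, s) \<le> c * vmax * \<bar>u (t, s) - r t\<bar>"
          using c v_bounds(2)[of t] v_pos[of t] eb(1) vmax_pos by (intro mult_mono) auto
        then show "\<bar>q (t, s) - 0\<bar> \<le> c * vmax * \<bar>u (t, s) - r t\<bar>"
          using c v_pos[of t] eb(1)[of "(t, s)"] by (simp add: q_def abs_mult)
      qed
    qed
  qed (rule slices_integrable[OF u_measurable abs_u_le] slices_integrable[OF qm qb] z)+
  have "AE z in lborel. z \<in> R \<longrightarrow> e z * max 0 (T' - fst z) = 0" if T': "T' < T" for T'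
  proof -
    \<comment> \<open>The weight depends on time only, so the flux drops out, and it decreases in
      time. With zero boundary terms, Green's inequality bounds a nonnegative integral of the
      congestion by 0.\<close>
    have C1: "C1_fun (\<lambda>z. pos_sq (T' - fst z)) (\<lambda>z. 2 * max 0 (T' - fst z) * (0 - 1)) (\<lambda>z. 2 * max 0 (T' - fst z) * (0 - 0))"
    proof (rule C1_fun_compose[OF C1_fun_diff[OF _ C1_fun_coords(1)] pos_sq_deriv])
      show "C1_fun (\<lambda>z. T') (\<lambda>z. 0) (\<lambda>z. 0)" by (auto simp: C1_fun_def)
      show "continuous_on UNIV (\<lambda>y::real. 2 * max 0 y)" by (intro continuous_intros)
    qed
    have "0 \<le> (LINT z:R|lborel. e z * (2 * max 0 (T' - fst z) * (0 - 1)) + q z * (2 * max 0 (T' - fst z) * (0 - 0)))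
      + (LINT x:{0..L}|lborel. 0 * pos_sq (T' - fst (0, x))) + (LINT t:{0..T}|lborel. 0 * pos_sq (T' - fst (t, 0::real)))
      - (LINT t:{0..T}|lborel. 0 * pos_sq (T' - fst (t, L)))"
      by (rule green_inequality[OF L_pos T_pos _ _ _ _ tr_u0 tr_q0 tr_qL weak C1 _ T', where B=B])
        (auto simp: B_def pos_sq_def intro: order_trans[OF qb] order_trans[OF eb(3)])
    moreover have "(LINT z:R|lborel. e z * (2 * max 0 (T' - fst z) * (0 - 1)) + q z * (2 * max 0 (T' - fst z) * (0 - 0)))
        = - 2 * (LINT z:R|lborel. e z * max 0 (T' - fst z))"
      unfolding set_integral_mult_right[symmetric]
      by (rule set_lebesgue_integral_cong) (simp_all add: R_finite)
    moreover have z0: "(LINT x:I|lborel. 0 * g x) = 0" for I and g :: "real \<Rightarrow> real"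
      by (simp add: set_lebesgue_integral_def)
    ultimately have le: "(LINT z:R|lborel. e z * max 0 (T' - fst z)) \<le> 0"
      unfolding z0 by linarith
    have int: "set_integrable lborel R (\<lambda>z. e z * max 0 (T' - fst z))"
    proof (rule set_integrable_bounded[OF R_finite])
      show "\<bar>e z * max 0 (T' - fst z)\<bar> \<le> \<rho>max * T" if "z \<in> R" for z
        unfolding abs_mult using that T' T_pos eb(3)[of z] by (intro mult_mono) auto
    qed measurable
    show ?thesis by (rule AE_zero_if_set_integral_le_zero[OF int le]) (simp add: eb)
  qed
  \<comment> \<open>Countably many values of \<open>T'\<close>, tending to T, exhaust the rectangle
    up to the null set t = T.\<close>
  then have "AE z in lborel. \<forall>n. z \<in> R \<longrightarrow> e z * max 0 (T - 1 / real (Suc n) - fst z) = 0"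
    unfolding AE_all_countable by simp
  moreover have "AE z in lborel. fst (z :: real \<times> real) \<noteq> T" by (intro AE_lborel_projections(1) AE_lborel_singleton)
  ultimately show ?thesis
  proof eventually_elim
    case (elim z)
    show ?case
    proof
      assume z: "z \<in> R"
      with elim have "0 < T - fst z" by auto
      then obtain n where "1 / real (Suc n) < T - fst z" using nat_approx_posE by blast
      moreover have "e z * max 0 (T - 1 / real (Suc n) - fst z) = 0" using elim z by blast
      ultimately have "e z = 0" by auto
      then show "u z \<le> \<rho>cr" by (simp add: e_def max_def split: if_splits)
    qed
  qed
qed

lemma transport_equation:
  assumes tf: "test_function L T \<phi> \<phi>t \<phi>x"
  shows "(LINT z:R|lborel. u z * \<phi>t z + v (fst z) * u z * \<phi>x z) = 0"
proof -
  have C1: "C1_fun \<phi> \<phi>t \<phi>x" using tf by (simp add: test_function_iff)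
  note [measurable] = C1_fun_measurable[OF C1]
  have "(LINT z:R|lborel. u z * \<phi>t z + v (fst z) * u z * \<phi>x z) = (LINT z:R|lborel. u z * \<phi>t z + f (u z) (v (fst z)) * \<phi>x z)"
  proof (rule set_lebesgue_integral_cong_AE)
    show "AE z \<in> R in lborel. u z * \<phi>t z + v (fst z) * u z * \<phi>x z = u z * \<phi>t z + f (u z) (v (fst z)) * \<phi>x z"
      using free_flow by eventually_elim (auto simp: newell_daganzo_flux_def)
  qed (use R_finite in measurable)
  with weak_equation[OF tf] show ?thesis by simp
qed

lemma r_integrable: "set_integrable lborel {0..T} r"
  using r_trace by (simp add: L1_trace_def)

lemma rv_integrable: "set_integrable lborel {0..T} (\<lambda>t. r t * v t)"
  by (rule set_integrable_mult_bounded[OF r_integrable v_measurable abs_v_le])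

text \<open>The transport equation is an equality, so Green's inequality applies to the solution and
  to its negative. On the left side the flux has the trace v (In / v) = In.\<close>

lemma balance:
  assumes \<Phi>: "C1_fun \<Phi> \<Phi>t \<Phi>x" "\<And>z. 0 \<le> \<Phi> z" "T' < T" "\<And>t x. T' \<le> t \<Longrightarrow> x \<in> {0..L} \<Longrightarrow> \<Phi> (t, x) = 0"
  shows "(LINT z:R|lborel. u z * (\<Phi>t z + v (fst z) * \<Phi>x z)) + (LINT x:{0..L}|lborel. \<rho>0 x * \<Phi> (0, x))
     + (LINT t:{0..T}|lborel. In t * \<Phi> (t, 0)) = (LINT t:{0..T}|lborel. r t * v t * \<Phi> (t, L))"
proof -
  have uv: "\<bar>v (fst z) * u z\<bar> \<le> vmax * \<rho>max" for z
    unfolding abs_mult using abs_v_le abs_u_le vmax_pos by (intro mult_mono) auto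
  define B where "B = max \<rho>max (vmax * \<rho>max)"
  have tr: "L1_trace (\<lambda>x t. s * (v t * u (t, x))) x0 {0<..<L} {0..T} (\<lambda>t. s * (v t * g t))"
    if g: "L1_trace (\<lambda>x t. u (t, x)) x0 {0<..<L} {0..T} g" and s: "\<bar>s\<bar> = 1" for s x0 g
  proof (rule L1_trace_dominated[OF g, where C=vmax])
    show "AE t in lborel. t \<in> {0..T} \<longrightarrow> \<bar>s * (v t * u (t, x)) - s * (v t * g t)\<bar> \<le> vmax * \<bar>u (t, x) - g t\<bar>" for x
      using s abs_v_le by (auto simp: abs_mult mult_right_mono simp flip: right_diff_distrib)
    have "set_integrable lborel {0..T} g" using g by (simp add: L1_trace_def)
    from set_integrable_mult_bounded[OF this v_measurable abs_v_le]
    show "set_integrable lborel {0..T} (\<lambda>t. s * (v t * g t))" by (simp add: mult.commute)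
    have "\<bar>s * (v (fst z) * u z)\<bar> \<le> vmax * \<rho>max" for z using uv[of z] s by (simp add: abs_mult)
    from slices_integrable(2)[where g="\<lambda>z. s * (v (fst z) * u z)", OF _ this]
    show "set_integrable lborel {0..T} (\<lambda>t. s * (v t * u (t, x)))" for x by simp
    show "set_integrable lborel {0..T} (\<lambda>t. u (t, x))" for x
      by (rule slices_integrable[OF u_measurable abs_u_le])
  qed
  have tri: "initial_trace L T (\<lambda>t x. s * u (t, x)) (\<lambda>x. s * \<rho>0 x)" if s: "\<bar>s\<bar> = 1" for s
  proof (rule L1_trace_dominated[OF u_traces(1), where C=1])
    show "AE x in lborel. x \<in> {0..L} \<longrightarrow> \<bar>s * u (t, x) - s * \<rho>0 x\<bar> \<le> 1 * \<bar>u (t, x) - \<rho>0 x\<bar>" for t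
      using s by (auto simp: abs_mult simp flip: right_diff_distrib)
    show "set_integrable lborel {0..L} (\<lambda>x. u (t, x))" "set_integrable lborel {0..L} (\<lambda>x. s * u (t, x))" for t
      using slices_integrable(1)[OF u_measurable abs_u_le, of 0 L t] by simp_all
    show "set_integrable lborel {0..L} (\<lambda>x. s * \<rho>0 x)"
      using rho0_integrable[of 0 L] by simp
  qed
  have main: "0 \<le> s * ((LINT z:R|lborel. u z * (\<Phi>t z + v (fst z) * \<Phi>x z)) + (LINT x:{0..L}|lborel. \<rho>0 x * \<Phi> (0, x))
      + (LINT t:{0..T}|lborel. In t * \<Phi> (t, 0)) - (LINT t:{0..T}|lborel. r t * v t * \<Phi> (t, L)))"
    if s: "\<bar>s\<bar> = 1" for s
  proof -
    have "0 \<le> (LINT z:R|lborel. (s * u z) * \<Phi>t z + (s * (v (fst z) * u z)) * \<Phi>x z)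
      + (LINT x:{0..L}|lborel. (s * \<rho>0 x) * \<Phi> (0, x)) + (LINT t:{0..T}|lborel. (s * (v t * (In t / v t))) * \<Phi> (t, 0))
      - (LINT t:{0..T}|lborel. (s * (v t * r t)) * \<Phi> (t, L))"
    proof (rule green_inequality[OF L_pos T_pos _ _ _ _ _ _ _ _ \<Phi>, where B=B])
      show "\<bar>s * u z\<bar> \<le> B" "\<bar>s * (v (fst z) * u z)\<bar> \<le> B" for z
        using s abs_u_le[of z] uv[of z] by (auto simp: B_def abs_mult)
      show "initial_trace L T (\<lambda>t x. s * u (t, x)) (\<lambda>x. s * \<rho>0 x)" by (rule tri[OF s])
      show "left_trace L T (\<lambda>t x. s * (v (fst (t, x)) * u (t, x))) (\<lambda>t. s * (v t * (In t / v t)))"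
        using tr[OF u_traces(2) s] by simp
      show "right_trace L T (\<lambda>t x. s * (v (fst (t, x)) * u (t, x))) (\<lambda>t. s * (v t * r t))"
        using tr[OF u_traces(3) s] by simp
      show "0 \<le> (LINT z:R|lborel. s * u z * \<phi>t z + s * (v (fst z) * u z) * \<phi>x z)"
        if "test_function L T \<phi> \<phi>t \<phi>x" for \<phi> \<phi>t \<phi>x
      proof -
        have "(LINT z:R|lborel. s * u z * \<phi>t z + s * (v (fst z) * u z) * \<phi>x z) =
            (LINT z:R|lborel. s * (u z * \<phi>t z + v (fst z) * u z * \<phi>x z))" by (simp add: algebra_simps)
        also have "\<dots> = 0" using transport_equation[OF that] by simp
        finally show ?thesis by simp
      qed
    qed measurable
    moreover have 1: "(LINT z:R|lborel. (s * u z) * \<Phi>t z + (s * (v (fst z) * u z)) * \<Phi>x z) = s * (LINT z:R|lborel. u z * (\<Phi>t z + v (fst z) * \<Phi>x z))"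
      by (simp add: algebra_simps flip: set_integral_mult_right)
    moreover have 2: "(LINT x:{0..L}|lborel. (s * \<rho>0 x) * \<Phi> (0, x)) = s * (LINT x:{0..L}|lborel. \<rho>0 x * \<Phi> (0, x))"
      by (simp add: mult.assoc)
    moreover have 3: "(LINT t:{0..T}|lborel. (s * (v t * (In t / v t))) * \<Phi> (t, 0)) = s * (LINT t:{0..T}|lborel. In t * \<Phi> (t, 0))"
      using v_pos[THEN less_imp_neq] by (simp add: mult.assoc)
    moreover have 4: "(LINT t:{0..T}|lborel. (s * (v t * r t)) * \<Phi> (t, L)) = s * (LINT t:{0..T}|lborel. r t * v t * \<Phi> (t, L))"
      by (simp add: mult_ac flip: set_integral_mult_right)
    ultimately show ?thesis unfolding 1 2 3 4 by (simp only: right_diff_distrib distrib_left)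
  qed
  from main[of 1] main[of "-1"] show ?thesis by simp
qed

text \<open>The limiting test function depends on \<open>V t - x\<close> only and is constant along
  characteristics. Its interior integral therefore disappears and only boundary terms
  survive.\<close>

lemma balance_cutoff:
  assumes ts: "ts \<le> T"
  shows "(LINT x:{0..L}|lborel. \<rho>0 x * cutoff m (V ts - L + x)) + (LINT t:{0..T}|lborel. In t * cutoff m (V ts - L - V t))
     = (LINT t:{0..T}|lborel. r t * v t * cutoff m (V ts - V t))"
proof -
  \<comment> \<open>With \<open>V\<close> in place of \<open>V_avg n\<close>, this is positive
    exactly if the characteristic through (t,x) reaches x = L before time \<open>ts\<close>.\<close>
  define k where "k n z = V ts - L - (V_avg n (fst z) - snd z)" for n and z :: "real \<times> real"
  define H where "H n z = u z * (cutoff' m (k n z) * (v (fst z) - V_avg' n (fst z)))" for n z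
  have [measurable]: "k n \<in> borel_measurable borel" for n unfolding k_def by measurable
  have [measurable]: "H n \<in> borel_measurable borel" for n unfolding H_def by measurable
  have C1: "C1_fun (\<lambda>z. cutoff m (k n z)) (\<lambda>z. cutoff' m (k n z) * (0 - (V_avg' n (fst z) - 0)))
      (\<lambda>z. cutoff' m (k n z) * (0 - (0 - 1)))" for n
    unfolding k_def
  proof (intro C1_fun_compose[OF _ cutoff_deriv continuous_cutoff'] C1_fun_diff C1_fun_V_avg C1_fun_coords)
    show "C1_fun (\<lambda>z. V ts - L) (\<lambda>z. 0) (\<lambda>z. 0)" by (auto simp: C1_fun_def)
  qed
  \<comment> \<open>From \<open>T'\<close> on, \<open>V\<close> can grow by at most 1/(m+1) up to
    \<open>ts\<close>, and \<open>cutoff m\<close> vanishes up to that value.\<close>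
  define T' where "T' = T - 1 / (vmax * real (Suc m))"
  have T': "T' < T" using vmax_pos by (simp add: T'_def)
  have van: "cutoff m (k n (t, x)) = 0" if t: "T' \<le> t" and x: "x \<in> {0..L}" for n t x
  proof (rule cutoff_zero)
    have "V ts - V t \<le> 1 / real (Suc m)"
    proof (cases "t \<le> ts")
      case True
      have "V ts - V t \<le> vmax * (ts - t)" by (rule V_bounds(2)[OF True])
      also have "\<dots> \<le> vmax * (1 / (vmax * real (Suc m)))"
        using t ts vmax_pos by (intro mult_left_mono) (auto simp: T'_def)
      finally show ?thesis using vmax_pos by simp
    next
      case False
      then have "V ts \<le> V t" by (simp add: V_le_iff)
      moreover have "0 \<le> 1 / real (Suc m)" by simp
      ultimately show ?thesis by linarith
    qed
    \<comment> \<open>Here it matters that the averages lie above \<open>V\<close>: together with x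
      at most L this gives k at most \<open>V ts - V t\<close>, for every n.\<close>
    then show "k n (t, x) \<le> 1 / real (Suc m)" using V_avg_bounds(1)[of t n] x by (simp add: k_def)
  qed
  have eq: "(LINT z:R|lborel. H n z) + (LINT x:{0..L}|lborel. \<rho>0 x * cutoff m (k n (0, x)))
     + (LINT t:{0..T}|lborel. In t * cutoff m (k n (t, 0))) = (LINT t:{0..T}|lborel. r t * v t * cutoff m (k n (t, L)))" for n
  proof -
    have "(LINT z:R|lborel. H n z) = (LINT z:R|lborel. u z * (cutoff' m (k n z) * (0 - (V_avg' n (fst z) - 0)) +
        v (fst z) * (cutoff' m (k n z) * (0 - (0 - 1)))))"
      by (simp add: H_def algebra_simps)
    with balance[OF C1[of n] cutoff_bounds(1) T' van] show ?thesis by simp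
  qed
  have klim: "(\<lambda>n. cutoff m (k n (t, x))) \<longlonglongrightarrow> cutoff m (V ts - L - (V t - x))" for t x
  proof (rule isCont_tendsto_compose[of _ "cutoff m"])
    show "(\<lambda>n. k n (t, x)) \<longlonglongrightarrow> V ts - L - (V t - x)" unfolding k_def fst_conv snd_conv by (intro tendsto_intros V_avg_tendsto)
    show "isCont (cutoff m) (V ts - L - (V t - x))"
      using continuous_cutoff[of m] by (simp add: continuous_on_eq_continuous_at)
  qed
  have cb: "\<bar>cutoff m y\<bar> \<le> 1" for y using cutoff_bounds[of m y] by simp
  obtain M where M: "\<And>t. \<bar>cutoff' m t\<bar> \<le> M" using cutoff'_bounded by metis
  \<comment> \<open>The averaged test function fails to be constant along characteristics by the
    factor \<open>v - V_avg' n\<close>, which tends to 0 wherever \<open>v\<close> is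
    continuous.\<close>
  have lim0: "(\<lambda>n. LINT z:R|lborel. H n z) \<longlonglongrightarrow> (LINT z:R|lborel. 0)"
  proof (rule set_integral_dominated_bounded[OF R_finite])
    show "\<bar>H n z\<bar> \<le> \<rho>max * (M * (vmax + vmax))" for n z
    proof -
      have "\<bar>v (fst z) - V_avg' n (fst z)\<bar> \<le> vmax + vmax"
        using abs_v_le[of "fst z"] V_avg'_bounds[of n "fst z"] by linarith
      moreover have "0 \<le> M" using M[of 0] by linarith
      ultimately show ?thesis
        unfolding H_def abs_mult using M[of "k n z"] abs_u_le[of z] rmax_pos vmax_pos by (intro mult_mono) auto
    qed
    show "AE z in lborel. z \<in> R \<longrightarrow> (\<lambda>n. H n z) \<longlonglongrightarrow> 0"
      using AE_lborel_projections(1)[OF AE_isCont_v]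
    proof eventually_elim
      case (elim z)
      have "(\<lambda>n. H n z) \<longlonglongrightarrow> 0"
      proof (rule Lim_null_comparison)
        show "\<forall>\<^sub>F n in sequentially. norm (H n z) \<le> \<rho>max * (M * \<bar>v (fst z) - V_avg' n (fst z)\<bar>)"
          unfolding H_def real_norm_def abs_mult using M abs_u_le rmax_pos
          by (intro always_eventually allI mult_mono) (auto intro: order_trans[OF abs_ge_zero M])
        have "(\<lambda>n. \<rho>max * (M * \<bar>v (fst z) - V_avg' n (fst z)\<bar>)) \<longlonglongrightarrow> \<rho>max * (M * \<bar>v (fst z) - v (fst z)\<bar>)"
          by (intro tendsto_intros V_avg'_tendsto elim)
        then show "(\<lambda>n. \<rho>max * (M * \<bar>v (fst z) - V_avg' n (fst z)\<bar>)) \<longlonglongrightarrow> 0" by simp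
      qed
      then show ?case by simp
    qed
  qed measurable
  have m: "(\<lambda>t. cutoff m (k n (t, x))) \<in> borel_measurable borel" "(\<lambda>x. cutoff m (k n (t, x))) \<in> borel_measurable borel"
    "(\<lambda>t. cutoff m (V ts - L - (V t - x))) \<in> borel_measurable borel"
    "(\<lambda>x. cutoff m (V ts - L - (V t - x))) \<in> borel_measurable borel" for n t x
    unfolding k_def fst_conv snd_conv by measurable
  have lim1: "(\<lambda>n. LINT x:{0..L}|lborel. \<rho>0 x * cutoff m (k n (0, x))) \<longlonglongrightarrow> (LINT x:{0..L}|lborel. \<rho>0 x * cutoff m (V ts - L - (V 0 - x)))"
    by (intro set_integral_weighted_limit[where C=1] rho0_integrable m cb AE_I2 impI klim)
  have lim2: "(\<lambda>n. LINT t:{0..T}|lborel. In t * cutoff m (k n (t, 0))) \<longlonglongrightarrow> (LINT t:{0..T}|lborel. In t * cutoff m (V ts - L - (V t - 0)))"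
    by (intro set_integral_weighted_limit[where C=1] In_integrable m cb AE_I2 impI klim)
  have lim3: "(\<lambda>n. LINT t:{0..T}|lborel. r t * v t * cutoff m (k n (t, L))) \<longlonglongrightarrow> (LINT t:{0..T}|lborel. r t * v t * cutoff m (V ts - L - (V t - L)))"
    by (intro set_integral_weighted_limit[where C=1] rv_integrable m cb AE_I2 impI klim)
  from LIMSEQ_unique[OF tendsto_add[OF tendsto_add[OF lim0 lim1] lim2, unfolded eq] lim3]
  show ?thesis by (simp add: set_lebesgue_integral_def algebra_simps)
qed

text \<open>The cutoffs sharpen to the indicator of the positive numbers as m grows; dominated
  convergence passes the balance to the limit.\<close>

lemma cumulative_outflow:
  assumes ts: "ts \<le> T"
  shows "(LINT t:{0..T}|lborel. r t * v t * indicator {0<..} (V ts - V t)) = departed ts"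
proof -
  have clim: "(\<lambda>m. cutoff m y) \<longlonglongrightarrow> indicator {0<..} y" for y
  proof (cases "0 < y")
    case False
    then have "cutoff m y = 0" for m by (intro cutoff_zero) (simp add: not_less order_trans[of y 0])
    then show ?thesis using False by simp
  qed (simp add: cutoff_tendsto)
  have cb: "\<bar>cutoff m y\<bar> \<le> 1" for m y using cutoff_bounds[of m y] by simp
  have lim1: "(\<lambda>m. LINT x:{0..L}|lborel. \<rho>0 x * cutoff m (V ts - L + x)) \<longlonglongrightarrow>
      (LINT x:{0..L}|lborel. \<rho>0 x * indicator {0<..} (V ts - L + x))"
    by (intro set_integral_weighted_limit[where C=1] rho0_integrable cb AE_I2 impI clim) measurable
  have lim2: "(\<lambda>m. LINT t:{0..T}|lborel. In t * cutoff m (V ts - L - V t)) \<longlonglongrightarrow>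
      (LINT t:{0..T}|lborel. In t * indicator {0<..} (V ts - L - V t))"
    by (intro set_integral_weighted_limit[where C=1] In_integrable cb AE_I2 impI clim) measurable
  have lim3: "(\<lambda>m. LINT t:{0..T}|lborel. r t * v t * cutoff m (V ts - V t)) \<longlonglongrightarrow>
      (LINT t:{0..T}|lborel. r t * v t * indicator {0<..} (V ts - V t))"
    by (intro set_integral_weighted_limit[where C=1] rv_integrable cb AE_I2 impI clim) measurable
  show ?thesis
    using LIMSEQ_unique[OF tendsto_add[OF lim1 lim2, unfolded balance_cutoff[OF ts]] lim3]
    by (simp add: departed_def)
qed

lemma trace_bounds: "AE t in lborel. t \<in> {0..T} \<longrightarrow> r t \<le> \<rho>cr"
  using r_flux by eventually_elim (simp add: flux_eq_linear_iff)

end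

end

section \<open>Existence of the entropy solution\<close>

context traffic
begin

text \<open>The density carried by the characteristic with label s = V t - x. A negative label
  started at position -s at time 0; any other entered at x = 0 at time \<open>V_inv s\<close>, with
  density flow over speed.\<close>

definition profile :: "real \<Rightarrow> real" where
  "profile s = (if s < 0 then \<rho>0 (- s) else In (V_inv s) / v (V_inv s))"

lemma profile_measurable [measurable]: "profile \<in> borel_measurable borel"
  unfolding profile_def by measurable

lemma profile_bounds: "0 \<le> profile s" "profile s \<le> \<rho>cr" "\<bar>profile s\<bar> \<le> \<rho>cr"
proof -
  show *: "0 \<le> profile s" "profile s \<le> \<rho>cr" using rho0_bounds In_bounds v_pos by (auto simp: profile_def less_imp_le)
  then show "\<bar>profile s\<bar> \<le> \<rho>cr" by simp
qed

text \<open>\<open>V\<close> is a bijection that is continuous in both directions, so apart from s =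
  0 the discontinuities are images of those of the data.\<close>

lemma profile_discont: "countable {s. \<not> isCont profile s}"
proof (rule countable_subset)
  have "isCont profile s" if "s \<noteq> 0" "isCont \<rho>0 (- s)" "isCont In (V_inv s)" "isCont v (V_inv s)" for s
  proof (cases "s < 0")
    case True
    then have "\<forall>\<^sub>F x in nhds s. x < 0" by (auto intro: eventually_nhds_in_open[of "{..<0}", simplified])
    then have "\<forall>\<^sub>F x in nhds s. profile x = \<rho>0 (- x)" by eventually_elim (simp add: profile_def)
    moreover have "isCont (\<lambda>x. \<rho>0 (- x)) s" using isCont_o2[of s uminus \<rho>0] that(2) by simp
    ultimately show ?thesis by (simp cong: isCont_cong)
  next
    case False
    with that(1) have "\<forall>\<^sub>F x in nhds s. 0 < x" by (auto intro: eventually_nhds_in_open[of "{0<..}", simplified])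
    then have "\<forall>\<^sub>F x in nhds s. profile x = In (V_inv x) / v (V_inv x)" by eventually_elim (simp add: profile_def)
    moreover have "isCont (\<lambda>x. In (V_inv x) / v (V_inv x)) s"
      using v_pos[of "V_inv s"] isCont_o2[OF isCont_V_inv that(3)] isCont_o2[OF isCont_V_inv that(4)]
      by (intro continuous_divide) auto
    ultimately show ?thesis by (simp cong: isCont_cong)
  qed
  then show "{s. \<not> isCont profile s} \<subseteq> {0} \<union> uminus ` {x. \<not> isCont \<rho>0 x} \<union> V ` ({t. \<not> isCont In t} \<union> {t. \<not> isCont v t})"
  proof (intro subsetI)
    fix s assume *: "s \<in> {s. \<not> isCont profile s}" and
      imp: "\<And>s. s \<noteq> 0 \<Longrightarrow> isCont \<rho>0 (- s) \<Longrightarrow> isCont In (V_inv s) \<Longrightarrow> isCont v (V_inv s) \<Longrightarrow> isCont profile s"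
    have "s \<in> uminus ` {x. \<not> isCont \<rho>0 x}" if "\<not> isCont \<rho>0 (- s)"
      using that by (intro image_eqI[of _ _ "- s"]) auto
    moreover have "s \<in> V ` ({t. \<not> isCont In t} \<union> {t. \<not> isCont v t})" if "\<not> isCont In (V_inv s) \<or> \<not> isCont v (V_inv s)"
      using that by (intro image_eqI[of _ _ "V_inv s"]) auto
    ultimately show "s \<in> {0} \<union> uminus ` {x. \<not> isCont \<rho>0 x} \<union> V ` ({t. \<not> isCont In t} \<union> {t. \<not> isCont v t})"
      using imp[of s] * by blast
  qed
  show "countable ({0} \<union> uminus ` {x. \<not> isCont \<rho>0 x} \<union> V ` ({t. \<not> isCont In t} \<union> {t. \<not> isCont v t}))"
    using rho0_discont In_discont v_discont by auto
qed

text \<open>Dominated convergence: for almost every y the limiting label is a continuity point of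
  the profile, so the values converge pointwise.\<close>

lemma L1_trace_profile:
  assumes g [measurable]: "g \<in> borel_measurable borel" and gb: "\<And>y. \<bar>g y\<bar> \<le> C"
    and p [measurable]: "\<And>s. p s \<in> borel_measurable borel"
    and lim: "\<And>y. ((\<lambda>s. p s y) \<longlongrightarrow> p s0 y) (at s0 within S)"
    and geq: "AE y in lborel. y \<in> {a..b} \<longrightarrow> profile (p s0 y) = g y"
    and cont: "AE y in lborel. isCont profile (p s0 y)"
  shows "L1_trace (\<lambda>s y. profile (p s y)) s0 S {a..b} g"
  unfolding L1_trace_def
proof (intro conjI bexI[of _ "{}"])
  show "set_integrable lborel {a..b} g" by (rule set_integrable_Icc_bounded[OF g gb])
  show "((\<lambda>s. LINT y:{a..b}|lborel. \<bar>profile (p s y) - g y\<bar>) \<longlongrightarrow> 0) (at s0 within (S - {}))"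
    unfolding tendsto_at_iff_sequentially comp_def
  proof (intro allI impI)
    fix X :: "nat \<Rightarrow> real" assume X: "\<forall>i. X i \<in> S - {} - {s0}" "X \<longlonglongrightarrow> s0"
    have "(\<lambda>n. LINT y:{a..b}|lborel. \<bar>profile (p (X n) y) - g y\<bar>) \<longlonglongrightarrow> (LINT y:{a..b}|lborel. 0)"
    proof (rule set_integral_dominated_bounded)
      show "\<bar>\<bar>profile (p (X n) y) - g y\<bar>\<bar> \<le> \<rho>cr + C" for n y
        using profile_bounds(3)[of "p (X n) y"] gb[of y] by linarith
      show "AE y in lborel. y \<in> {a..b} \<longrightarrow> (\<lambda>n. \<bar>profile (p (X n) y) - g y\<bar>) \<longlonglongrightarrow> 0"
        using geq cont
      proof eventually_elim
        case (elim y)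
        show ?case
        proof
          assume y: "y \<in> {a..b}"
          have "(\<lambda>n. p (X n) y) \<longlonglongrightarrow> p s0 y"
            using lim[of y] X unfolding tendsto_at_iff_sequentially comp_def by simp
          from isCont_tendsto_compose[OF elim(2) this]
          have "(\<lambda>n. \<bar>profile (p (X n) y) - g y\<bar>) \<longlonglongrightarrow> \<bar>profile (p s0 y) - g y\<bar>" by (intro tendsto_intros)
          then show "(\<lambda>n. \<bar>profile (p (X n) y) - g y\<bar>) \<longlonglongrightarrow> 0" using elim(1) y by simp
        qed
      qed
    qed (auto intro: emeasure_lborel_Icc_eq[THEN ord_eq_less_trans])
    then show "(\<lambda>n. LINT y:{a..b}|lborel. \<bar>profile (p (X n) y) - g y\<bar>) \<longlonglongrightarrow> 0"
      by (simp add: set_lebesgue_integral_def)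
  qed
qed simp

text \<open>The substitution s = V t - x at fixed t turns the integrand into G s times the
  derivative of \<open>\<phi>\<close> along the characteristic with label s. Integrating in t first
  gives the difference of two end values of \<open>\<phi>\<close>, both zero.\<close>

lemma transport_integral:
  assumes tf: "test_function L T \<phi> \<phi>t \<phi>x" and G [measurable]: "G \<in> borel_measurable borel" and Gb: "\<And>s. \<bar>G s\<bar> \<le> C"
  shows "(LINT z:R|lborel. G (V (fst z) - snd z) * (\<phi>t z + v (fst z) * \<phi>x z)) = 0"
proof -
  have C1: "C1_fun \<phi> \<phi>t \<phi>x" using tf by (simp add: test_function_iff)
  note [measurable] = C1_fun_measurable[OF C1]
  define D where "D z = \<phi>t z + v (fst z) * \<phi>x z" for z
  have [measurable]: "D \<in> borel_measurable borel" unfolding D_def by measurable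
  have D0: "D z = 0" if "z \<notin> {0<..<T} \<times> {0<..<L}" for z
    using test_function_outside[OF tf that] by (simp add: D_def)
  obtain M where M: "\<And>z. z \<in> R \<Longrightarrow> \<bar>\<phi> z\<bar> \<le> M \<and> \<bar>\<phi>t z\<bar> \<le> M \<and> \<bar>\<phi>x z\<bar> \<le> M" "0 \<le> M"
    using C1_fun_bounded_rect[OF C1] by metis
  have Db: "\<bar>D z\<bar> \<le> M + vmax * M" for z
  proof (cases "z \<in> R")
    case True
    have "\<bar>v (fst z) * \<phi>x z\<bar> \<le> vmax * M"
      unfolding abs_mult using M(1)[OF True] abs_v_le vmax_pos by (intro mult_mono) auto
    then show ?thesis using M(1)[OF True] unfolding D_def by linarith
  next
    case False
    then have "D z = 0" by (intro D0) auto
    then show ?thesis using M vmax_pos by simp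
  qed
  have C0: "0 \<le> C" using Gb[of 0] by linarith
  \<comment> \<open>\<open>D\<close> vanishes outside the open rectangle. The range of s may thus be
    enlarged to one interval common to all t, a product domain on which the order of integration can
    be exchanged.\<close>
  have shift: "(LINT x:{0..L}|lborel. G (V t - x) * D (t, x)) = (LINT s:{- L..V T}|lborel. G s * D (t, V t - s))"
    if t: "t \<in> {0..T}" for t
  proof -
    have Vt: "0 \<le> V t" "V t \<le> V T" using t V_mono[of 0 t] V_mono[of t T] by auto
    have "(LINT x:{0..L}|lborel. G (V t - x) * D (t, x)) = (LINT x|lborel. G (V t - x) * D (t, x))"
      unfolding set_lebesgue_integral_def
    proof (rule Bochner_Integration.integral_cong)
      fix x
      show "indicator {0..L} x *\<^sub>R (G (V t - x) * D (t, x)) = G (V t - x) * D (t, x)"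
        using D0[of "(t, x)"] by (cases "x \<in> {0..L}") auto
    qed simp
    also have "\<dots> = (LINT s|lborel. G s * D (t, V t - s))"
      using lborel_integral_real_affine[of "-1" "\<lambda>x. G (V t - x) * D (t, x)" "V t"] by simp
    also have "\<dots> = (LINT s:{- L..V T}|lborel. G s * D (t, V t - s))"
      unfolding set_lebesgue_integral_def
    proof (rule Bochner_Integration.integral_cong)
      fix s
      show "G s * D (t, V t - s) = indicator {- L..V T} s *\<^sub>R (G s * D (t, V t - s))"
        using Vt D0[of "(t, V t - s)"] by (cases "s \<in> {- L..V T}") auto
    qed simp
    finally show ?thesis .
  qed
  have bd: "\<bar>G y * D z\<bar> \<le> C * (M + vmax * M)" for y z
    unfolding abs_mult using Gb Db C0 by (intro mult_mono) auto
  have "(LINT z:R|lborel. G (V (fst z) - snd z) * D z) = (LINT t:{0..T}|lborel. LINT x:{0..L}|lborel. G (V t - x) * D (t, x))"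
    by (subst set_Fubini(1)[where B="C * (M + vmax * M)"]) (use bd in auto)
  also have "\<dots> = (LINT t:{0..T}|lborel. LINT s:{- L..V T}|lborel. G s * D (t, V t - s))"
    by (intro set_lebesgue_integral_cong) (auto simp: shift)
  also have "\<dots> = (LINT z:{0..T} \<times> {- L..V T}|lborel. G (snd z) * D (fst z, V (fst z) - snd z))"
    by (subst set_Fubini(1)[where B="C * (M + vmax * M)"]) (use bd in auto)
  also have "\<dots> = (LINT s:{- L..V T}|lborel. LINT t:{0..T}|lborel. G s * D (t, V t - s))"
    by (subst set_Fubini(2)[where B="C * (M + vmax * M)"]) (use bd in auto)
  also have "\<dots> = (LINT s:{- L..V T}|lborel. G s * 0)"
  proof -
    have "(LINT t:{0..T}|lborel. D (t, V t - s)) = 0" for s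
      using integral_along_characteristic[OF C1, of T s] T_pos test_function_outside(1)[OF tf] by (simp add: D_def)
    then show ?thesis by simp
  qed
  finally show ?thesis by (simp add: D_def set_lebesgue_integral_def)
qed

text \<open>Equality holds in every case. For k up to \<open>\<rho>cr\<close> both states lie on the
  linear branch and the entropy is again a function of the label. For larger k the sign is always
  -1, and the integrand is a constant-state part minus the transport equation.\<close>

lemma kruzhkov_profile: "kruzhkov_inequalities L T \<rho>cr \<rho>max v (\<lambda>t x. profile (V t - x))"
  unfolding kruzhkov_inequalities_def
proof (intro ballI allI impI)
  fix k \<phi> \<phi>t \<phi>x
  assume k: "k \<in> {0..\<rho>max}" and tf: "test_function L T \<phi> \<phi>t \<phi>x"
  have C1: "C1_fun \<phi> \<phi>t \<phi>x" using tf by (simp add: test_function_iff)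
  note [measurable] = C1_fun_measurable[OF C1]
  define I where "I = (\<lambda>(t, x). \<bar>profile (V t - x) - k\<bar> * \<phi>t (t, x)
    + sgn (profile (V t - x) - k) * (f (profile (V t - x)) (v t) - f k (v t)) * \<phi>x (t, x))"
  have fh: "f (profile s) w = profile s * w" for s w using profile_bounds(2) by (simp add: newell_daganzo_flux_def)
  have "(LINT z:R|lborel. I z) = 0"
  proof (cases "k \<le> \<rho>cr")
    case True
    have "(LINT z:R|lborel. I z) = (LINT z:R|lborel. \<bar>profile (V (fst z) - snd z) - k\<bar> * (\<phi>t z + v (fst z) * \<phi>x z))"
    proof (rule set_lebesgue_integral_cong)
      show "\<forall>z. z \<in> R \<longrightarrow> I z = \<bar>profile (V (fst z) - snd z) - k\<bar> * (\<phi>t z + v (fst z) * \<phi>x z)" (is "\<forall>z. z \<in> R \<longrightarrow> ?P z")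
      proof (intro allI impI)
        fix z :: "real \<times> real"
        have "sgn y * y = \<bar>y\<bar>" for y :: real by (simp add: sgn_if)
        from this[of "profile (V (fst z) - snd z) - k"] True
        show "?P z"
          by (simp add: I_def case_prod_beta fh newell_daganzo_flux_def[of _ _ k] distrib_left mult.assoc flip: left_diff_distrib)
      qed
    qed (simp add: R_finite)
    also have "\<dots> = 0"
    proof (rule transport_integral[OF tf, where C="\<rho>cr + \<bar>k\<bar>"])
      show "\<bar>\<bar>profile s - k\<bar>\<bar> \<le> \<rho>cr + \<bar>k\<bar>" for s using profile_bounds(3)[of s] by linarith
    qed measurable
    finally show ?thesis .
  next
    case False
    \<comment> \<open>On the falling branch the flux of a constant state is still proportional to v,
      with a factor free of t and x.\<close>
    define \<kappa> where "\<kappa> = \<rho>cr / (\<rho>max - \<rho>cr) * (\<rho>max - k)"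
    have fk: "f k w = \<kappa> * w" for w using False by (simp add: newell_daganzo_flux_def \<kappa>_def)
    have "(LINT z:R|lborel. I z) = (LINT z:R|lborel. (k * \<phi>t z + \<kappa> * (v (fst z) * \<phi>x z)) - profile (V (fst z) - snd z) * (\<phi>t z + v (fst z) * \<phi>x z))"
    proof (rule set_lebesgue_integral_cong)
      show "\<forall>z. z \<in> R \<longrightarrow> I z = (k * \<phi>t z + \<kappa> * (v (fst z) * \<phi>x z)) - profile (V (fst z) - snd z) * (\<phi>t z + v (fst z) * \<phi>x z)" (is "\<forall>z. z \<in> R \<longrightarrow> ?P z")
      proof (intro allI impI)
        fix z :: "real \<times> real"
        have "profile (V (fst z) - snd z) < k" using profile_bounds(2)[of "V (fst z) - snd z"] False by simp
        then show "?P z"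
          by (simp add: I_def case_prod_beta fh fk algebra_simps)
      qed
    qed (simp add: R_finite)
    also have "\<dots> = k * (LINT z:R|lborel. \<phi>t z) + \<kappa> * (LINT z:R|lborel. v (fst z) * \<phi>x z)
        - (LINT z:R|lborel. profile (V (fst z) - snd z) * (\<phi>t z + v (fst z) * \<phi>x z))"
    proof -
      have i: "set_integrable lborel R \<phi>t" "set_integrable lborel R (\<lambda>z. v (fst z) * \<phi>x z)"
        using integrable_test(1)[OF tf, of "\<lambda>_. 1" 1] integrable_test(2)[OF tf, of "\<lambda>z. v (fst z)" vmax] abs_v_le by auto
      have j: "set_integrable lborel R (\<lambda>z. profile (V (fst z) - snd z) * \<phi>t z)"
        by (rule integrable_test(1)[OF tf _ profile_bounds(3)]) measurable
      have l: "set_integrable lborel R (\<lambda>z. (profile (V (fst z) - snd z) * v (fst z)) * \<phi>x z)"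
      proof (rule integrable_test(2)[OF tf, where C="\<rho>cr * vmax"])
        show "\<bar>profile (V (fst z) - snd z) * v (fst z)\<bar> \<le> \<rho>cr * vmax" for z :: "real \<times> real"
          unfolding abs_mult using profile_bounds(3) abs_v_le rcr_pos by (intro mult_mono) auto
      qed measurable
      have "set_integrable lborel R (\<lambda>z. profile (V (fst z) - snd z) * (\<phi>t z + v (fst z) * \<phi>x z))"
        using set_integral_add(1)[OF j l] by (simp add: distrib_left mult.assoc)
      with i show ?thesis by (simp add: set_integral_add set_integral_diff)
    qed
    also have "\<dots> = 0"
      using test_function_integrals[OF tf T_pos L_pos v_measurable abs_v_le] transport_integral[OF tf profile_measurable profile_bounds(3)] by simp
    finally show ?thesis .
  qed
  then show "0 \<le> (LINT (t, x) : R | lborel. \<bar>profile (V t - x) - k\<bar> * \<phi>t (t, x)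
      + sgn (profile (V t - x) - k) * (f (profile (V t - x)) (v t) - f k (v t)) * \<phi>x (t, x))"
    unfolding I_def by simp
qed

lemma entropy_solution_profile: "entropy_solution L T \<rho>cr \<rho>max \<rho>0 In v (\<lambda>t x. profile (V t - x))"
  unfolding entropy_solution_def
proof (intro conjI kruzhkov_profile ballI exI[of _ "\<lambda>t. profile (V t - L)"])
  have "(\<lambda>z. profile (V (fst z) - snd z)) \<in> borel_measurable borel" by measurable
  then show "set_borel_measurable lborel R (\<lambda>(t, x). profile (V t - x))"
    unfolding set_borel_measurable_def case_prod_beta using R_finite by measurable
  show "profile (V t - x) \<in> {0..\<rho>max}" for t x using profile_bounds(1,2)[of "V t - x"] rcr_less by auto
  \<comment> \<open>A label map with left inverse \<open>q'\<close> can hit the countable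
    exceptional set only from points of its image under \<open>q'\<close>, which is again
    countable.\<close>
  have disc: "AE y in lborel. isCont profile (q y)" if "\<And>y. q' (q y) = y" for q q' :: "real \<Rightarrow> real"
  proof -
    have "AE y in lborel. y \<notin> q' ` {s. \<not> isCont profile s}"
      by (rule AE_not_in[OF countable_imp_null_set_lborel]) (intro countable_image profile_discont)
    then show ?thesis
    proof eventually_elim
      case (elim y)
      then show ?case using that[of y] by (metis (mono_tags, lifting) imageI mem_Collect_eq)
    qed
  qed
  have Vlim: "((\<lambda>t. V t - x) \<longlongrightarrow> V t0 - x) (at t0 within S)" for t0 x S
    using isCont_V[of t0] by (intro tendsto_intros) (auto simp: isCont_def intro: tendsto_within_subset)
  show "initial_trace L T (\<lambda>t x. profile (V t - x)) \<rho>0"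
  proof (rule L1_trace_profile[OF rho0_measurable abs_rho0_le _ Vlim])
    \<comment> \<open>The point x = 0 is left out because label 0 carries the inflow value.\<close>
    show "AE x in lborel. x \<in> {0..L} \<longrightarrow> profile (V 0 - x) = \<rho>0 x"
      using AE_lborel_singleton[of 0] by eventually_elim (auto simp: profile_def)
    show "AE x in lborel. isCont profile (V 0 - x)" by (rule disc[of uminus]) simp
  qed measurable
  have Inv: "\<bar>In t / v t\<bar> \<le> \<rho>cr" for t
    using In_bounds(1)[of t] In_bounds(2)[of t t] v_pos[of t] by simp
  show "left_trace L T (\<lambda>t x. profile (V t - x)) (\<lambda>t. In t / v t)"
  proof (rule L1_trace_profile[OF _ Inv])
    show "AE t in lborel. t \<in> {0..T} \<longrightarrow> profile (V t - 0) = In t / v t"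
    proof (intro AE_I2 impI)
      fix t assume "t \<in> {0..T}"
      then have "0 \<le> V t" using V_mono[of 0 t] by simp
      then show "profile (V t - 0) = In t / v t" by (simp add: profile_def)
    qed
    show "AE t in lborel. isCont profile (V t - 0)" by (rule disc[of V_inv]) simp
  qed (measurable, intro tendsto_intros)
  show "right_trace L T (\<lambda>t x. profile (V t - x)) (\<lambda>t. profile (V t - L))"
  proof (rule L1_trace_profile[OF _ profile_bounds(3)])
    show "AE t in lborel. isCont profile (V t - L)" by (rule disc[of "\<lambda>y. V_inv (y + L)"]) simp
  qed (measurable, intro tendsto_intros, simp)
  show "AE t in lborel. t \<in> {0..T} \<longrightarrow> f (profile (V t - L)) (v t) = profile (V t - L) * v t"
    using profile_bounds(2) by (auto simp: flux_eq_linear_iff)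
qed

end

section \<open>Uniqueness of traces\<close>

text \<open>The triangle inequality bounds the distance of the two traces by a sum that tends to 0
  along a common approach. Removing both exceptional null sets must leave points near
  \<open>s0\<close>, whence the last assumption.\<close>

lemma L1_trace_unique:
  assumes tr: "L1_trace w s0 S I g1" "L1_trace w s0 S I g2"
    and I [measurable]: "I \<in> sets borel"
    and w: "\<And>s. s \<in> S \<Longrightarrow> set_integrable lborel I (w s)"
    and nontriv: "\<And>N. N \<in> null_sets lborel \<Longrightarrow> at s0 within (S - N) \<noteq> bot"
  shows "AE y in lborel. y \<in> I \<longrightarrow> g1 y = g2 y"
proof -
  obtain N1 N2 where N: "N1 \<in> null_sets lborel" "N2 \<in> null_sets lborel"
    and g: "set_integrable lborel I g1" "set_integrable lborel I g2"
    and lim: "((\<lambda>s. LINT y:I|lborel. \<bar>w s y - g1 y\<bar>) \<longlongrightarrow> 0) (at s0 within (S - N1))"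
      "((\<lambda>s. LINT y:I|lborel. \<bar>w s y - g2 y\<bar>) \<longlongrightarrow> 0) (at s0 within (S - N2))"
    using tr unfolding L1_trace_def by blast
  have gi: "set_integrable lborel I (\<lambda>y. \<bar>g1 y - g2 y\<bar>)" by (intro set_integrable_abs set_integral_diff g)
  have "((\<lambda>s. (LINT y:I|lborel. \<bar>w s y - g1 y\<bar>) + (LINT y:I|lborel. \<bar>w s y - g2 y\<bar>)) \<longlongrightarrow> 0 + 0) (at s0 within (S - (N1 \<union> N2)))"
    by (intro tendsto_add tendsto_within_subset[OF lim(1)] tendsto_within_subset[OF lim(2)]) auto
  then have "(LINT y:I|lborel. \<bar>g1 y - g2 y\<bar>) \<le> 0 + 0"
  proof (rule tendsto_lowerbound)
    show "at s0 within (S - (N1 \<union> N2)) \<noteq> bot" using N by (intro nontriv) auto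
    show "\<forall>\<^sub>F s in at s0 within (S - (N1 \<union> N2)).
        (LINT y:I|lborel. \<bar>g1 y - g2 y\<bar>) \<le> (LINT y:I|lborel. \<bar>w s y - g1 y\<bar>) + (LINT y:I|lborel. \<bar>w s y - g2 y\<bar>)"
      unfolding eventually_at_filter
    proof (intro always_eventually allI impI)
      fix s assume "s \<in> S - (N1 \<union> N2)"
      then have s: "s \<in> S" by simp
      have i: "set_integrable lborel I (\<lambda>y. \<bar>w s y - g1 y\<bar>)" "set_integrable lborel I (\<lambda>y. \<bar>w s y - g2 y\<bar>)"
        by (intro set_integrable_abs set_integral_diff g w s)+
      have "(LINT y:I|lborel. \<bar>g1 y - g2 y\<bar>) \<le> (LINT y:I|lborel. \<bar>w s y - g1 y\<bar> + \<bar>w s y - g2 y\<bar>)"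
        using i by (intro set_integral_mono gi set_integral_add) auto
      then show "(LINT y:I|lborel. \<bar>g1 y - g2 y\<bar>) \<le> (LINT y:I|lborel. \<bar>w s y - g1 y\<bar>) + (LINT y:I|lborel. \<bar>w s y - g2 y\<bar>)"
        using i by (simp add: set_integral_add)
    qed
  qed
  then have le: "(LINT y:I|lborel. \<bar>g1 y - g2 y\<bar>) \<le> 0" by simp
  from AE_zero_if_set_integral_le_zero[OF gi le] show ?thesis by simp
qed

text \<open>An interval to the left of L has positive measure and cannot be covered by a null
  set.\<close>

lemma at_within_Ioo_minus_null_set:
  fixes L :: real
  assumes "0 < L" "N \<in> null_sets lborel"
  shows "at L within ({0<..<L} - N) \<noteq> bot"
  unfolding trivial_limit_within not_not islimpt_approachable
proof (intro allI impI)
  fix e :: real assume "0 < e"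
  define a where "a = max 0 (L - e)"
  have a: "a < L" using assms(1) \<open>0 < e\<close> by (simp add: a_def)
  have "\<not> {a<..<L} \<subseteq> N"
  proof
    assume "{a<..<L} \<subseteq> N"
    then have "emeasure lborel {a<..<L} = 0"
      using null_sets_subset[OF assms(2)] by (metis borel_open open_greaterThanLessThan null_setsD1 sets_lborel)
    then show False using a by simp
  qed
  then obtain x where "x \<in> {a<..<L}" "x \<notin> N" by blast
  then show "\<exists>x'\<in>{0<..<L} - N. x' \<noteq> L \<and> dist x' L < e"
    by (intro bexI[of _ x]) (auto simp: a_def dist_real_def)
qed

text \<open>The trace chosen by \<open>SOME\<close> may differ from the one in the outflow
  condition; uniqueness of traces transfers the condition to it almost everywhere. Existence of the
  explicit solution ensures that the choices denote a solution and a trace.\<close>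

lemma (in traffic) outflow_characterization:
  defines "Out \<equiv> outflow L T \<rho>cr \<rho>max \<rho>0 In v"
  shows "set_integrable lborel {0..T} Out"
    and "AE t in lborel. t \<in> {0..T} \<longrightarrow> \<bar>Out t\<bar> \<le> \<rho>cr * vmax"
    and "\<And>ts. ts \<le> T \<Longrightarrow> (LINT t:{0..T}|lborel. Out t * indicator {..<ts} t) = departed ts"
proof -
  define \<rho> where "\<rho> = (SOME \<rho>. entropy_solution L T \<rho>cr \<rho>max \<rho>0 In v \<rho>)"
  define r where "r = (SOME r. right_trace L T \<rho> r)"
  have sol: "entropy_solution L T \<rho>cr \<rho>max \<rho>0 In v \<rho>"
    unfolding \<rho>_def using entropy_solution_profile by (rule someI[of "entropy_solution L T \<rho>cr \<rho>max \<rho>0 In v"])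
  then obtain r' where r': "right_trace L T \<rho> r'" "AE t in lborel. t \<in> {0..T} \<longrightarrow> f (r' t) (v t) = r' t * v t"
    unfolding entropy_solution_def by blast
  have r: "right_trace L T \<rho> r" unfolding r_def using r'(1) by (rule someI[of "right_trace L T \<rho>"])
  note um = u_measurable[OF sol r'] and ub = abs_u_le[OF sol r']
  have ui: "set_integrable lborel {0..T} (\<lambda>t. u \<rho> (t, x))" for x by (rule slices_integrable[OF um ub])
  have u_tr: "right_trace L T (\<lambda>t x. u \<rho> (t, x)) g \<longleftrightarrow> right_trace L T \<rho> g" for g
    by (rule L1_trace_cong) (auto simp: u_def[OF sol r'])
  have "AE t in lborel. t \<in> {0..T} \<longrightarrow> r t = r' t"
    by (rule L1_trace_unique[OF r[folded u_tr] r'(1)[folded u_tr] _ ui at_within_Ioo_minus_null_set[OF L_pos]]) simp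
  then have rf: "AE t in lborel. t \<in> {0..T} \<longrightarrow> f (r t) (v t) = r t * v t"
    using r'(2) by eventually_elim simp
  \<comment> \<open>The solution is nonnegative, so |r| is a trace as well; uniqueness then gives
    the sign of r, and with it the two-sided bound on the outflow.\<close>
  have "right_trace L T (\<lambda>t x. u \<rho> (t, x)) (\<lambda>t. \<bar>r t\<bar>)"
  proof (rule L1_trace_dominated[OF r[folded u_tr] ui ui, where C=1])
    show "set_integrable lborel {0..T} (\<lambda>t. \<bar>r t\<bar>)" using r by (intro set_integrable_abs) (simp add: L1_trace_def)
    show "AE t in lborel. t \<in> {0..T} \<longrightarrow> \<bar>u \<rho> (t, x) - \<bar>r t\<bar>\<bar> \<le> 1 * \<bar>u \<rho> (t, x) - r t\<bar>" for x
    proof (intro AE_I2 impI)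
      fix t
      show "\<bar>u \<rho> (t, x) - \<bar>r t\<bar>\<bar> \<le> 1 * \<bar>u \<rho> (t, x) - r t\<bar>" using u_bounds(1)[OF sol r', of "(t, x)"] by (auto simp: abs_if)
    qed
  qed
  then have rnn: "AE t in lborel. t \<in> {0..T} \<longrightarrow> r t = \<bar>r t\<bar>"
    using L1_trace_unique[OF r[folded u_tr] _ _ ui at_within_Ioo_minus_null_set[OF L_pos]] by simp
  have Out: "Out = (\<lambda>t. r t * v t)"
    unfolding Out_def outflow_def Let_def \<rho>_def[symmetric] r_def[symmetric] ..
  show "set_integrable lborel {0..T} Out" unfolding Out by (rule rv_integrable[OF sol r rf])
  show "AE t in lborel. t \<in> {0..T} \<longrightarrow> \<bar>Out t\<bar> \<le> \<rho>cr * vmax"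
    using trace_bounds[OF sol r rf] rnn
  proof eventually_elim
    case (elim t)
    show ?case
    proof
      assume "t \<in> {0..T}"
      with elim have "\<bar>r t\<bar> \<le> \<rho>cr" by simp
      then show "\<bar>Out t\<bar> \<le> \<rho>cr * vmax" unfolding Out abs_mult using abs_v_le rcr_pos by (intro mult_mono) auto
    qed
  qed
  fix ts assume "ts \<le> T"
  have "indicator {0<..} (V ts - V t) = (indicator {..<ts} t :: real)" for t
    by (simp add: indicator_def V_less_iff)
  with cumulative_outflow[OF sol r rf \<open>ts \<le> T\<close>]
  show "(LINT t:{0..T}|lborel. Out t * indicator {..<ts} t) = departed ts" by (simp add: Out)
qed

section \<open>Weak convergence and lower semicontinuity\<close>

text \<open>Half-lines form an intersection-stable generator of the Borel sets, so a Dynkin argument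
  extends convergence to all indicators, and approximation extends it to integrable weights. Limits
  of weights are admissible because the uniform bound C makes the error independent of n.\<close>

lemma weak_convergence_of_cumulative:
  fixes d :: "nat \<Rightarrow> real \<Rightarrow> real"
  assumes dm [measurable]: "\<And>n. d n \<in> borel_measurable borel" and C0: "0 \<le> C"
    and db: "\<And>n. AE t in lborel. \<bar>d n t\<bar> \<le> C"
    and d0: "\<And>n t. t \<notin> {a..b} \<Longrightarrow> d n t = 0"
    and cum: "\<And>s. s \<le> b \<Longrightarrow> (\<lambda>n. LINT t|lborel. indicator {..<s} t * d n t) \<longlonglongrightarrow> 0"
    and \<psi>: "integrable lborel \<psi>"
  shows "(\<lambda>n. LINT t|lborel. \<psi> t * d n t) \<longlonglongrightarrow> 0"
proof -
  define good where "good \<psi> \<longleftrightarrow> (\<lambda>n. LINT t|lborel. \<psi> t * d n t) \<longlonglongrightarrow> 0" for \<psi> :: "real \<Rightarrow> real"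
  \<comment> \<open>The functions \<open>d n\<close> live on [a,b], so weights need to be integrable
    only there. This admits the constant 1 as a majorant of indicators.\<close>
  define loc where "loc w \<longleftrightarrow> integrable lborel (\<lambda>t. indicator {a..b} t * w t)" for w :: "real \<Rightarrow> real"
  have int: "integrable lborel (\<lambda>t. w t * d n t)" if "loc w" for w n
  proof (rule Bochner_Integration.integrable_bound)
    show "integrable lborel (\<lambda>t. C * (indicator {a..b} t * w t))" using that by (simp add: loc_def)
    have "(\<lambda>t. (indicator {a..b} t * w t) * d n t) \<in> borel_measurable lborel"
      using that[unfolded loc_def, THEN borel_measurable_integrable] by measurable
    moreover have "(\<lambda>t. (indicator {a..b} t * w t) * d n t) = (\<lambda>t. w t * d n t)"
    proof
      fix t show "indicator {a..b} t * w t * d n t = w t * d n t" using d0[of t n] by (cases "t \<in> {a..b}") auto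
    qed
    ultimately show "(\<lambda>t. w t * d n t) \<in> borel_measurable lborel" by simp
    show "AE t in lborel. norm (w t * d n t) \<le> norm (C * (indicator {a..b} t * w t))"
      using db[of n]
    proof eventually_elim
      case (elim t)
      show ?case
        using d0[of t n] mult_right_mono[OF elim, of "\<bar>w t\<bar>"] C0
        by (cases "t \<in> {a..b}") (auto simp: abs_mult mult.commute)
    qed
  qed
  have good_lim: "good f" if s: "\<And>i. good (s i)" "\<And>i. s i \<in> borel_measurable borel" "f \<in> borel_measurable borel"
    and l: "\<And>t. (\<lambda>i. s i t) \<longlonglongrightarrow> f t" and bd: "\<And>i t. \<bar>s i t\<bar> \<le> w t" and w: "loc w" for f s w
  proof -
    have fw: "\<bar>f t\<bar> \<le> w t" for t by (rule LIMSEQ_le_const2[OF tendsto_rabs[OF l]]) (use bd in auto)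
    have locI: "loc g" if "\<And>t. \<bar>g t\<bar> \<le> w t" "g \<in> borel_measurable borel" for g
      unfolding loc_def
      by (rule Bochner_Integration.integrable_bound[OF w[unfolded loc_def]])
        (use that in \<open>auto simp: indicator_def intro: order_trans[OF _ abs_ge_self]\<close>)
    have sl: "loc (s i)" "loc f" for i using locI bd fw s by auto
    have e: "(\<lambda>i. LINT t|lborel. indicator {a..b} t * \<bar>s i t - f t\<bar>) \<longlonglongrightarrow> (LINT (t::real)|lborel. 0)"
    proof (rule integral_dominated_convergence[where w="\<lambda>t. 2 * (indicator {a..b} t * w t)"])
      show "integrable lborel (\<lambda>t. 2 * (indicator {a..b} t * w t))" using w by (simp add: loc_def)
      show "AE t in lborel. norm (indicator {a..b} t * \<bar>s i t - f t\<bar>) \<le> 2 * (indicator {a..b} t * w t)" for i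
      proof (intro AE_I2)
        fix t
        have "\<bar>s i t - f t\<bar> \<le> 2 * w t" using bd[of i t] fw[of t] by linarith
        then show "norm (indicator {a..b} t * \<bar>s i t - f t\<bar>) \<le> 2 * (indicator {a..b} t * w t)"
          by (simp add: indicator_def)
      qed
      show "AE t in lborel. (\<lambda>i. indicator {a..b} t * \<bar>s i t - f t\<bar>) \<longlonglongrightarrow> 0"
      proof (intro AE_I2)
        fix t
        have "(\<lambda>i. indicator {a..b} t * \<bar>s i t - f t\<bar>) \<longlonglongrightarrow> indicator {a..b} t * \<bar>f t - f t\<bar>"
          by (intro tendsto_intros l)
        then show "(\<lambda>i. indicator {a..b} t * \<bar>s i t - f t\<bar>) \<longlonglongrightarrow> 0" by simp
      qed
    qed (use s in measurable)
    show "good f"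
      unfolding good_def
    proof (rule LIMSEQ_I)
      fix \<epsilon> :: real assume \<epsilon>: "0 < \<epsilon>"
      \<comment> \<open>Dividing by C + 1 instead of C covers the case C = 0.\<close>
      then have "0 < \<epsilon> / 2 / (C + 1)" using C0 by simp
      then have "\<forall>\<^sub>F i in sequentially. (LINT t|lborel. indicator {a..b} t * \<bar>s i t - f t\<bar>) < \<epsilon> / 2 / (C + 1)"
        using order_tendstoD(2)[OF e] by simp
      then obtain i where i: "(LINT t|lborel. indicator {a..b} t * \<bar>s i t - f t\<bar>) < \<epsilon> / 2 / (C + 1)"
        by (auto simp: eventually_sequentially)
      have ei: "integrable lborel (\<lambda>t. indicator {a..b} t * \<bar>s i t - f t\<bar>)"
      proof -
        have eq: "(\<lambda>t. indicator {a..b} t * \<bar>s i t - f t\<bar>) = (\<lambda>t. \<bar>indicator {a..b} t * s i t - indicator {a..b} t * f t\<bar>)"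
        proof
          fix t
          show "indicator {a..b} t * \<bar>s i t - f t\<bar> = \<bar>indicator {a..b} t * s i t - indicator {a..b} t * f t\<bar>"
            by (cases "t \<in> {a..b}") auto
        qed
        show ?thesis
          unfolding eq by (intro integrable_abs Bochner_Integration.integrable_diff sl[unfolded loc_def])
      qed
      have small: "\<bar>(LINT t|lborel. f t * d n t) - (LINT t|lborel. s i t * d n t)\<bar> < \<epsilon> / 2" for n
      proof -
        have "\<bar>(LINT t|lborel. f t * d n t) - (LINT t|lborel. s i t * d n t)\<bar> = \<bar>LINT t|lborel. f t * d n t - s i t * d n t\<bar>"
          using sl by (simp add: int)
        also have "\<dots> \<le> (LINT t|lborel. \<bar>f t * d n t - s i t * d n t\<bar>)" by (rule integral_abs_bound)
        also have "\<dots> \<le> (LINT t|lborel. C * (indicator {a..b} t * \<bar>s i t - f t\<bar>))"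
        proof (rule integral_mono_AE)
          show "integrable lborel (\<lambda>t. \<bar>f t * d n t - s i t * d n t\<bar>)" using sl by (simp add: int)
          show "integrable lborel (\<lambda>t. C * (indicator {a..b} t * \<bar>s i t - f t\<bar>))" using ei by simp
          show "AE t in lborel. \<bar>f t * d n t - s i t * d n t\<bar> \<le> C * (indicator {a..b} t * \<bar>s i t - f t\<bar>)"
            using db[of n]
          proof eventually_elim
            case (elim t)
            have "\<bar>f t * d n t - s i t * d n t\<bar> = \<bar>d n t\<bar> * \<bar>s i t - f t\<bar>"
              by (simp add: abs_minus_commute mult.commute[of _ "d n t"] flip: right_diff_distrib abs_mult)
            then show ?case
              using d0[of t n] mult_right_mono[OF elim, of "\<bar>s i t - f t\<bar>"] by (cases "t \<in> {a..b}") auto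
          qed
        qed
        also have "\<dots> \<le> (C + 1) * (LINT t|lborel. indicator {a..b} t * \<bar>s i t - f t\<bar>)"
          using C0 by (simp add: mult_right_mono)
        also have "\<dots> < (C + 1) * (\<epsilon> / 2 / (C + 1))" using i C0 by (intro mult_strict_left_mono) auto
        also have "\<dots> = \<epsilon> / 2"
          using nonzero_mult_div_cancel_left[of "C + 1" "\<epsilon> / 2"] C0 by (simp only: times_divide_eq_right)
        finally show ?thesis .
      qed
      have "\<forall>\<^sub>F n in sequentially. \<bar>LINT t|lborel. s i t * d n t\<bar> < \<epsilon> / 2"
        using order_tendstoD(2)[OF tendsto_rabs_zero[OF s(1)[of i, unfolded good_def]], of "\<epsilon> / 2"] \<epsilon> by simp
      then have "\<forall>\<^sub>F n in sequentially. norm ((LINT t|lborel. f t * d n t) - 0) < \<epsilon>"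
      proof eventually_elim
        case (elim n)
        then show ?case using small[of n] unfolding real_norm_def by linarith
      qed
      then show "\<exists>no. \<forall>n\<ge>no. norm ((LINT t|lborel. f t * d n t) - 0) < \<epsilon>"
        by (simp add: eventually_sequentially)
    qed
  qed
  have good_add: "good (\<lambda>t. f t + g t)" if "good f" "good g" "loc f" "loc g" for f g
    using tendsto_add[OF that(1,2)[unfolded good_def]] that(3,4) unfolding good_def
    by (simp add: distrib_right int)
  have loc_integrable: "loc f" if "integrable lborel f" for f
    using integrable_mult_indicator[OF _ that, of "{a..b}"] by (simp add: loc_def)
  have loc_ind: "loc (indicator A)" if "A \<in> sets borel" for A
  proof -
    have "integrable lborel (\<lambda>t. indicator {a..b} t *\<^sub>R (indicator A t :: real))"
      using that by (intro integrableI_bounded_set_indicator[where B=1]) (auto simp: indicator_def emeasure_lborel_Icc_eq)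
    then show ?thesis by (simp add: loc_def)
  qed
  have good_ind: "good (indicator A)" if "A \<in> sets borel" for A
  proof -
    let ?G = "range lessThan :: real set set"
    have "Int_stable ?G"
    proof (rule Int_stableI_image)
      show "\<exists>k\<in>UNIV. {..<i} \<inter> {..<j} = {..<k}" for i j :: real by (intro bexI[of _ "min i j"]) auto
    qed
    moreover have "?G \<subseteq> Pow UNIV" by simp
    moreover have "A \<in> sigma_sets UNIV ?G" using that by (simp add: borel_Iio)
    ultimately show ?thesis
    proof (induction rule: sigma_sets_induct_disjoint)
      case (basic A)
      then obtain s where A: "A = {..<s}" by auto
      \<comment> \<open>Convergence is assumed up to b only; beyond b the functions vanish, and the
        point b itself is a null set.\<close>
      have "(LINT t|lborel. indicator {..<s} t * d n t) = (LINT t|lborel. indicator {..<min s b} t * d n t)" for n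
      proof (rule integral_cong_AE)
        show "AE t in lborel. indicator {..<s} t * d n t = indicator {..<min s b} t * d n t"
          using AE_lborel_singleton[of b] by eventually_elim (use d0 in \<open>auto simp: indicator_def\<close>)
      qed measurable
      then show ?case using cum[of "min s b"] by (simp add: good_def A)
    next
      case empty
      show ?case by (simp add: good_def)
    next
      case (compl A)
      have A: "A \<in> sets borel" using compl by (simp add: borel_Iio)
      have "(LINT t|lborel. indicator {..<b} t * d n t) = (LINT t|lborel. d n t)" for n
      proof (rule integral_cong_AE)
        show "AE t in lborel. indicator {..<b} t * d n t = d n t"
          using AE_lborel_singleton[of b] by eventually_elim (use d0 in \<open>auto simp: indicator_def\<close>)
      qed measurable
      with cum[of b] have all: "(\<lambda>n. LINT t|lborel. d n t) \<longlonglongrightarrow> 0" by simp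
      have di: "integrable lborel (d n)" for n using int[OF loc_ind[of UNIV]] by simp
      have "(LINT t|lborel. indicator (UNIV - A) t * d n t) = (LINT t|lborel. d n t) - (LINT t|lborel. indicator A t * d n t)" for n
      proof -
        have "(LINT t|lborel. indicator (UNIV - A) t * d n t) = (LINT t|lborel. d n t - indicator A t * d n t)"
          by (rule Bochner_Integration.integral_cong) (auto simp: indicator_def)
        then show ?thesis using di int[OF loc_ind[OF A]] by simp
      qed
      with tendsto_diff[OF all compl.IH[unfolded good_def]] show ?case by (simp add: good_def)
    next
      case (union A)
      have A [measurable]: "A i \<in> sets borel" for i using union by (auto simp: borel_Iio)
      have fin: "good (indicator (\<Union>i<k. A i))" for k :: nat
      proof (induction k)
        case 0
        show ?case by (simp add: good_def)
      next
        case (Suc k)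
        have "A i \<inter> A k = {}" if "i < k" for i using union(1) that by (simp add: disjoint_family_on_def)
        then have disj: "t \<in> A k \<Longrightarrow> t \<notin> (\<Union>i<k. A i)" for t by blast
        have eq: "indicator (\<Union>i<Suc k. A i) t = (indicator (\<Union>i<k. A i) t + indicator (A k) t :: real)" for t
          unfolding lessThan_Suc UN_insert using disj[of t] by (cases "t \<in> A k") (simp_all add: indicator_def)
        have "(\<Union>i<k. A i) \<in> sets borel" by measurable
        from good_add[OF Suc union(3) loc_ind[OF this] loc_ind[OF A]] show ?case unfolding good_def eq .
      qed
      show ?case
      proof (rule good_lim[OF fin, where w="\<lambda>_. 1"])
        show "(\<lambda>k. indicator (\<Union>i<k. A i) t :: real) \<longlonglongrightarrow> indicator (\<Union> (range A)) t" for t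
          by (rule LIMSEQ_indicator_UN)
        show "loc (\<lambda>_. 1)" using loc_ind[of UNIV] by (simp add: loc_def)
        show "\<bar>indicator (\<Union>i<k. A i) t :: real\<bar> \<le> 1" for k t by (simp add: indicator_def)
        show "indicator (\<Union>i<k. A i) \<in> borel_measurable borel" for k
          by (intro borel_measurable_indicator) measurable
        show "indicator (\<Union> (range A)) \<in> borel_measurable borel"
          by (intro borel_measurable_indicator) measurable
      qed
    qed
  qed
  have "good \<psi>"
    using \<psi>
  proof (induction rule: integrable_induct)
    case (base A c)
    then have "good (\<lambda>t. c * indicator A t)"
      using tendsto_mult[OF tendsto_const[of c] good_ind[of A, unfolded good_def]] by (simp add: good_def mult.assoc)
    then show ?case by (simp add: mult.commute)
  next
    case (add f g)
    then show ?case by (intro good_add loc_integrable)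
  next
    case (lim f s)
    show ?case
    proof (rule good_lim[of s f "\<lambda>t. 2 * \<bar>f t\<bar>"])
      show "loc (\<lambda>t. 2 * \<bar>f t\<bar>)" using lim by (intro loc_integrable) simp
    qed (use lim in auto)
  qed
  then show ?thesis by (simp add: good_def)
qed

text \<open>The square lies above its tangent at the limit function. The linear term of the tangent
  is a pairing of \<open>g n - g0\<close> with a fixed integrable function and tends to 0 by weak
  convergence.\<close>

lemma square_cost_lower_semicontinuous:
  fixes g :: "nat \<Rightarrow> real \<Rightarrow> real"
  assumes gn: "\<And>n. set_integrable lborel {0..T} (g n)" "\<And>n. AE t in lborel. t \<in> {0..T} \<longrightarrow> \<bar>g n t\<bar> \<le> C"
    and g0: "set_integrable lborel {0..T} g0" "AE t in lborel. t \<in> {0..T} \<longrightarrow> \<bar>g0 t\<bar> \<le> C"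
    and C: "0 \<le> C"
    and cum: "\<And>s. s \<le> T \<Longrightarrow> (\<lambda>n. LINT t:{0..T}|lborel. g n t * indicator {..<s} t) \<longlonglongrightarrow> (LINT t:{0..T}|lborel. g0 t * indicator {..<s} t)"
    and f: "f \<in> borel_measurable borel" "\<And>t. \<bar>f t\<bar> \<le> Cf"
    and lim: "(\<lambda>n. LINT t:{0..T}|lborel. (g n t - f t)\<^sup>2) \<longlonglongrightarrow> c"
  shows "(LINT t:{0..T}|lborel. (g0 t - f t)\<^sup>2) \<le> c"
proof -
  have [measurable]: "f \<in> borel_measurable borel" by fact
  \<comment> \<open>An outflow is only known to be integrable on [0,T]; its extension by zero is
    measurable on the line.\<close>
  define Z where "Z k t = indicator {0..T} t * k t" for k :: "real \<Rightarrow> real" and t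
  have Zm: "Z k \<in> borel_measurable borel" if "set_integrable lborel {0..T} k" for k
    using that by (auto simp: Z_def[abs_def] set_integrable_def dest: borel_measurable_integrable)
  have Zb: "AE t in lborel. \<bar>Z k t\<bar> \<le> C" if "AE t in lborel. t \<in> {0..T} \<longrightarrow> \<bar>k t\<bar> \<le> C" for k
    using that by eventually_elim (auto simp: Z_def indicator_def C)
  note [measurable] = Zm[OF gn(1)] Zm[OF g0(1)]
  define G where "G k t = Z k t - indicator {0..T} t * f t" for k t
  have Gm: "G k \<in> borel_measurable borel" if "set_integrable lborel {0..T} k" for k
    using Zm[OF that] unfolding G_def by measurable
  have Gb: "AE t in lborel. \<bar>G k t\<bar> \<le> C + Cf" if "AE t in lborel. t \<in> {0..T} \<longrightarrow> \<bar>k t\<bar> \<le> C" for k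
    using Zb[OF that]
  proof eventually_elim
    case (elim t)
    have "0 \<le> Cf" using f(2)[of t] by linarith
    then have "\<bar>indicator {0..T} t * f t\<bar> \<le> Cf" using f(2)[of t] by (simp add: indicator_def)
    with elim show ?case unfolding G_def by linarith
  qed
  have Gi: "integrable lborel (\<lambda>t. G k t * q t)"
    if "set_integrable lborel {0..T} k" "AE t in lborel. t \<in> {0..T} \<longrightarrow> \<bar>k t\<bar> \<le> C"
      "q \<in> borel_measurable borel" "AE t in lborel. \<bar>q t\<bar> \<le> Q" for k q Q
  proof (rule integrableI_bounded_set[where A="{0..T}" and B="(C + Cf) * Q"])
    show "AE t in lborel. t \<in> {0..T} \<longrightarrow> norm (G k t * q t) \<le> (C + Cf) * Q"
      using Gb[OF that(2)] that(4)
    proof eventually_elim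
      case (elim t)
      have "\<bar>G k t\<bar> * \<bar>q t\<bar> \<le> (C + Cf) * Q" by (rule mult_mono) (use elim in auto)
      then show ?case by (simp add: abs_mult)
    qed
    show "(\<lambda>t. G k t * q t) \<in> borel_measurable lborel" using Gm[OF that(1)] that(3) by measurable
  qed (auto simp: G_def Z_def emeasure_lborel_Icc_eq)
  have Geq: "(LINT t:{0..T}|lborel. (k t - f t)\<^sup>2) = (LINT t|lborel. G k t * G k t)" for k
    unfolding set_lebesgue_integral_def
    by (rule Bochner_Integration.integral_cong) (auto simp: G_def Z_def indicator_def power2_eq_square)
  have db: "AE t in lborel. \<bar>Z (g n) t - Z g0 t\<bar> \<le> C + C" for n
    using Zb[OF gn(2)[of n]] Zb[OF g0(2)] by eventually_elim linarith
  have "(\<lambda>n. LINT t|lborel. G g0 t * (Z (g n) t - Z g0 t)) \<longlonglongrightarrow> 0"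
  proof (rule weak_convergence_of_cumulative[where a=0 and b=T and C="C + C", OF _ _ db])
    show "(\<lambda>t. Z (g n) t - Z g0 t) \<in> borel_measurable borel" for n by measurable
    show "Z (g n) t - Z g0 t = 0" if "t \<notin> {0..T}" for n t using that by (simp add: Z_def)
    show "integrable lborel (G g0)" using Gi[OF g0, of "\<lambda>_. 1" 1] by simp
    fix s assume s: "s \<le> T"
    have ci: "set_integrable lborel {0..T} (\<lambda>t. k t * indicator {..<s} t)" if "set_integrable lborel {0..T} k" for k :: "real \<Rightarrow> real"
      by (rule set_integrable_mult_bounded[OF that, where C=1]) (auto simp: indicator_def)
    have "(LINT t|lborel. indicator {..<s} t * (Z (g n) t - Z g0 t)) =
        (LINT t:{0..T}|lborel. g n t * indicator {..<s} t - g0 t * indicator {..<s} t)" for n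
      unfolding set_lebesgue_integral_def
      by (rule Bochner_Integration.integral_cong) (auto simp: Z_def algebra_simps)
    then have "(LINT t|lborel. indicator {..<s} t * (Z (g n) t - Z g0 t)) =
        (LINT t:{0..T}|lborel. g n t * indicator {..<s} t) - (LINT t:{0..T}|lborel. g0 t * indicator {..<s} t)" for n
      by (simp add: set_integral_diff ci gn g0)
    then show "(\<lambda>n. LINT t|lborel. indicator {..<s} t * (Z (g n) t - Z g0 t)) \<longlonglongrightarrow> 0"
      using cum[OF s] by (simp add: LIM_zero)
  qed (use C in simp)
  from tendsto_add[OF tendsto_const[of "LINT t|lborel. G g0 t * G g0 t"] tendsto_mult[OF tendsto_const[of 2] this]]
  have low: "(\<lambda>n. (LINT t|lborel. G g0 t * G g0 t) + 2 * (LINT t|lborel. G g0 t * (Z (g n) t - Z g0 t)))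
      \<longlonglongrightarrow> (LINT t|lborel. G g0 t * G g0 t)" by simp
  have "(LINT t|lborel. G g0 t * G g0 t) \<le> c"
  proof (rule LIMSEQ_le[OF low lim], intro exI allI impI)
    fix n
    have dm: "(\<lambda>t. Z (g n) t - Z g0 t) \<in> borel_measurable borel" by measurable
    note i = Gi[OF g0 Gm[OF g0(1)] Gb[OF g0(2)]] Gi[OF g0 dm db]
      Gi[OF gn[of n] Gm[OF gn(1)[of n]] Gb[OF gn(2)[of n]]]
    have "(LINT t|lborel. G g0 t * G g0 t) + 2 * (LINT t|lborel. G g0 t * (Z (g n) t - Z g0 t))
        = (LINT t|lborel. G g0 t * G g0 t + 2 * (G g0 t * (Z (g n) t - Z g0 t)))"
      using i by simp
    also have "\<dots> \<le> (LINT t|lborel. G (g n) t * G (g n) t)"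
    proof (rule Bochner_Integration.integral_mono)
      show "integrable lborel (\<lambda>t. G g0 t * G g0 t + 2 * (G g0 t * (Z (g n) t - Z g0 t)))" using i by simp
      show "integrable lborel (\<lambda>t. G (g n) t * G (g n) t)" by (rule i)
      fix t
      have "0 \<le> (Z (g n) t - Z g0 t)\<^sup>2" by simp
      then show "G g0 t * G g0 t + 2 * (G g0 t * (Z (g n) t - Z g0 t)) \<le> G (g n) t * G (g n) t"
        by (simp add: G_def power2_eq_square algebra_simps)
    qed
    finally show "(LINT t|lborel. G g0 t * G g0 t) + 2 * (LINT t|lborel. G g0 t * (Z (g n) t - Z g0 t))
        \<le> (LINT t:{0..T}|lborel. (g n t - f t)\<^sup>2)"
      by (simp add: Geq)
  qed
  then show ?thesis by (simp add: Geq)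
qed

section \<open>Continuous dependence on the control\<close>

lemma velocity_V_tendsto:
  assumes vn: "\<And>n. velocity (vn n) vmin vmax" and v: "velocity v vmin vmax"
    and lim: "\<And>t. (\<lambda>n. vn n t) \<longlonglongrightarrow> v t" and t: "0 \<le> t"
  shows "(\<lambda>n. velocity.V (vn n) t) \<longlonglongrightarrow> velocity.V v t"
proof -
  have V: "velocity.V w t = (LINT s:{0..t}|lborel. w s)" if "velocity w vmin vmax" for w
    using velocity.V_diff[OF that t] velocity.V_0[OF that] by simp
  have "(\<lambda>n. LINT s:{0..t}|lborel. vn n s) \<longlonglongrightarrow> (LINT s:{0..t}|lborel. v s)"
    by (rule set_integral_dominated_bounded[where B=vmax])
      (use velocity.v_measurable[OF vn] velocity.v_measurable[OF v] velocity.abs_v_le[OF vn] lim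
        in \<open>auto simp: emeasure_lborel_Icc_eq\<close>)
  then show ?thesis by (simp add: V vn v)
qed

text \<open>An indicator of a half-line converges unless its argument tends to the jump at 0. As
  \<open>V\<close> is injective, each of the two integrals has at most one such point.\<close>

lemma traffic_departed_tendsto:
  assumes vn: "\<And>n. traffic (vn n) vmin vmax L T \<rho>cr \<rho>max \<rho>0 In" and v: "traffic v vmin vmax L T \<rho>cr \<rho>max \<rho>0 In"
    and lim: "\<And>t. (\<lambda>n. vn n t) \<longlonglongrightarrow> v t" and ts: "0 \<le> ts"
  shows "(\<lambda>n. traffic.departed (vn n) L T \<rho>0 In ts) \<longlonglongrightarrow> traffic.departed v L T \<rho>0 In ts"
proof -
  interpret traffic v vmin vmax L T \<rho>cr \<rho>max \<rho>0 In by (rule v)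
  define Vn where "Vn n = velocity.V (vn n)" for n
  have vel: "velocity (vn n) vmin vmax" for n using vn[of n] by (simp add: traffic_def)
  have Vlim: "(\<lambda>n. Vn n t) \<longlonglongrightarrow> V t" if "0 \<le> t" for t
    unfolding Vn_def by (rule velocity_V_tendsto[OF vel velocity_axioms lim that])
  have Vm [measurable]: "Vn n \<in> borel_measurable borel" for n unfolding Vn_def by (rule velocity.V_measurable[OF vel])
  have dep: "traffic.departed (vn n) L T \<rho>0 In ts = (LINT x:{0..L}|lborel. \<rho>0 x * indicator {0<..} (Vn n ts - L + x)) +
     (LINT s:{0..T}|lborel. In s * indicator {0<..} (Vn n ts - L - Vn n s))" for n
    by (simp add: traffic.departed_def[OF vn] Vn_def)
  have ind: "(\<lambda>n. indicator {0<..} (y n) :: real) \<longlonglongrightarrow> indicator {0<..} y0" if "y \<longlonglongrightarrow> y0" "y0 \<noteq> 0" for y :: "nat \<Rightarrow> real" and y0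
  proof (rule tendsto_eventually)
    show "\<forall>\<^sub>F n in sequentially. indicator {0<..} (y n) = (indicator {0<..} y0 :: real)"
    proof (cases "0 < y0")
      case True
      then show ?thesis using order_tendstoD(1)[OF that(1) True] by (auto elim!: eventually_mono)
    next
      case False
      with that(2) have "y0 < 0" by simp
      from order_tendstoD(2)[OF that(1) this] show ?thesis
        by eventually_elim (use False in auto)
    qed
  qed
  have ib: "\<bar>indicator {0<..} y :: real\<bar> \<le> 1" for y :: real by (simp add: indicator_def)
  have "(\<lambda>n. LINT x:{0..L}|lborel. \<rho>0 x * indicator {0<..} (Vn n ts - L + x)) \<longlonglongrightarrow>
      (LINT x:{0..L}|lborel. \<rho>0 x * indicator {0<..} (V ts - L + x))"
  proof (rule set_integral_weighted_limit[OF rho0_integrable _ _ ib])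
    show "AE x in lborel. x \<in> {0..L} \<longrightarrow> (\<lambda>n. indicator {0<..} (Vn n ts - L + x) :: real) \<longlonglongrightarrow> indicator {0<..} (V ts - L + x)"
      using AE_lborel_singleton[of "L - V ts"]
      by eventually_elim (intro impI ind tendsto_intros Vlim ts, auto)
  qed measurable
  moreover have "(\<lambda>n. LINT s:{0..T}|lborel. In s * indicator {0<..} (Vn n ts - L - Vn n s)) \<longlonglongrightarrow>
      (LINT s:{0..T}|lborel. In s * indicator {0<..} (V ts - L - V s))"
  proof (rule set_integral_weighted_limit[OF In_integrable _ _ ib])
    show "AE s in lborel. s \<in> {0..T} \<longrightarrow> (\<lambda>n. indicator {0<..} (Vn n ts - L - Vn n s) :: real) \<longlonglongrightarrow> indicator {0<..} (V ts - L - V s)"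
      using AE_lborel_singleton[of "V_inv (V ts - L)"]
    proof eventually_elim
      case (elim s)
      show ?case
      proof
        assume "s \<in> {0..T}"
        moreover have "V ts - L - V s \<noteq> 0"
        proof
          assume "V ts - L - V s = 0"
          then have "V_inv (V ts - L) = V_inv (V s)" by simp
          then show False using elim by simp
        qed
        ultimately show "(\<lambda>n. indicator {0<..} (Vn n ts - L - Vn n s) :: real) \<longlonglongrightarrow> indicator {0<..} (V ts - L - V s)"
          by (intro ind tendsto_intros Vlim ts) auto
      qed
    qed
  qed measurable
  ultimately show ?thesis unfolding dep departed_def by (rule tendsto_add)
qed

section \<open>Existence of an optimal control\<close>

lemma L1_trace_cong_limit:
  assumes "\<And>y. y \<in> I \<Longrightarrow> g y = g' y"
  shows "L1_trace w s0 S I g \<longleftrightarrow> L1_trace w s0 S I g'"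
proof -
  have "(\<lambda>y. indicator I y *\<^sub>R g y) = (\<lambda>y. indicator I y *\<^sub>R g' y)"
    "(\<lambda>y. indicator I y *\<^sub>R \<bar>w s y - g y\<bar>) = (\<lambda>y. indicator I y *\<^sub>R \<bar>w s y - g' y\<bar>)" for s
    using assms by (auto simp: indicator_def)
  then show ?thesis by (simp add: L1_trace_def set_integrable_def set_lebesgue_integral_def)
qed

lemma entropy_solution_cong:
  assumes v: "\<And>t. t \<in> {0..T} \<Longrightarrow> v t = v' t" and In: "\<And>t. t \<in> {0..T} \<Longrightarrow> In t = In' t"
    and \<rho>0: "\<And>x. x \<in> {0..L} \<Longrightarrow> \<rho>0 x = \<rho>0' x"
  shows "entropy_solution L T \<rho>cr \<rho>max \<rho>0 In v \<rho> \<longleftrightarrow> entropy_solution L T \<rho>cr \<rho>max \<rho>0' In' v' \<rho>"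
proof -
  have "kruzhkov_inequalities L T \<rho>cr \<rho>max v \<rho> \<longleftrightarrow> kruzhkov_inequalities L T \<rho>cr \<rho>max v' \<rho>"
    unfolding kruzhkov_inequalities_def
    by (intro ball_cong refl all_cong1 imp_cong arg_cong[where f="\<lambda>x. 0 \<le> x"] set_lebesgue_integral_cong)
      (auto simp: v emeasure_lborel_rect)
  moreover have "initial_trace L T \<rho> \<rho>0 \<longleftrightarrow> initial_trace L T \<rho> \<rho>0'"
    by (rule L1_trace_cong_limit) (rule \<rho>0)
  moreover have "left_trace L T \<rho> (\<lambda>t. In t / v t) \<longleftrightarrow> left_trace L T \<rho> (\<lambda>t. In' t / v' t)"
    by (rule L1_trace_cong_limit) (simp add: v In)
  moreover have "(AE t in lborel. t \<in> {0..T} \<longrightarrow> newell_daganzo_flux \<rho>cr \<rho>max (r t) (v t) = r t * v t) \<longleftrightarrow>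
      (AE t in lborel. t \<in> {0..T} \<longrightarrow> newell_daganzo_flux \<rho>cr \<rho>max (r t) (v' t) = r t * v' t)" for r
    by (intro AE_cong imp_cong refl) (simp add: v)
  ultimately show ?thesis unfolding entropy_solution_def by simp
qed

text \<open>It allows all data to be replaced by their clamped extensions, for which the global
  assumptions of \<open>traffic\<close> hold.\<close>

lemma cost_cong:
  assumes v: "\<And>t. t \<in> {0..T} \<Longrightarrow> v t = v' t" and In: "\<And>t. t \<in> {0..T} \<Longrightarrow> In t = In' t"
    and \<rho>0: "\<And>x. x \<in> {0..L} \<Longrightarrow> \<rho>0 x = \<rho>0' x" and g: "\<And>t. t \<in> {0..T} \<Longrightarrow> g t = g' t"
  shows "cost L T \<rho>cr \<rho>max \<rho>0 In g v = cost L T \<rho>cr \<rho>max \<rho>0' In' g' v'"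
proof -
  \<comment> \<open>Equality of the predicates themselves makes \<open>SOME\<close> choose the same
    solution, hence the same trace.\<close>
  have eq: "entropy_solution L T \<rho>cr \<rho>max \<rho>0 In v = entropy_solution L T \<rho>cr \<rho>max \<rho>0' In' v'"
    by (rule ext) (rule entropy_solution_cong[OF v In \<rho>0])
  have "outflow L T \<rho>cr \<rho>max \<rho>0 In v t = outflow L T \<rho>cr \<rho>max \<rho>0' In' v' t" if "t \<in> {0..T}" for t
    unfolding outflow_def eq using v[OF that] by (simp add: Let_def)
  then show ?thesis unfolding cost_def by (intro set_lebesgue_integral_cong) (auto simp: g)
qed

theorem proposition4:
  fixes L T vmin vmax \<rho>cr \<rho>max \<rho>0min \<rho>0max fmin fmax K :: real
    and \<rho>0 In fstar :: "real \<Rightarrow> real"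
  assumes "0 < L" and "0 < T"
    and "0 < vmin" and "vmin \<le> vmax"
    and "0 < \<rho>cr" and "\<rho>cr < \<rho>max"
    and "0 < \<rho>0min" and "\<rho>0min \<le> \<rho>0max" and "\<rho>0max \<le> \<rho>cr"
    and "0 < fmin" and "fmin \<le> fmax"
    and "\<rho>0min \<le> fmin / vmax" and "\<rho>0max \<ge> fmax / vmin"
    and "0 < K"
    and "\<rho>0 \<in> BV 0 L {\<rho>0min..\<rho>0max}"
    and "In \<in> BV 0 T {fmin..fmax}"
    and "fstar \<in> BV 0 T {fmin..fmax}"
  shows "\<exists>v \<in> BV 0 T {vmin..vmax}. total_variation 0 T v \<le> ereal K \<and>
           (\<forall>w \<in> BV 0 T {vmin..vmax}. total_variation 0 T w \<le> ereal K \<longrightarrow>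
              cost L T \<rho>cr \<rho>max \<rho>0 In fstar v \<le> cost L T \<rho>cr \<rho>max \<rho>0 In fstar w)"
proof -
  define S where "S = {w \<in> BV 0 T {vmin..vmax}. total_variation 0 T w \<le> ereal K}"
  define J where "J = cost L T \<rho>cr \<rho>max \<rho>0 In fstar"
  define ve where "ve = clamp_ext 0 T"
  define \<rho>e where "\<rho>e = clamp_ext 0 L \<rho>0"
  have T0: "0 \<le> T" and L0: "0 \<le> L" using assms by simp_all
  have \<rho>e: "\<rho>0min \<le> \<rho>e x" "\<rho>e x \<le> \<rho>0max" for x
    using clamp_ext_in[OF L0, of \<rho>0 "{\<rho>0min..\<rho>0max}" x] \<open>\<rho>0 \<in> _\<close> by (auto simp: BV_def \<rho>e_def)
  have Ine: "fmin \<le> ve In t" "ve In t \<le> fmax" for t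
    using clamp_ext_in[OF T0, of In "{fmin..fmax}" t] \<open>In \<in> _\<close> by (auto simp: BV_def ve_def)
  have fe: "fmin \<le> ve fstar t" "ve fstar t \<le> fmax" for t
    using clamp_ext_in[OF T0, of fstar "{fmin..fmax}" t] \<open>fstar \<in> _\<close> by (auto simp: BV_def ve_def)
  have traffic: "traffic (ve w) vmin vmax L T \<rho>cr \<rho>max \<rho>e (ve In)" if w: "w \<in> BV 0 T {vmin..vmax}" for w
  proof
    have b: "vmin \<le> ve w t" "ve w t \<le> vmax" for t
      using clamp_ext_in[OF T0, of w "{vmin..vmax}" t] w by (auto simp: BV_def ve_def)
    then show "vmin \<le> ve w t" "ve w t \<le> vmax" for t by blast+
    show "ve w \<in> borel_measurable borel" "countable {t. \<not> isCont (ve w) t}"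
      unfolding ve_def by (rule clamp_ext_BV[OF T0 w])+
    show "ve In \<in> borel_measurable borel" "countable {t. \<not> isCont (ve In) t}"
      unfolding ve_def by (rule clamp_ext_BV[OF T0 \<open>In \<in> _\<close>])+
    show "\<rho>e \<in> borel_measurable borel" "countable {t. \<not> isCont \<rho>e t}"
      unfolding \<rho>e_def by (rule clamp_ext_BV[OF L0 \<open>\<rho>0 \<in> _\<close>])+
    \<comment> \<open>The inflow density is at most fmax / vmin, which is bounded by
      \<open>\<rho>0max\<close> and so by \<open>\<rho>cr\<close>, uniformly in the control.\<close>
    show "ve In t / ve w s \<le> \<rho>cr" for s t
    proof -
      have "ve In t / ve w s \<le> fmax / vmin"
        using Ine[of t] b[of s] assms by (intro frac_le) auto
      then show ?thesis using assms by linarith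
    qed
    show "0 \<le> \<rho>e x" "\<rho>e x \<le> \<rho>cr" for x using \<rho>e[of x] assms by linarith+
    show "0 \<le> ve In t" for t using Ine[of t] assms by linarith
  qed (use assms in auto)
  have J: "J w = cost L T \<rho>cr \<rho>max \<rho>e (ve In) (ve fstar) (ve w)" for w
    unfolding J_def by (rule cost_cong) (simp_all add: ve_def \<rho>e_def)
  have J0: "0 \<le> J w" for w
    unfolding J_def cost_def set_lebesgue_integral_def by (rule Bochner_Integration.integral_nonneg) simp
  \<comment> \<open>A constant control has variation 0 and shows that the admissible set is
    nonempty.\<close>
  have "total_variation 0 T (\<lambda>_. vmin) \<le> ereal 0"
    unfolding total_variation_le_iff by simp
  moreover have "ereal 0 \<le> ereal K" using assms by simp
  ultimately have "total_variation 0 T (\<lambda>_. vmin) \<le> ereal K" by (rule order_trans)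
  then have ne: "S \<noteq> {}" using assms by (auto simp: S_def BV_def intro!: exI[of _ "\<lambda>_. vmin"] elim: le_less_trans)
  have bdd: "bdd_below (J ` S)" using J0 by (intro bdd_belowI[of _ 0]) auto
  define m where "m = (INF w\<in>S. J w)"
  have "\<exists>w\<in>S. J w < m + 1 / real (Suc n)" for n
    unfolding m_def by (rule cINF_less_iff[OF ne bdd, THEN iffD1]) simp
  then obtain w where w: "\<And>n. w n \<in> S" "\<And>n. J (w n) < m + 1 / real (Suc n)" by metis
  have mle: "m \<le> J u" if "u \<in> S" for u unfolding m_def by (rule cINF_lower[OF bdd that])
  have "(\<lambda>n. J (w n)) \<longlonglongrightarrow> m"
  proof (rule tendsto_sandwich[OF _ _ tendsto_const])
    show "(\<lambda>n. m + 1 / real (Suc n)) \<longlonglongrightarrow> m"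
      using tendsto_add[OF tendsto_const[of m] tendsto_Suc_over[of 1]] by simp
    show "\<forall>\<^sub>F n in sequentially. J (w n) \<le> m + 1 / real (Suc n)"
      by (intro always_eventually allI less_imp_le w)
    show "\<forall>\<^sub>F n in sequentially. m \<le> J (w n)"
      by (intro always_eventually allI mle w)
  qed
  moreover obtain k v where k: "strict_mono (k :: nat \<Rightarrow> nat)"
    and v: "\<And>t. t \<in> {0..T} \<Longrightarrow> (\<lambda>n. w (k n) t) \<longlonglongrightarrow> v t" "v ` {0..T} \<subseteq> {vmin..vmax}" "total_variation 0 T v \<le> ereal K"
    using Helly_selection_BV[OF T0, of w vmin vmax K] w(1) unfolding S_def BV_def by blast
  ultimately have Jlim: "(\<lambda>n. J (w (k n))) \<longlonglongrightarrow> m"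
    using LIMSEQ_subseq_LIMSEQ[of "\<lambda>n. J (w n)" m k] by (simp add: o_def)
  have vBV: "v \<in> BV 0 T {vmin..vmax}" using v by (auto simp: BV_def elim: le_less_trans)
  have wBV: "w n \<in> BV 0 T {vmin..vmax}" for n using w(1)[of n] by (simp add: S_def)
  note tn = traffic[OF wBV] and t = traffic[OF vBV]
  \<comment> \<open>Clamping evaluates at a point of [0,T], so the convergence given by Helly's
    theorem holds on the whole line.\<close>
  have velim: "(\<lambda>n. ve (w (k n)) s) \<longlonglongrightarrow> ve v s" for s
    unfolding ve_def clamp_ext_def by (rule v) (use T0 in auto)
  define Out where "Out u = outflow L T \<rho>cr \<rho>max \<rho>e (ve In) (ve u)" for u
  have "(LINT s:{0..T}|lborel. (Out v s - ve fstar s)\<^sup>2) \<le> m"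
  proof (rule square_cost_lower_semicontinuous[where g="\<lambda>n. Out (w (k n))" and C="\<rho>cr * vmax"])
    show "set_integrable lborel {0..T} (Out (w (k n)))" "AE s in lborel. s \<in> {0..T} \<longrightarrow> \<bar>Out (w (k n)) s\<bar> \<le> \<rho>cr * vmax" for n
      unfolding Out_def using traffic.outflow_characterization(1,2)[OF tn] by auto
    show "set_integrable lborel {0..T} (Out v)" "AE s in lborel. s \<in> {0..T} \<longrightarrow> \<bar>Out v s\<bar> \<le> \<rho>cr * vmax"
      unfolding Out_def using traffic.outflow_characterization(1,2)[OF t] by auto
    show "0 \<le> \<rho>cr * vmax" using assms by simp
    show "(\<lambda>n. LINT s:{0..T}|lborel. Out (w (k n)) s * indicator {..<r} s) \<longlonglongrightarrow> (LINT s:{0..T}|lborel. Out v s * indicator {..<r} s)"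
      if r: "r \<le> T" for r
    proof (cases "0 \<le> r")
      case True
      show ?thesis
        unfolding Out_def traffic.outflow_characterization(3)[OF tn r] traffic.outflow_characterization(3)[OF t r]
        by (rule traffic_departed_tendsto[OF tn t velim True])
    next
      \<comment> \<open>The convergence of \<open>departed\<close> is available for nonnegative
        times; for a negative one both integrals are 0.\<close>
      case False
      then have "(LINT s:{0..T}|lborel. g s * indicator {..<r} s) = 0" for g :: "real \<Rightarrow> real"
        unfolding set_lebesgue_integral_def by (intro integral_eq_zero_AE AE_I2) (auto simp: indicator_def)
      then show ?thesis by simp
    qed
    show "ve fstar \<in> borel_measurable borel" unfolding ve_def by (rule clamp_ext_BV[OF T0 \<open>fstar \<in> _\<close>])
    show "\<bar>ve fstar s\<bar> \<le> fmax" for s using fe[of s] assms by simp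
    show "(\<lambda>n. LINT s:{0..T}|lborel. (Out (w (k n)) s - ve fstar s)\<^sup>2) \<longlonglongrightarrow> m"
      using Jlim unfolding J cost_def Out_def .
  qed
  then have "J v \<le> m" unfolding J cost_def Out_def .
  with mle have "\<forall>u\<in>S. J v \<le> J u" by (auto intro: order_trans)
  then show ?thesis
    using vBV v(3) unfolding S_def J_def by blast
qed

end
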